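(* Let $n$ and $d$ be positive integers, and let $\mathsf{X}$ be the $P(d) \times P(d)$ matrix with rows and columns indexed by the partitions of $d$ whose entry in row $\lambda$ and column $\mu$ is $\chi_\lambda(\sigma_\mu)$ (the character table of $S_d$). Then $A^n_d = \mathsf{X} D \mathsf{X}^{-1}$, where $D$ is a diagonal matrix whose diagonal entries are powers of $n$.
   Context: $P(d)$ is the number of partitions of $d$; all indexing by partitions of $d$ is in reverse lexicographical order. $\chi_\lambda$ is the character of the irreducible representation $H_\lambda$ of the symmetric group $S_d$ (in characteristic $0$) corresponding to the partition $\lambda$ of $d$. For a partition $\mu = (\mu_1,\dots,\mu_p)$ of $d$, $\sigma_\mu \in S_d$ is a product of disjoint cycles of lengths $\mu_1, \dots, \mu_p$. For partitions $\lambda, \beta_1, \dots, \beta_n$, the generalized Littlewood--Richardson coefficient $c^\lambda_{\beta_1,\dots,\beta_n}$ is the coefficient of the Schur function $s_\lambda$ in the product $s_{\beta_1} \cdots s_{\beta_n}$. For partitions $\lambda,\mu$ of $d$, put $a^n_{\lambda,\mu} = \sum_{\beta_1,\dots,\beta_n} c^\lambda_{\beta_1,\dots,\beta_n} c^\mu_{\beta_1,\dots,\beta_n}$, the sum being over all $n$-tuples of partitions, and $A^n_d = (a^n_{\lambda,\mu})$. *)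

theory Defs
  imports
    "Jordan_Normal_Form.Matrix"
    "HOL-Combinatorics.Combinatorics"
    "HOL-Library.Function_Algebras"
    "HOL-Library.FuncSet"
    "HOL-Library.Multiset"
    "HOL-Library.List_Lexorder"
begin

section \<open>Partitions\<close>

definition is_partition :: "nat list \<Rightarrow> bool" where
  "is_partition l \<longleftrightarrow> sorted_wrt (\<ge>) l \<and> 0 \<notin> set l"

definition partitions :: "nat \<Rightarrow> nat list set" where
  "partitions d = {l. is_partition l \<and> sum_list l = d}"

lemma finite_partitions: "finite (partitions d)"
proof -
  have len: "length l \<le> sum_list l" if "0 \<notin> set l" for l :: "nat list"
    using that by (induction l) auto
  have "partitions d \<subseteq> {l. set l \<subseteq> {..d} \<and> length l \<le> d}"
    using len by (auto simp: partitions_def is_partition_def intro: member_le_sum_list)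
  then show ?thesis
    using finite_lists_length_le[of "{..d}" d] finite_subset by blast
qed

text \<open>Reverse lexicographical order: the list starts with \<open>[d]\<close> and ends with
  \<open>[1, \<dots>, 1]\<close>.\<close>

definition partition_list :: "nat \<Rightarrow> nat list list" where
  "partition_list d = rev (sorted_list_of_set (partitions d))"

definition num_partitions :: "nat \<Rightarrow> nat" where
  "num_partitions d = card (partitions d)"

definition cells :: "nat list \<Rightarrow> (nat \<times> nat) set" where
  "cells l = {(i, j). i < length l \<and> j < l ! i}"


section \<open>Irreducible characters of the symmetric group\<close>

interpretation fun_space: vector_space "\<lambda>(c :: 'k :: field) (f :: 'b \<Rightarrow> 'k) x. c * f x"
  by unfold_locales (auto simp: fun_eq_iff algebra_simps)

text \<open>The trace of an endomorphism \<open>T\<close> of a finite-dimensional space \<open>V\<close> of functions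
  (it does not depend on the chosen basis of \<open>V\<close>).\<close>

definition trace_on :: "('b \<Rightarrow> 'k :: field) set \<Rightarrow> (('b \<Rightarrow> 'k) \<Rightarrow> ('b \<Rightarrow> 'k)) \<Rightarrow> 'k" where
  "trace_on V T =
    (let B = (SOME B. fun_space.independent B \<and> fun_space.span B = V)
     in \<Sum>b\<in>B. fun_space.representation B (T b) b)"

text \<open>The symmetric group on \<open>d\<close> letters is the set of permutations of \<open>{..<d}\<close>. Its group
  algebra consists of the functions on permutations vanishing outside of this set, a function
  \<open>f\<close> standing for the formal sum of the \<open>f p\<close> times \<open>p\<close>.\<close>

definition group_alg :: "nat \<Rightarrow> ((nat \<Rightarrow> nat) \<Rightarrow> 'k :: field) set" where
  "group_alg d = {f. \<forall>p. \<not> p permutes {..<d} \<longrightarrow> f p = 0}"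

definition group_alg_mult ::
  "nat \<Rightarrow> ((nat \<Rightarrow> nat) \<Rightarrow> 'k :: field) \<Rightarrow> ((nat \<Rightarrow> nat) \<Rightarrow> 'k) \<Rightarrow> (nat \<Rightarrow> nat) \<Rightarrow> 'k" where
  "group_alg_mult d f g = (\<lambda>p. \<Sum>q | q permutes {..<d}. f q * g (Hilbert_Choice.inv q \<circ> p))"

text \<open>Left multiplication by the group element \<open>s\<close>.\<close>

definition perm_act :: "(nat \<Rightarrow> nat) \<Rightarrow> ((nat \<Rightarrow> nat) \<Rightarrow> 'k) \<Rightarrow> (nat \<Rightarrow> nat) \<Rightarrow> 'k" where
  "perm_act s f = (\<lambda>p. f (Hilbert_Choice.inv s \<circ> p))"

text \<open>The tableau of shape \<open>l\<close> in which the entries \<open>0, 1, \<dots>, d - 1\<close> are filled in row by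
  row.\<close>

definition std_entry :: "nat list \<Rightarrow> nat \<Rightarrow> nat \<Rightarrow> nat" where
  "std_entry l i j = sum_list (take i l) + j"

definition row_group :: "nat list \<Rightarrow> (nat \<Rightarrow> nat) set" where
  "row_group l = {p. p permutes {..<sum_list l} \<and>
     (\<forall>i. p ` {std_entry l i j | j. (i, j) \<in> cells l} = {std_entry l i j | j. (i, j) \<in> cells l})}"

definition col_group :: "nat list \<Rightarrow> (nat \<Rightarrow> nat) set" where
  "col_group l = {p. p permutes {..<sum_list l} \<and>
     (\<forall>j. p ` {std_entry l i j | i. (i, j) \<in> cells l} = {std_entry l i j | i. (i, j) \<in> cells l})}"

definition young_symmetrizer :: "nat list \<Rightarrow> (nat \<Rightarrow> nat) \<Rightarrow> 'k :: field" where
  "young_symmetrizer l = group_alg_mult (sum_list l)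
     (\<lambda>p. if p \<in> row_group l then 1 else 0)
     (\<lambda>p. if p \<in> col_group l then of_int (sign p) else 0)"

text \<open>The irreducible representation attached to \<open>l\<close> is the left ideal of the group algebra
  generated by the Young symmetrizer; thus \<open>[d]\<close> gives the trivial and \<open>[1, \<dots>, 1]\<close> the sign
  representation.\<close>

definition irrep :: "nat list \<Rightarrow> ((nat \<Rightarrow> nat) \<Rightarrow> 'k :: field) set" where
  "irrep l = (\<lambda>x. group_alg_mult (sum_list l) x (young_symmetrizer l)) ` group_alg (sum_list l)"

definition irr_char :: "nat list \<Rightarrow> (nat \<Rightarrow> nat) \<Rightarrow> 'k :: field_char_0" where
  "irr_char l s = trace_on (irrep l) (perm_act s)"

definition is_cycle_product :: "nat \<Rightarrow> nat list \<Rightarrow> (nat \<Rightarrow> nat) \<Rightarrow> bool" where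
  "is_cycle_product d m s \<longleftrightarrow>
    (\<exists>cs. map length cs = m \<and> distinct (concat cs) \<and> set (concat cs) = {..<d} \<and>
          s = foldr (\<circ>) (map cycle_of_list cs) id)"


section \<open>Schur functions and Littlewood--Richardson coefficients\<close>

definition ssyt :: "nat list \<Rightarrow> (nat \<times> nat \<Rightarrow> nat) set" where
  "ssyt l = {T \<in> cells l \<rightarrow>\<^sub>E UNIV.
     (\<forall>i j j'. (i, j) \<in> cells l \<and> (i, j') \<in> cells l \<and> j < j' \<longrightarrow> T (i, j) \<le> T (i, j')) \<and>
     (\<forall>i i' j. (i, j) \<in> cells l \<and> (i', j) \<in> cells l \<and> i < i' \<longrightarrow> T (i, j) < T (i', j))}"

text \<open>A formal power series in the variables \<open>x\<^sub>0, x\<^sub>1, \<dots>\<close> is given by its coefficients; a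
  monomial is represented by the multiset of the indices of its variables.\<close>

type_synonym series = "nat multiset \<Rightarrow> int"

definition series_one :: series where
  "series_one = (\<lambda>M. if M = {#} then 1 else 0)"

definition series_mult :: "series \<Rightarrow> series \<Rightarrow> series" where
  "series_mult f g = (\<lambda>M. \<Sum>N | N \<subseteq># M. f N * g (M - N))"

definition schur :: "nat list \<Rightarrow> series" where
  "schur l = (\<lambda>M. int (card {T \<in> ssyt l. image_mset T (mset_set (cells l)) = M}))"

definition schur_prod :: "nat list list \<Rightarrow> series" where
  "schur_prod bs = foldr series_mult (map schur bs) series_one"

text \<open>The Schur functions form a basis of the ring of symmetric functions, so the finitely
  supported coefficient family below is unique.\<close>

definition lr_coeff :: "nat list \<Rightarrow> nat list list \<Rightarrow> int" where
  "lr_coeff l bs =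
    (THE c. finite {m. c m \<noteq> 0} \<and> (\<forall>m. c m \<noteq> 0 \<longrightarrow> is_partition m) \<and>
            schur_prod bs = (\<lambda>M. \<Sum>m | c m \<noteq> 0. c m * schur m M)) l"

text \<open>The sum runs over all \<open>n\<close>-tuples of partitions; as only finitely many terms are nonzero
  (the sizes of the entries must add up to that of \<open>l\<close>), it is written as a sum over the
  support, since \<^const>\<open>sum\<close> is zero on infinite index sets.\<close>

definition a_coeff :: "nat \<Rightarrow> nat list \<Rightarrow> nat list \<Rightarrow> int" where
  "a_coeff n l m =
    (\<Sum>bs | length bs = n \<and> (\<forall>b\<in>set bs. is_partition b) \<and> lr_coeff l bs * lr_coeff m bs \<noteq> 0.
       lr_coeff l bs * lr_coeff m bs)"


section \<open>The matrices\<close>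

definition A_mat :: "nat \<Rightarrow> nat \<Rightarrow> 'k :: field_char_0 mat" where
  "A_mat n d = mat (num_partitions d) (num_partitions d)
     (\<lambda>(i, j). of_int (a_coeff n (partition_list d ! i) (partition_list d ! j)))"

text \<open>Here \<open>\<sigma> m\<close> is the chosen permutation of cycle type \<open>m\<close>.\<close>

definition char_table :: "nat \<Rightarrow> (nat list \<Rightarrow> nat \<Rightarrow> nat) \<Rightarrow> 'k :: field_char_0 mat" where
  "char_table d \<sigma> = mat (num_partitions d) (num_partitions d)
     (\<lambda>(i, j). irr_char (partition_list d ! i) (\<sigma> (partition_list d ! j)))"

end

theory Submission
  imports Defs "Jordan_Normal_Form.Determinant"
begin

text \<open>Let \<open>K\<close> be the matrix of numbers of semistandard tableaux, \<open>K l m\<close> counting those of shape \<open>l\<close> and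
  content \<open>m\<close>, and \<open>\<Phi>\<close> the matrix of the values at the \<open>\<sigma> m\<close> of the characters of the permutation
  representations on functions with content \<open>l\<close>. Expanding the \<open>n\<close>-th power of the Cauchy kernel in
  two ways shows that \<open>K\<^sup>T A K\<close> counts matrices of natural numbers whose entries are distributed
  over \<open>n\<close> colours, with prescribed row and column sums. Counting the same objects as orbits of the
  symmetric group gives \<open>K\<^sup>T A K = \<Phi> W D \<Phi>\<^sup>T\<close>, where \<open>W\<close> holds the relative sizes of the conjugacy
  classes and \<open>D\<close> the numbers of colourings fixed by the \<open>\<sigma> m\<close>, which are powers of \<open>n\<close>; for
  \<open>n = 1\<close> it reads \<open>K\<^sup>T K = \<Phi> W \<Phi>\<^sup>T\<close>. On the other hand the irreducible characters satisfy
  \<open>X W X\<^sup>T = 1\<close>, and \<open>L = X W \<Phi>\<^sup>T\<close> is upper unitriangular like \<open>K\<close>. Then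
  \<open>L\<^sup>T L = \<Phi> W \<Phi>\<^sup>T = K\<^sup>T K\<close>, and uniqueness of the Cholesky decomposition gives \<open>L = K\<close>, whence
  \<open>A = X W D X\<^sup>T = X D X\<^sup>-\<^sup>1\<close>.\<close>

section \<open>Shapes and tableaux\<close>

text \<open>The difficulty is that Littlewood-Richardson coefficients are defined through Schur
  functions and characters as traces on left ideals, while the classical bridge between the two, the
  Frobenius character formula, would have to be built. The permutation characters serve as the
  bridge instead. Their mutual inner products are numbers of matrices with given margins, which the
  Cauchy identity expresses by Kostka numbers. Their inner products with irreducible characters are
  accessible from Young symmetrizers, though directly only up to unitriangularity. The equation
  \<open>L = K\<close>, which is Young's rule, thus comes out of linear algebra instead of a
  comparison of tableaux with representations. As the field is any field of characteristic 0, no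
  positivity is available, and uniqueness of the Cholesky factor rests on the unit diagonals. The
  pairings contain no inverse because the characters in question agree at \<open>s\<close> and
  \<open>pinv s\<close>. The exponent of \<open>n\<close> at a partition is the number of orbits of
  the chosen permutation, fixed points included.\<close>

definition is_shape :: "(nat \<Rightarrow> nat) \<Rightarrow> bool" where
  "is_shape f \<longleftrightarrow> (\<forall>i. f (Suc i) \<le> f i) \<and> (\<exists>N. \<forall>i\<ge>N. f i = 0)"

definition shape_size :: "(nat \<Rightarrow> nat) \<Rightarrow> nat" where
  "shape_size f = (\<Sum>i | f i \<noteq> 0. f i)"

definition shape_cells :: "(nat \<Rightarrow> nat) \<Rightarrow> (nat \<times> nat) set" where
  "shape_cells f = {(i, j). j < f i}"

text \<open>The skew shape \<open>f / g\<close> is a horizontal strip; in a tableau, the cells with the largest entry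
  form one.\<close>

definition hstrip :: "(nat \<Rightarrow> nat) \<Rightarrow> (nat \<Rightarrow> nat) \<Rightarrow> bool" where
  "hstrip f g \<longleftrightarrow> (\<forall>i. g i \<le> f i \<and> f (Suc i) \<le> g i)"

definition tableaux :: "(nat \<Rightarrow> nat) \<Rightarrow> (nat \<times> nat \<Rightarrow> nat) set" where
  "tableaux f = {T \<in> shape_cells f \<rightarrow>\<^sub>E UNIV.
     (\<forall>i j j'. j < j' \<longrightarrow> j' < f i \<longrightarrow> T (i, j) \<le> T (i, j')) \<and>
     (\<forall>i i' j. i < i' \<longrightarrow> j < f i' \<longrightarrow> T (i, j) < T (i', j))}"

text \<open>Contents are multisets of arbitrary numbers rather than partitions, so that discarding
  the largest value and permuting values, the two operations of the inductions below, stay within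
  the notion.\<close>

definition kostka :: "(nat \<Rightarrow> nat) \<Rightarrow> nat multiset \<Rightarrow> nat" where
  "kostka f M = card {T \<in> tableaux f. image_mset T (mset_set (shape_cells f)) = M}"

lemma shape_mono: "is_shape f \<Longrightarrow> i \<le> j \<Longrightarrow> f j \<le> f i"
  unfolding is_shape_def by (metis lift_Suc_antimono_le)

lemma shape_size_eq:
  assumes "\<And>i. i \<ge> N \<Longrightarrow> f i = 0" shows "shape_size f = (\<Sum>i<N. f i)"
proof -
  have "i < N" if "f i \<noteq> 0" for i using assms[of i] that by linarith
  then have "{i. f i \<noteq> 0} \<subseteq> {..<N}" by auto
  then show ?thesis unfolding shape_size_def by (intro sum.mono_neutral_left) auto
qed

lemma shape_obtain_bound:
  assumes "is_shape f" "is_shape g"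
  obtains N where "\<And>i. i \<ge> N \<Longrightarrow> f i = 0" "\<And>i. i \<ge> N \<Longrightarrow> g i = 0"
proof -
  obtain N1 N2 where "\<And>i. i \<ge> N1 \<Longrightarrow> f i = 0" "\<And>i. i \<ge> N2 \<Longrightarrow> g i = 0"
    using assms unfolding is_shape_def by auto
  then show ?thesis using that[of "max N1 N2"] by auto
qed

lemma hstrip_shape_lower: "is_shape f \<Longrightarrow> hstrip f g \<Longrightarrow> is_shape g"
  unfolding is_shape_def hstrip_def by (metis le_zero_eq order_trans)

lemma hstrip_shape_upper:
  assumes "is_shape g" "hstrip f g" shows "is_shape f"
proof -
  obtain N where "\<forall>i\<ge>N. g i = 0" using assms(1) is_shape_def by auto
  then have "\<forall>i\<ge>Suc N. f i = 0" using assms(2) unfolding hstrip_def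
    by (metis Suc_le_D Suc_le_mono le_zero_eq)
  moreover have "\<forall>i. f (Suc i) \<le> f i" using assms(2) unfolding hstrip_def
    using le_trans by blast
  ultimately show ?thesis unfolding is_shape_def by blast
qed

lemma finite_shape_cells:
  assumes "is_shape f" shows "finite (shape_cells f)"
proof -
  obtain N where N: "\<forall>i\<ge>N. f i = 0" using assms is_shape_def by auto
  have "shape_cells f \<subseteq> (SIGMA i:{..<N}. {..<f i})"
    unfolding shape_cells_def using N by (auto simp: not_less[symmetric])
  then show ?thesis by (rule finite_subset) auto
qed

lemma card_shape_cells:
  assumes "is_shape f" shows "card (shape_cells f) = shape_size f"
proof -
  obtain N where N: "\<forall>i\<ge>N. f i = 0" using assms is_shape_def by auto
  have "shape_cells f = (SIGMA i:{..<N}. {..<f i})"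
    unfolding shape_cells_def using N by (auto simp: not_less[symmetric])
  then show ?thesis using N by (simp add: shape_size_eq[of N])
qed

lemma kostka_size: "is_shape f \<Longrightarrow> kostka f M \<noteq> 0 \<Longrightarrow> size M = shape_size f"
  unfolding kostka_def card_shape_cells[symmetric]
  by (metis (mono_tags, lifting) Collect_empty_eq card.empty size_image_mset size_mset_set)

lemma hstrip_cells: "hstrip f g \<Longrightarrow> shape_cells g \<subseteq> shape_cells f"
  unfolding hstrip_def shape_cells_def by (auto intro: less_le_trans)

lemma hstrip_size_le:
  assumes "is_shape f" "hstrip f g" shows "shape_size g \<le> shape_size f"
  using card_mono[OF finite_shape_cells[OF assms(1)] hstrip_cells[OF assms(2)]]
  by (simp add: card_shape_cells assms hstrip_shape_lower[OF assms])

lemma shape_size_0_iff: "is_shape f \<Longrightarrow> shape_size f = 0 \<longleftrightarrow> f = (\<lambda>_. 0)"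
proof -
  assume f: "is_shape f"
  then obtain N where N: "\<And>i. i \<ge> N \<Longrightarrow> f i = 0" using is_shape_def by auto
  show ?thesis using N by (auto simp: fun_eq_iff shape_size_eq[of N]) (meson lessThan_iff not_le)
qed

lemma finite_le_shape:
  assumes "is_shape f" shows "finite {g. \<forall>i. g i \<le> f i}"
proof -
  obtain N where N: "\<And>i. i \<ge> N \<Longrightarrow> f i = 0" using assms is_shape_def by auto
  have "{g. \<forall>i. g i \<le> f i} \<subseteq> {g. (\<forall>i\<in>{..<N}. g i \<in> {..Max (f ` {..<N})}) \<and> (\<forall>i. i \<notin> {..<N} \<longrightarrow> g i = 0)}" (is "_ \<subseteq> ?R")
  proof clarsimp
    fix g assume "\<forall>i. g i \<le> f i"
    then show "(\<forall>i\<in>{..<N}. g i \<le> Max (f ` {..<N})) \<and> (\<forall>i. \<not> i < N \<longrightarrow> g i = 0)"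
      using N by (metis Max_ge finite_imageI finite_lessThan image_eqI le_zero_eq not_le order_trans)
  qed
  then show ?thesis
    
    using finite_set_of_finite_funs[of "{..<N}" "{..Max (f ` {..<N})}" 0]
    by (rule_tac finite_subset[of _ ?R]) (auto elim!: rev_finite_subset)
qed

text \<open>Row \<open>i\<close> forces a rectangle with \<open>i + 1\<close> rows and
  \<open>f i\<close> columns into the diagram. Hence \<open>f i \<le> d\<close> everywhere and
  \<open>f i = 0\<close> from row \<open>d\<close> on.\<close>

lemma finite_shapes_of_size: "finite {f. is_shape f \<and> shape_size f \<le> d}"
proof -
  have "f i \<le> (if i < d then d else 0)" if f: "is_shape f" "shape_size f \<le> d" for f i
  proof -
    have "(SIGMA i':{..i}. {..<f i}) \<subseteq> shape_cells f"
      unfolding shape_cells_def using shape_mono[OF f(1)] by (auto intro: less_le_trans)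
    from card_mono[OF finite_shape_cells[OF f(1)] this] have "Suc i * f i \<le> d"
      using f by (simp add: card_shape_cells)
    then show ?thesis
      by (cases "f i") (auto simp: not_less intro: order_trans)
  qed
  then have "{f. is_shape f \<and> shape_size f \<le> d} \<subseteq> {g. \<forall>i. g i \<le> (if i < d then d else 0)}" by blast
  moreover have "is_shape (\<lambda>i. if i < d then d else 0)" unfolding is_shape_def by (auto intro: exI[of _ d])
  ultimately show ?thesis using finite_le_shape finite_subset by blast
qed

lemma finite_hstrip_lower: "is_shape f \<Longrightarrow> finite {g. hstrip f g \<and> P g}"
  using finite_le_shape[of f] by (rule finite_subset[rotated]) (auto simp: hstrip_def)

lemma finite_hstrip_upper: "is_shape g \<Longrightarrow> finite {f. hstrip f g \<and> shape_size f = n \<and> P f}"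
  using finite_shapes_of_size[of n] by (rule finite_subset[rotated]) (auto intro: hstrip_shape_upper)

lemma finite_tableaux_content: 
  assumes "is_shape f" shows "finite {T \<in> tableaux f. image_mset T (mset_set (shape_cells f)) = M}"
proof -
  have "{T \<in> tableaux f. image_mset T (mset_set (shape_cells f)) = M} \<subseteq> shape_cells f \<rightarrow>\<^sub>E set_mset M"
    using finite_shape_cells[OF assms] by (auto simp: tableaux_def PiE_def Pi_def)
  then show ?thesis using finite_shape_cells[OF assms] by (meson finite_PiE finite_set_mset finite_subset)
qed

section \<open>Branching: cutting the largest value off a tableau\<close>

lemma lessThan_down_closed:
  fixes S :: "nat set"
  assumes "S \<subseteq> {..<n}" "\<And>x y. x < y \<Longrightarrow> y \<in> S \<Longrightarrow> x \<in> S"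
  shows "S = {..<card S}"
proof -
  have fin: "finite S" using assms(1) finite_subset by blast
  show ?thesis
  proof (cases "S = {}")
    case False
    have "S = {..Max S}" using assms(2) Max_in[OF fin False] Max_ge[OF fin]
      by (auto simp: le_less)
    then have "S = {..<Suc (Max S)}" by (simp add: lessThan_Suc_atMost)
    then show ?thesis by (metis card_lessThan)
  qed auto
qed

lemma card_bij_Sigma:
  assumes "finite G" "\<And>g. g \<in> G \<Longrightarrow> finite (H g)" "bij_betw \<phi> S (Sigma G H)"
  shows "card S = (\<Sum>g\<in>G. card (H g))"
  using bij_betw_same_card[OF assms(3)] assms(1,2) by simp

text \<open>The cells with entries below \<open>v\<close> form a smaller shape \<open>g\<close>, and
  the tableau is recovered from its restriction to \<open>g\<close> by filling the strip with
  \<open>v\<close>. This branching rule drives every later induction on the largest value of a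
  content.\<close>

lemma kostka_rec:
  assumes f: "is_shape f" and A: "\<forall>x\<in>#A. x < v"
  shows "kostka f (A + replicate_mset a v) =
    (\<Sum>g | hstrip f g \<and> shape_size f = shape_size g + a. kostka g A)"
proof -
  define G where "G = {g. hstrip f g \<and> shape_size f = shape_size g + a}"
  define H where "H g = {T \<in> tableaux g. image_mset T (mset_set (shape_cells g)) = A}" for g
  define S where "S = {T \<in> tableaux f. image_mset T (mset_set (shape_cells f)) = A + replicate_mset a v}"
  define sh where "sh T i = card {j. j < f i \<and> T (i, j) < v}" for T :: "nat \<times> nat \<Rightarrow> nat" and i
  define to where "to T = (sh T, restrict T (shape_cells (sh T)))" for T :: "nat \<times> nat \<Rightarrow> nat"
  define fro where "fro = (\<lambda>(g, T) c. if c \<in> shape_cells g then (T c :: nat)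
      else if c \<in> shape_cells f then v else undefined)"
  have finf: "finite (shape_cells f)" using finite_shape_cells f by auto
  have sub: "shape_cells g \<subseteq> shape_cells f" if "g \<in> G" for g
    using hstrip_cells that unfolding G_def by auto
  have shg: "is_shape g" if "g \<in> G" for g using that hstrip_shape_lower[OF f] G_def by auto
  have shiff: "j < sh T i \<longleftrightarrow> j < f i \<and> T (i, j) < v" if T: "T \<in> tableaux f" for T i j
  proof -
    have "{j. j < f i \<and> T (i, j) < v} = {..<card {j. j < f i \<and> T (i, j) < v}}"
    proof (rule lessThan_down_closed[of _ "f i"])
      fix x y assume "x < y" "y \<in> {j. j < f i \<and> T (i, j) < v}"
      then show "x \<in> {j. j < f i \<and> T (i, j) < v}" using T unfolding tableaux_def by fastforce
    qed auto
    then show ?thesis unfolding sh_def by blast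
  qed
  have cellsT: "shape_cells (sh T) = {c \<in> shape_cells f. T c < v}" if T: "T \<in> tableaux f" for T
    using shiff[OF T] unfolding shape_cells_def by auto
  have to_in: "to T \<in> Sigma G H" if T: "T \<in> S" for T
  proof -
    have T1: "T \<in> tableaux f" and T2: "image_mset T (mset_set (shape_cells f)) = A + replicate_mset a v"
      using T unfolding S_def by auto
    have T_le: "T c \<le> v" if "c \<in> shape_cells f" for c
    proof -
      have "T c \<in># A + replicate_mset a v" using that finf by (simp flip: T2)
      then show ?thesis using A by (auto simp: less_imp_le split: if_splits)
    qed
    have hs: "hstrip f (sh T)" unfolding hstrip_def
    proof (intro allI conjI)
      fix i
      show "sh T i \<le> f i" using shiff[OF T1] by (meson leI nat_less_le)
      \<comment> \<open>Otherwise row \<open>i + 1\<close> has a cell in column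
        \<open>sh T i\<close>. It holds at most \<open>v\<close>, so by column strictness the entry
        above it is below \<open>v\<close>; but then column \<open>sh T i\<close> would itself be
        counted in \<open>sh T i\<close>.\<close>
      show "f (Suc i) \<le> sh T i"
      proof (rule ccontr)
        assume "\<not> f (Suc i) \<le> sh T i"
        then have j: "sh T i < f (Suc i)" by simp
        then have "T (i, sh T i) < T (Suc i, sh T i)" using T1 unfolding tableaux_def by auto
        moreover have "T (Suc i, sh T i) \<le> v" using T_le[of "(Suc i, sh T i)"] j by (auto simp: shape_cells_def)
        moreover have "sh T i < f i" using j shape_mono[OF f, of i "Suc i"] by simp
        ultimately have "sh T i < sh T i" unfolding shiff[OF T1, of "sh T i"] by linarith
        then show False by simp
      qed
    qed
    have c1: "image_mset T (mset_set (shape_cells (sh T))) = A"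
    proof -
      have "image_mset T (mset_set (shape_cells (sh T))) = filter_mset (\<lambda>x. x < v) (image_mset T (mset_set (shape_cells f)))"
        unfolding cellsT[OF T1] using finf by (simp add: filter_mset_image_mset flip: filter_mset_mset_set)
      also have "\<dots> = A" unfolding T2 using A by (intro multiset_eqI) (auto simp: count_eq_zero_iff)
      finally show ?thesis .
    qed
    have sz: "shape_size f = shape_size (sh T) + a"
    proof -
      have "shape_size f = size A + a" using arg_cong[OF T2, of size] by (simp add: card_shape_cells f)
      moreover have "shape_size (sh T) = size A" using arg_cong[OF c1, of size]
        by (simp add: card_shape_cells hstrip_shape_lower[OF f hs])
      ultimately show ?thesis by simp
    qed
    have "restrict T (shape_cells (sh T)) \<in> H (sh T)"
    proof -
      have "restrict T (shape_cells (sh T)) \<in> tableaux (sh T)"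
        unfolding tableaux_def
      proof (intro CollectI conjI allI impI)
        fix i j j' assume h: "j < j'" "j' < sh T i"
        then have "j < sh T i" "j' < f i" using shiff[OF T1, of j' i] by linarith+
        then show "restrict T (shape_cells (sh T)) (i, j) \<le> restrict T (shape_cells (sh T)) (i, j')"
          using T1 h unfolding tableaux_def shape_cells_def by auto
      next
        fix i i' j assume h: "i < i'" "j < sh T i'"
        then have "j < sh T i" "j < f i'"
          using shiff[OF T1, of j i'] shape_mono[OF hstrip_shape_lower[OF f hs], of i i'] by linarith+
        then show "restrict T (shape_cells (sh T)) (i, j) < restrict T (shape_cells (sh T)) (i', j)"
          using T1 h unfolding tableaux_def shape_cells_def by auto
      next
        show "restrict T (shape_cells (sh T)) \<in> shape_cells (sh T) \<rightarrow>\<^sub>E UNIV" by (simp add: PiE_def)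
      qed
      moreover have "image_mset (restrict T (shape_cells (sh T))) (mset_set (shape_cells (sh T))) = A"
        unfolding c1[symmetric] using hs hstrip_shape_lower[OF f] finite_shape_cells
        by (intro image_mset_cong) auto
      ultimately show ?thesis unfolding H_def by auto
    qed
    then show ?thesis using hs sz unfolding to_def G_def by auto
  qed
  have fro_in: "fro (g, T) \<in> S \<and> to (fro (g, T)) = (g, T)" if g: "g \<in> G" and T: "T \<in> H g" for g T
  proof -
    have fing: "finite (shape_cells g)" using finite_shape_cells shg g by auto
    have T1: "T \<in> tableaux g" and T2: "image_mset T (mset_set (shape_cells g)) = A"
      using T unfolding H_def by auto
    have Tlt: "T (i, j) < v" if "j < g i" for i j
    proof -
      have "T (i, j) \<in># A" using that fing by (auto simp flip: T2 simp: shape_cells_def)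
      then show ?thesis using A by auto
    qed
    have fge: "f i' \<le> g i" if "i < i'" for i i'
      using g shape_mono[OF shg[OF g]] that unfolding G_def hstrip_def
      by (cases i') (auto intro: order_trans)
    have e: "fro (g, T) (i, j) = (if j < g i then T (i, j) else if j < f i then v else undefined)" for i j
      unfolding fro_def shape_cells_def by auto
    have tab: "fro (g, T) \<in> tableaux f"
      unfolding tableaux_def
    proof (intro CollectI conjI allI impI)
      show "fro (g, T) \<in> shape_cells f \<rightarrow>\<^sub>E UNIV"
        using sub[OF g] by (auto simp: fro_def)
    next
      fix i j j' assume "j < j'" "j' < f i"
      then show "fro (g, T) (i, j) \<le> fro (g, T) (i, j')"
        using T1 Tlt[of j i] unfolding e tableaux_def by (simp add: less_imp_le)
    next
      fix i i' j assume h: "i < i'" "j < f i'"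
      then have "j < g i" using fge by (meson less_le_trans)
      then show "fro (g, T) (i, j) < fro (g, T) (i', j)"
        using T1 Tlt[of j i] h unfolding e tableaux_def by simp
    qed
    have "mset_set (shape_cells f) = mset_set (shape_cells g) + mset_set (shape_cells f - shape_cells g)"
      using sub[OF g] finf fing by (metis Diff_disjoint Un_Diff_cancel finite_Diff mset_set_Union sup.absorb2)
    then have "image_mset (fro (g, T)) (mset_set (shape_cells f)) =
       image_mset (fro (g, T)) (mset_set (shape_cells g)) + image_mset (fro (g, T)) (mset_set (shape_cells f - shape_cells g))"
      by simp
    also have "image_mset (fro (g, T)) (mset_set (shape_cells g)) = image_mset T (mset_set (shape_cells g))"
      using fing by (intro image_mset_cong) (auto simp: fro_def)
    also have "image_mset (fro (g, T)) (mset_set (shape_cells f - shape_cells g)) = image_mset (\<lambda>_. v) (mset_set (shape_cells f - shape_cells g))"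
      using finf by (intro image_mset_cong) (auto simp: fro_def)
    also have "\<dots> = replicate_mset a v"
      using g sub[OF g] finf fing unfolding G_def
      by (simp add: image_mset_const_eq card_Diff_subset card_shape_cells f shg g)
    finally have S: "fro (g, T) \<in> S" unfolding S_def using tab T2 by auto
    have sh: "sh (fro (g, T)) = g"
    proof
      fix i
      have gle: "g i \<le> f i" using g unfolding G_def hstrip_def by auto
      have "{j. j < f i \<and> fro (g, T) (i, j) < v} = {..<g i}"
        unfolding e using Tlt gle by (auto split: if_splits)
      then show "sh (fro (g, T)) i = g i" unfolding sh_def by simp
    qed
    have "restrict (fro (g, T)) (shape_cells g) = T"
      using T1 unfolding tableaux_def by (simp add: fro_def PiE_def extensional_def restrict_def fun_eq_iff)
    then show ?thesis using S sh unfolding to_def by auto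
  qed
  have inj: "fro (to T) = T" if T: "T \<in> S" for T
  proof
    fix c
    have T1: "T \<in> tableaux f" and T2: "image_mset T (mset_set (shape_cells f)) = A + replicate_mset a v"
      using T unfolding S_def by auto
    have "T c = v" if "c \<in> shape_cells f" "\<not> T c < v"
    proof -
      have "T c \<in># A + replicate_mset a v" using that finf by (simp flip: T2)
      then show ?thesis using A that by (auto split: if_splits)
    qed
    moreover have "T c = undefined" if "c \<notin> shape_cells f" using T1 that unfolding tableaux_def by auto
    ultimately show "fro (to T) c = T c"
      unfolding fro_def to_def using cellsT[OF T1] by auto
  qed
  have "bij_betw to S (Sigma G H)"
  proof (rule bij_betw_byWitness[where f'=fro])
    show "\<forall>T\<in>S. fro (to T) = T" using inj by blast
    show "\<forall>p\<in>Sigma G H. to (fro p) = p" using fro_in by (simp add: split_paired_Ball_Sigma)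
    show "to ` S \<subseteq> Sigma G H" using to_in by blast
    show "fro ` Sigma G H \<subseteq> S"
      using fro_in by (simp add: image_subset_iff split_paired_Ball_Sigma)
  qed
  moreover have "finite G" unfolding G_def by (rule finite_hstrip_lower[OF f])
  moreover have "finite (H g)" if "g \<in> G" for g
    unfolding H_def by (rule finite_tableaux_content[OF shg[OF that]])
  ultimately have "card S = (\<Sum>g\<in>G. card (H g))" by (rule card_bij_Sigma[rotated 2])
  then show ?thesis unfolding S_def G_def H_def kostka_def .
qed

section \<open>Symmetry of Kostka numbers in the content\<close>

lemma hstrip_hstrip_iff:
  "hstrip f g \<and> hstrip g h \<longleftrightarrow> (\<forall>i. max (h i) (f (Suc i)) \<le> g i \<and>
     g i \<le> (case i of 0 \<Rightarrow> f 0 | Suc j \<Rightarrow> min (f (Suc j)) (h j)))" (is "_ = (\<forall>i. ?P i)")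
proof
  assume a: "hstrip f g \<and> hstrip g h"
  show "\<forall>i. ?P i" 
  proof
    fix i show "?P i" using a unfolding hstrip_def by (cases i) auto
  qed
next
  assume a: "\<forall>i. ?P i"
  have "g i \<le> f i \<and> f (Suc i) \<le> g i \<and> h i \<le> g i \<and> g (Suc i) \<le> h i" for i
    using spec[OF a, of i] spec[OF a, of "Suc i"] by (auto split: nat.splits)
  then show "hstrip f g \<and> hstrip g h" unfolding hstrip_def by auto
qed

text \<open>Reflecting every row length in the interval allowed by its neighbours exchanges the sizes of
  the two strips.\<close>

lemma card_intermediate_shapes:
  assumes f: "is_shape f" and h: "is_shape h"
  shows "card {g. hstrip f g \<and> hstrip g h \<and> shape_size f = shape_size g + b \<and> shape_size g = shape_size h + a}
       = card {g. hstrip f g \<and> hstrip g h \<and> shape_size f = shape_size g + a \<and> shape_size g = shape_size h + b}"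
    (is "card (?S a b) = card (?S b a)")
proof -
  define lo where "lo i = max (h i) (f (Suc i))" for i
  define hi where "hi i = (case i of 0 \<Rightarrow> f 0 | Suc j \<Rightarrow> min (f (Suc j)) (h j))" for i
  define rf where "rf g i = lo i + hi i - g i" for g :: "nat \<Rightarrow> nat" and i
  \<comment> \<open>The bounds involve only \<open>f\<close> and \<open>h\<close>, so the rows of an
    intermediate shape vary independently of each other and can be reflected one by one.\<close>
  have iff: "hstrip f g \<and> hstrip g h \<longleftrightarrow> (\<forall>i. lo i \<le> g i \<and> g i \<le> hi i)" for g
    unfolding hstrip_hstrip_iff lo_def hi_def ..
  obtain N where N: "\<And>i. i \<ge> N \<Longrightarrow> f i = 0" "\<And>i. i \<ge> N \<Longrightarrow> h i = 0"
    using shape_obtain_bound[OF f h] by blast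
  \<comment> \<open>Telescoping across neighbouring rows: \<open>lo i\<close> is the maximum and
    \<open>hi (Suc i)\<close> the minimum of the same two numbers \<open>h i\<close> and
    \<open>f (Suc i)\<close>, so together they give their sum. Only the last maximum is left
    over.\<close>
  have lohi: "(\<Sum>i<Suc n. lo i + hi i) = (\<Sum>i<Suc n. f i) + (\<Sum>i<n. h i) + max (h n) (f (Suc n))" for n
    by (induction n) (auto simp: lo_def hi_def max_def min_def)
  have size: "shape_size (rf g) + shape_size g = shape_size f + shape_size h" 
    if g: "hstrip f g \<and> hstrip g h" for g
  proof -
    have b: "lo i \<le> g i" "g i \<le> hi i" for i using g iff by auto
    have z: "g i = 0" "rf g i = 0" if "i \<ge> Suc N" for i
      using b[of i] N that by (auto simp: rf_def lo_def hi_def split: nat.splits)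
    have "shape_size (rf g) + shape_size g = (\<Sum>i<Suc N. rf g i) + (\<Sum>i<Suc N. g i)"
      using z by (subst (1 2) shape_size_eq[of "Suc N"]) auto
    also have "\<dots> = (\<Sum>i<Suc N. lo i + hi i)"
      unfolding sum.distrib[symmetric] using b by (intro sum.cong) (auto simp: rf_def intro!: le_add_diff_inverse2 trans_le_add2)
    also have "\<dots> = shape_size f + shape_size h"
      unfolding lohi using N by (subst (1 2) shape_size_eq[of N]) auto
    finally show ?thesis .
  qed
  have maps: "rf ` ?S a b \<subseteq> ?S b a" for a b
  proof clarify
    fix g assume g: "hstrip f g" "hstrip g h" and s: "shape_size f = shape_size g + b" "shape_size g = shape_size h + a"
    have b: "\<forall>i. lo i \<le> g i \<and> g i \<le> hi i" using g iff by auto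
    have "\<forall>i. lo i \<le> rf g i \<and> rf g i \<le> hi i"
    proof
      fix i show "lo i \<le> rf g i \<and> rf g i \<le> hi i" using spec[OF b, of i] unfolding rf_def by linarith
    qed
    then have "hstrip f (rf g) \<and> hstrip (rf g) h" using iff by auto
    moreover have "shape_size (rf g) + shape_size g = shape_size f + shape_size h" using size g by auto
    ultimately show "hstrip f (rf g) \<and> hstrip (rf g) h \<and> shape_size f = shape_size (rf g) + a \<and> shape_size (rf g) = shape_size h + b"
      using s by auto
  qed
  have inv: "rf (rf g) = g" if "g \<in> ?S a b" for g a b
  proof
    fix i
    have "lo i \<le> g i \<and> g i \<le> hi i" using that iff by blast
    then show "rf (rf g) i = g i" unfolding rf_def by linarith
  qed
  have "bij_betw rf (?S a b) (?S b a)"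
    by (rule bij_betw_byWitness[where f'=rf]) (use inv maps in auto)
  then show ?thesis by (rule bij_betw_same_card)
qed

text \<open>Two branching steps, collected by the shape that remains after both. Summing over all
  \<open>h\<close> below \<open>f\<close>, with weight 0 for those that are no shapes, gives one
  finite index set on which the effect of exchanging \<open>a\<close> and \<open>b\<close> can be
  compared term by term.\<close>

lemma kostka_rec2:
  assumes f: "is_shape f" and A: "\<forall>x\<in>#A. x < v"
  shows "kostka f (A + replicate_mset a v + replicate_mset b (Suc v)) =
    (\<Sum>h | (\<forall>i. h i \<le> f i). (if is_shape h then card {g. hstrip f g \<and> hstrip g h \<and> shape_size f = shape_size g + b \<and> shape_size g = shape_size h + a}
       else 0) * kostka h A)"
proof -
  define G where "G = {g. hstrip f g \<and> shape_size f = shape_size g + b}"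
  have Gsh: "is_shape g" if "g \<in> G" for g using that f hstrip_shape_lower unfolding G_def by auto
  have fG: "finite G" unfolding G_def using finite_hstrip_lower[OF f] .
  define H where "H = {h. \<forall>i. h i \<le> f i}"
  have fH: "finite H" unfolding H_def using finite_le_shape[OF f] .
  have "kostka f (A + replicate_mset a v + replicate_mset b (Suc v)) = (\<Sum>g\<in>G. kostka g (A + replicate_mset a v))"
    unfolding G_def by (rule kostka_rec[OF f]) (use A in \<open>auto split: if_splits\<close>)
  also have "\<dots> = (\<Sum>g\<in>G. \<Sum>h | h \<in> H \<and> (hstrip g h \<and> shape_size g = shape_size h + a). kostka h A)"
  proof (intro sum.cong refl)
    fix g assume g: "g \<in> G"
    have "{h. hstrip g h \<and> shape_size g = shape_size h + a} = {h \<in> H. hstrip g h \<and> shape_size g = shape_size h + a}"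
      using g unfolding G_def H_def hstrip_def by (auto intro: order_trans)
    then show "kostka g (A + replicate_mset a v) = (\<Sum>h | h \<in> H \<and> (hstrip g h \<and> shape_size g = shape_size h + a). kostka h A)"
      using kostka_rec[OF Gsh[OF g] A, of a] by simp
  qed
  also have "\<dots> = (\<Sum>h\<in>H. \<Sum>g | g \<in> G \<and> (hstrip g h \<and> shape_size g = shape_size h + a). kostka h A)"
    by (rule sum.swap_restrict[OF fG fH])
  also have "\<dots> = (\<Sum>h\<in>H. (if is_shape h then card {g. hstrip f g \<and> hstrip g h \<and> shape_size f = shape_size g + b \<and> shape_size g = shape_size h + a}
       else 0) * kostka h A)"
  proof (intro sum.cong refl)
    fix h
    have "{g \<in> G. hstrip g h \<and> shape_size g = shape_size h + a} =
      (if is_shape h then {g. hstrip f g \<and> hstrip g h \<and> shape_size f = shape_size g + b \<and> shape_size g = shape_size h + a} else {})"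
      using Gsh hstrip_shape_lower unfolding G_def by auto
    then show "(\<Sum>g | g \<in> G \<and> (hstrip g h \<and> shape_size g = shape_size h + a). kostka h A) = 
      (if is_shape h then card {g. hstrip f g \<and> hstrip g h \<and> shape_size f = shape_size g + b \<and> shape_size g = shape_size h + a}
       else 0) * kostka h A" by simp
  qed
  finally show ?thesis unfolding H_def .
qed

text \<open>What a Bender-Knuth involution achieves on the two largest values; here only the number
  of intermediate shapes is compared, and the tableau on the inner shape is untouched.\<close>

lemma kostka_swap_top:
  assumes f: "is_shape f" and A: "\<forall>x\<in>#A. x < v"
  shows "kostka f (A + replicate_mset a v + replicate_mset b (Suc v)) = kostka f (A + replicate_mset b v + replicate_mset a (Suc v))"
  unfolding kostka_rec2[OF assms] using card_intermediate_shapes[OF f, of _ b a]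
  by (intro sum.cong refl) simp

lemma mset_split_top:
  fixes A :: "nat multiset"
  assumes "\<forall>x\<in>#A. x < Suc v"
  shows "A = filter_mset (\<lambda>x. x < v) A + replicate_mset (count A v) v"
  using assms by (intro multiset_eqI) (auto simp: count_eq_zero_iff less_Suc_eq)

text \<open>Values above \<open>Suc v\<close> are fixed by the transposition, so branching strips
  them from both contents alike until \<open>v\<close> and \<open>Suc v\<close> are the largest
  possible ones. The induction runs over the number of possible values above them.\<close>

lemma kostka_swap:
  assumes "is_shape f"
  shows "kostka f (image_mset (transpose v (Suc v)) A) = kostka f A"
proof -
  have "kostka f (image_mset (transpose v (Suc v)) A) = kostka f A" 
    if "\<forall>x\<in>#A. x < n + Suc (Suc v)" "is_shape f" for n f
    using that
  proof (induction n arbitrary: A f)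
    case 0
    define B where "B = filter_mset (\<lambda>x. x < Suc v) A"
    define C where "C = filter_mset (\<lambda>x. x < v) B"
    define a where "a = count B v"
    define b where "b = count A (Suc v)"
    have A: "A = C + replicate_mset a v + replicate_mset b (Suc v)"
      using mset_split_top[of A "Suc v"] mset_split_top[of B v] 0 unfolding B_def C_def a_def b_def by simp
    have C: "\<forall>x\<in>#C. x < v" unfolding C_def by simp
    have "image_mset (transpose v (Suc v)) C = C"
      using C by (intro multiset.map_ident_strong) (force simp: transpose_def)
    then have "image_mset (transpose v (Suc v)) A = C + replicate_mset b v + replicate_mset a (Suc v)"
      unfolding A by (simp add: add_ac)
    then show ?case using kostka_swap_top[OF 0(2) C, of a b] A by (simp add: add_ac)
  next
    case (Suc n)
    define w where "w = n + Suc (Suc v)"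
    define B where "B = filter_mset (\<lambda>x. x < w) A"
    define a where "a = count A w"
    have A: "A = B + replicate_mset a w" 
      using mset_split_top[of A w] Suc(2) unfolding a_def B_def w_def by simp
    have tr: "transpose v (Suc v) x < w \<longleftrightarrow> x < w" for x unfolding w_def transpose_def by auto
    have B: "\<forall>x\<in>#B. x < w" unfolding B_def by simp
    have B': "\<forall>x\<in>#image_mset (transpose v (Suc v)) B. x < w" using B tr by auto
    have iA: "image_mset (transpose v (Suc v)) A = image_mset (transpose v (Suc v)) B + replicate_mset a w"
      unfolding A w_def by (simp add: transpose_def)
    show ?case unfolding iA unfolding A unfolding kostka_rec[OF Suc(3) B] kostka_rec[OF Suc(3) B']
      using Suc.IH[OF B[unfolded w_def]] hstrip_shape_lower[OF Suc(3)] by (intro sum.cong) auto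
  qed
  moreover have "\<forall>x\<in>#A. x < Max (set_mset A) + Suc (Suc v)"
  proof
    fix x assume "x \<in># A"
    then have "x \<le> Max (set_mset A)" by simp
    then show "x < Max (set_mset A) + Suc (Suc v)" by simp
  qed
  ultimately show ?thesis using assms by blast
qed


section \<open>Common extensions and common restrictions of two shapes\<close>

lemma hstrip_pair_upper_iff:
  "hstrip g f \<and> hstrip g f' \<longleftrightarrow> max (f 0) (f' 0) \<le> g 0 \<and>
     (\<forall>i. max (f (Suc i)) (f' (Suc i)) \<le> g (Suc i) \<and> g (Suc i) \<le> min (f i) (f' i))"
    (is "_ \<longleftrightarrow> ?R")
proof
  assume "?R"
  then have "f i \<le> g i \<and> f' i \<le> g i \<and> g (Suc i) \<le> f i \<and> g (Suc i) \<le> f' i" for i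
    by (cases i) auto
  then show "hstrip g f \<and> hstrip g f'" unfolding hstrip_def by blast
qed (auto simp: hstrip_def)

lemma hstrip_pair_lower_iff:
  "hstrip f g \<and> hstrip f' g \<longleftrightarrow>
     (\<forall>i. max (f (Suc i)) (f' (Suc i)) \<le> g i \<and> g i \<le> min (f i) (f' i))"
  unfolding hstrip_def by auto

text \<open>For fixed shapes \<open>f\<close> and \<open>f'\<close>, the interval allowed for row \<open>i + 1\<close> of a common extension is
  the interval allowed for row \<open>i\<close> of a common restriction; only the first row of the extension is
  unbounded, and its excess is \<open>t\<close>.\<close>

lemma card_common_extensions:
  assumes f: "is_shape f" and f': "is_shape f'"
  shows "card {g. hstrip g f \<and> hstrip g f' \<and> shape_size g = shape_size f + k \<and> shape_size g = shape_size f' + j}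
    = (\<Sum>t\<le>min j k. card {h. hstrip f h \<and> hstrip f' h \<and>
         shape_size f = shape_size h + (j - t) \<and> shape_size f' = shape_size h + (k - t)})"
proof -
  define S where "S = {g. hstrip g f \<and> hstrip g f' \<and> shape_size g = shape_size f + k \<and> shape_size g = shape_size f' + j}"
  define H where "H t = {h. hstrip f h \<and> hstrip f' h \<and>
         shape_size f = shape_size h + (j - t) \<and> shape_size f' = shape_size h + (k - t)}" for t
  define M where "M i = max (f i) (f' i)" for i
  define m where "m i = min (f i) (f' i)" for i
  \<comment> \<open>The interval is reflected and not copied, so that sizes add up: with excess
    \<open>t\<close>, the sizes of \<open>g\<close> and its image \<open>h\<close> sum to those of
    \<open>f\<close> and \<open>f'\<close> plus \<open>t\<close>. This is what turns
    \<open>j\<close> and \<open>k\<close> into \<open>j - t\<close> and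
    \<open>k - t\<close>.\<close>
  define to where "to g = (g 0 - M 0, \<lambda>i. M (Suc i) + m i - g (Suc i))" for g
  define fro where "fro = (\<lambda>(t :: nat, h) i. case i of 0 \<Rightarrow> M 0 + t | Suc i \<Rightarrow> M (Suc i) + m i - h i)"
  obtain N where N: "\<And>i. i \<ge> N \<Longrightarrow> f i = 0" "\<And>i. i \<ge> N \<Longrightarrow> f' i = 0"
    using shape_obtain_bound[OF f f'] by blast
  have up: "hstrip g f \<and> hstrip g f' \<longleftrightarrow> M 0 \<le> g 0 \<and> (\<forall>i. M (Suc i) \<le> g (Suc i) \<and> g (Suc i) \<le> m i)" for g
    unfolding M_def m_def by (rule hstrip_pair_upper_iff)
  have lo: "hstrip f h \<and> hstrip f' h \<longleftrightarrow> (\<forall>i. M (Suc i) \<le> h i \<and> h i \<le> m i)" for h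
    unfolding M_def m_def by (rule hstrip_pair_lower_iff)
  have size: "shape_size g + shape_size h + M 0 = shape_size f + shape_size f' + g 0"
    if g: "hstrip g f" "hstrip g f'" and h: "hstrip f h" "hstrip f' h" and e: "\<And>i. g (Suc i) + h i = M (Suc i) + m i" for g h
  proof -
    have z: "h i = 0 \<and> g (Suc i) = 0" if "i \<ge> N" for i
      using g(1) h(1) N(1)[of i] that unfolding hstrip_def by (metis le_zero_eq)
    then have z': "g i = 0" if "i \<ge> Suc N" for i using that by (cases i) auto
    have "shape_size g + shape_size h = g 0 + (\<Sum>i<N. g (Suc i) + h i)"
      using z z' by (simp add: shape_size_eq[of "Suc N" g] shape_size_eq[of N h] sum.lessThan_Suc_shift sum.distrib del: sum.lessThan_Suc)
    also have "(\<Sum>i<N. g (Suc i) + h i) = (\<Sum>i<N. M (Suc i)) + (\<Sum>i<N. m i)"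
      using e by (simp add: sum.distrib[symmetric])
    finally have "shape_size g + shape_size h + M 0 = g 0 + (\<Sum>i<Suc N. M i) + (\<Sum>i<N. m i)"
      by (simp add: sum.lessThan_Suc_shift del: sum.lessThan_Suc)
    moreover have "M N = 0" using N unfolding M_def by auto
    ultimately have "shape_size g + shape_size h + M 0 = g 0 + (\<Sum>i<N. M i + m i)" by (simp add: sum.distrib)
    also have "(\<Sum>i<N. M i + m i) = (\<Sum>i<N. f i + f' i)" by (intro sum.cong) (auto simp: M_def m_def)
    finally show ?thesis using N by (simp add: shape_size_eq[of N] sum.distrib)
  qed
  have to_in: "to g \<in> Sigma {..min j k} H \<and> fro (to g) = g" if "g \<in> S" for g
  proof -
    define h where "h i = M (Suc i) + m i - g (Suc i)" for i
    have g: "hstrip g f" "hstrip g f'" and s: "shape_size g = shape_size f + k" "shape_size g = shape_size f' + j"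
      using that unfolding S_def by auto
    have b: "M 0 \<le> g 0" "M (Suc i) \<le> g (Suc i) \<and> g (Suc i) \<le> m i" for i using g up by blast+
    have hb: "M (Suc i) \<le> h i \<and> h i \<le> m i" and e: "g (Suc i) + h i = M (Suc i) + m i" for i
      using b(2)[of i] unfolding h_def by linarith+
    have h: "hstrip f h" "hstrip f' h" using hb lo by blast+
    have "shape_size g + shape_size h + M 0 = shape_size f + shape_size f' + g 0" by (rule size[OF g h e])
    moreover have "shape_size h \<le> shape_size f" "shape_size h \<le> shape_size f'" using hstrip_size_le h f f' by auto
    ultimately have "g 0 - M 0 \<le> min j k \<and> shape_size f = shape_size h + (j - (g 0 - M 0)) \<and> shape_size f' = shape_size h + (k - (g 0 - M 0))"
      using s b(1) by auto
    moreover have "fro (g 0 - M 0, h) = g"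
    proof
      fix i show "fro (g 0 - M 0, h) i = g i"
        unfolding fro_def h_def using b(1) b(2)[of "i - 1"] by (auto split: nat.splits)
    qed
    moreover have "to g = (g 0 - M 0, h)" unfolding to_def h_def ..
    ultimately show ?thesis using h unfolding H_def by auto
  qed
  have fro_in: "fro (t, h) \<in> S \<and> to (fro (t, h)) = (t, h)" if t: "t \<le> min j k" and h: "h \<in> H t" for t h
  proof -
    define g where "g = fro (t, h)"
    have hh: "hstrip f h" "hstrip f' h" and s: "shape_size f = shape_size h + (j - t)" "shape_size f' = shape_size h + (k - t)"
      using h unfolding H_def by auto
    have b: "M (Suc i) \<le> h i \<and> h i \<le> m i" for i using hh lo by blast
    have g0: "g 0 = M 0 + t" and gS: "g (Suc i) = M (Suc i) + m i - h i" for i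
      unfolding g_def fro_def by auto
    have e: "g (Suc i) + h i = M (Suc i) + m i" and gb: "M (Suc i) \<le> g (Suc i) \<and> g (Suc i) \<le> m i" for i
      using b[of i] gS[of i] by linarith+
    have g: "hstrip g f" "hstrip g f'" using gb g0 up[of g] by auto
    have "shape_size g + shape_size h + M 0 = shape_size f + shape_size f' + g 0" by (rule size[OF g hh e])
    then have "g \<in> S" using g s g0 t unfolding S_def by auto
    moreover have "to g = (t, h)"
    proof -
      have "M (Suc i) + m i - g (Suc i) = h i" for i using e[of i] by linarith
      then show ?thesis unfolding to_def using g0 by auto
    qed
    ultimately show ?thesis unfolding g_def by auto
  qed
  have "bij_betw to S (Sigma {..min j k} H)"
  proof (rule bij_betw_byWitness[where f'=fro])
    show "\<forall>g\<in>S. fro (to g) = g" using to_in by blast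
    show "\<forall>p\<in>Sigma {..min j k} H. to (fro p) = p" using fro_in by (simp add: split_paired_Ball_Sigma)
    show "to ` S \<subseteq> Sigma {..min j k} H" using to_in by blast
    show "fro ` Sigma {..min j k} H \<subseteq> S"
      using fro_in by (simp add: image_subset_iff split_paired_Ball_Sigma)
  qed
  moreover have "finite (H t)" for t unfolding H_def by (rule finite_hstrip_lower[OF f])
  ultimately have "card S = (\<Sum>t\<in>{..min j k}. card (H t))" by (intro card_bij_Sigma) auto
  then show ?thesis unfolding S_def H_def .
qed

section \<open>The Cauchy identity\<close>

lemma hstrip_refl: "is_shape f \<Longrightarrow> hstrip f f"
  unfolding is_shape_def hstrip_def by auto

lemma hstrip_same_size:
  assumes "is_shape g" "hstrip f g" "shape_size f = shape_size g" shows "f = g"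
proof -
  have f: "is_shape f" using hstrip_shape_upper assms by auto
  have "shape_cells g = shape_cells f"
    using card_subset_eq[OF finite_shape_cells[OF f] hstrip_cells[OF assms(2)]] assms f
    by (simp add: card_shape_cells)
  then have "j < g i \<longleftrightarrow> j < f i" for i j unfolding shape_cells_def by (auto simp: set_eq_iff)
  then have "g i = f i" for i by (metis less_irrefl not_less_iff_gr_or_eq)
  then show ?thesis by auto
qed

lemma kostka_empty: "kostka (\<lambda>_. 0) {#} = 1"
proof -
  have "{T \<in> tableaux (\<lambda>_. 0). image_mset T (mset_set (shape_cells (\<lambda>_. 0))) = {#}} = {\<lambda>_. undefined}"
    unfolding tableaux_def shape_cells_def by auto
  then show ?thesis unfolding kostka_def by simp
qed

lemma finite_multisets_of_size: "finite S \<Longrightarrow> finite {M. set_mset M \<subseteq> S \<and> size M = n}"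
proof -
  assume S: "finite S"
  have "{M. set_mset M \<subseteq> S \<and> size M = n} \<subseteq> mset ` {xs. set xs \<subseteq> S \<and> length xs = n}"
  proof
    fix M assume "M \<in> {M. set_mset M \<subseteq> S \<and> size M = n}"
    moreover obtain xs where "M = mset xs" using ex_mset[of M] by auto
    ultimately show "M \<in> mset ` {xs. set xs \<subseteq> S \<and> length xs = n}" by auto
  qed
  then show ?thesis using finite_lists_length_eq[OF S] finite_surj by blast
qed

lemma finite_subset_mset: "finite {N. N \<subseteq># A \<and> P N}"
proof -
  have "{N. N \<subseteq># A \<and> P N} \<subseteq> (\<Union>n\<le>size A. {M. set_mset M \<subseteq> set_mset A \<and> size M = n})"
    by (auto dest: mset_subset_eqD size_mset_mono)
  then show ?thesis by (rule finite_subset) (auto intro: finite_multisets_of_size)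
qed

section \<open>Pieri's rule\<close>

lemma sum_subset_mset_split:
  fixes F :: "'a multiset \<Rightarrow> nat"
  assumes v: "v \<notin># A"
  shows "(\<Sum>N | N \<subseteq># A + replicate_mset a v \<and> size N = b. F N)
     = (\<Sum>t\<le>min b a. \<Sum>N | N \<subseteq># A \<and> size N = b - t. F (N + replicate_mset t v))"
proof -
  have v0: "count A v = 0" using v by (simp add: count_eq_zero_iff)
  have "(\<Sum>t\<le>min b a. \<Sum>N | N \<subseteq># A \<and> size N = b - t. F (N + replicate_mset t v))
     = (\<Sum>(t, N)\<in>Sigma {..min b a} (\<lambda>t. {N. N \<subseteq># A \<and> size N = b - t}). F (N + replicate_mset t v))"
    by (rule sum.Sigma) (auto intro: finite_subset_mset)
  also have "\<dots> = (\<Sum>N | N \<subseteq># A + replicate_mset a v \<and> size N = b. F N)"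
  proof (rule sum.reindex_bij_witness[where j = "\<lambda>(t, N). N + replicate_mset t v"
      and i = "\<lambda>N. (count N v, filter_mset (\<lambda>x. x \<noteq> v) N)"])
    fix p assume "p \<in> Sigma {..min b a} (\<lambda>t. {N. N \<subseteq># A \<and> size N = b - t})"
    then obtain t N where p: "p = (t, N)" "t \<le> b" "t \<le> a" "N \<subseteq># A" "size N = b - t" by auto
    have N: "count N v = 0" using mset_subset_eq_count[OF p(4), of v] v0 by simp
    have f: "filter_mset (\<lambda>x. x \<noteq> v) N = N" using N by (intro multiset_eqI) auto
    show "(case case p of (t, N) \<Rightarrow> N + replicate_mset t v of N \<Rightarrow> (count N v, filter_mset (\<lambda>x. x \<noteq> v) N)) = p"
      using p N f by auto
    show "(case p of (t, N) \<Rightarrow> N + replicate_mset t v) \<in> {N. N \<subseteq># A + replicate_mset a v \<and> size N = b}"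
      using p by (auto intro!: subset_mset.add_mono simp: replicate_mset_msubseteq_iff)
    show "F (case p of (t, N) \<Rightarrow> N + replicate_mset t v) = (case p of (t, N) \<Rightarrow> F (N + replicate_mset t v))"
      using p by simp
  next
    fix N assume "N \<in> {N. N \<subseteq># A + replicate_mset a v \<and> size N = b}"
    then have N: "N \<subseteq># A + replicate_mset a v" "size N = b" by auto
    have e: "filter_mset (\<lambda>x. x \<noteq> v) N + replicate_mset (count N v) v = N"
      by (intro multiset_eqI) auto
    show "(case (count N v, filter_mset (\<lambda>x. x \<noteq> v) N) of (t, N) \<Rightarrow> N + replicate_mset t v) = N"
      using e by simp
    have "count N v \<le> a" using mset_subset_eq_count[OF N(1), of v] v0 by simp
    moreover have "filter_mset (\<lambda>x. x \<noteq> v) N \<subseteq># A"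
    proof (rule mset_subset_eqI)
      fix x show "count (filter_mset (\<lambda>x. x \<noteq> v) N) x \<le> count A x"
        using mset_subset_eq_count[OF N(1), of x] by (auto split: if_splits)
    qed
    moreover have "size (filter_mset (\<lambda>x. x \<noteq> v) N) + count N v = b" using arg_cong[OF e, of size] N(2) by simp
    ultimately show "(count N v, filter_mset (\<lambda>x. x \<noteq> v) N) \<in> Sigma {..min b a} (\<lambda>t. {N. N \<subseteq># A \<and> size N = b - t})"
      by auto
  qed
  finally show ?thesis ..
qed

text \<open>Pieri's rule read off at the monomial \<open>A\<close>: the right-hand side is the
  coefficient in the product of the complete homogeneous function of degree \<open>b\<close> with
  the Schur function of \<open>g\<close>. The induction removes the largest value \<open>v\<close>
  of \<open>A\<close> and commutes this removal past the addition of a strip; the correction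
  parameter \<open>t\<close> becomes the multiplicity of \<open>v\<close> in
  \<open>N\<close>.\<close>

lemma kostka_down:
  assumes "is_shape g"
  shows "(\<Sum>f | hstrip f g \<and> shape_size f = shape_size g + b. kostka f A)
       = (\<Sum>N | N \<subseteq># A \<and> size N = b. kostka g (A - N))"
proof -
  have "(\<Sum>f | hstrip f g \<and> shape_size f = shape_size g + b. kostka f A)
       = (\<Sum>N | N \<subseteq># A \<and> size N = b. kostka g (A - N))"
    if "\<forall>x\<in>#A. x < n" "is_shape g" for n
    using that
  proof (induction n arbitrary: g b A)
    case 0
    then have A: "A = {#}" by auto
    show ?case
    proof (cases "b = 0")
      case True
      have "{f. hstrip f g \<and> shape_size f = shape_size g + b} = {g}"
        using hstrip_same_size[OF 0(2)] hstrip_refl[OF 0(2)] True by auto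
      moreover have "{N. N \<subseteq># A \<and> size N = b} = {{#}}" using A True by auto
      ultimately show ?thesis by simp
    next
      case False
      have "kostka f A = 0" if "hstrip f g" "shape_size f = shape_size g + b" for f
        using kostka_size[OF hstrip_shape_upper[OF 0(2) that(1)], of A] A False that by auto
      moreover have "{N. N \<subseteq># A \<and> size N = b} = {}" using A False by auto
      ultimately show ?thesis by (simp only: sum.empty) simp
    qed
  next
    case (Suc v)
    define A' where "A' = filter_mset (\<lambda>x. x < v) A"
    define a where "a = count A v"
    have A: "A = A' + replicate_mset a v" unfolding A'_def a_def by (rule mset_split_top[OF Suc(2)])
    have A': "\<forall>x\<in>#A'. x < v" unfolding A'_def by auto
    define E where "E = {f. hstrip f g \<and> shape_size f = shape_size g + b}"
    define Hs where "Hs = {h. is_shape h \<and> shape_size h \<le> shape_size g + b}"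
    define R where "R t = {r. hstrip g r \<and> shape_size g = shape_size r + (a - t)}" for t
    have fE: "finite E" unfolding E_def using finite_hstrip_upper[OF Suc(3), of _ "\<lambda>_. True"] by simp
    have fH: "finite Hs" unfolding Hs_def by (rule finite_shapes_of_size)
    have fR: "finite (R t)" for t unfolding R_def by (rule finite_hstrip_lower[OF Suc(3)])
    have Esh: "is_shape f" if "f \<in> E" for f using that hstrip_shape_upper[OF Suc(3)] unfolding E_def by auto
    have Rsh: "is_shape r" if "r \<in> R t" for r t using that hstrip_shape_lower[OF Suc(3)] unfolding R_def by auto
    have "(\<Sum>f\<in>E. kostka f A) = (\<Sum>f\<in>E. \<Sum>h | h \<in> Hs \<and> (hstrip f h \<and> shape_size f = shape_size h + a). kostka h A')"
    proof (rule sum.cong[OF refl])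
      fix f assume f: "f \<in> E"
      have "{h. hstrip f h \<and> shape_size f = shape_size h + a} = {h \<in> Hs. hstrip f h \<and> shape_size f = shape_size h + a}"
        using f hstrip_shape_lower[OF Esh[OF f]] unfolding Hs_def E_def by auto
      then show "kostka f A = (\<Sum>h | h \<in> Hs \<and> (hstrip f h \<and> shape_size f = shape_size h + a). kostka h A')"
        unfolding A using kostka_rec[OF Esh[OF f] A', where a = a] by simp
    qed
    also have "\<dots> = (\<Sum>h\<in>Hs. \<Sum>f | f \<in> E \<and> (hstrip f h \<and> shape_size f = shape_size h + a). kostka h A')"
      by (rule sum.swap_restrict[OF fE fH])
    \<comment> \<open>The exchange of adding and removing: \<open>f\<close> was a common extension
      of \<open>g\<close> and \<open>h\<close>, and is replaced by their common restrictions
      \<open>r\<close>.\<close>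
    also have "\<dots> = (\<Sum>h\<in>Hs. \<Sum>t\<le>min b a. \<Sum>r | r \<in> R t \<and> (hstrip h r \<and> shape_size h = shape_size r + (b - t)). kostka h A')"
    proof (rule sum.cong[OF refl])
      fix h assume "h \<in> Hs"
      then have h: "is_shape h" unfolding Hs_def by auto
      have "{f \<in> E. hstrip f h \<and> shape_size f = shape_size h + a} =
        {f. hstrip f h \<and> hstrip f g \<and> shape_size f = shape_size h + a \<and> shape_size f = shape_size g + b}"
        unfolding E_def by auto
      then have "card {f \<in> E. hstrip f h \<and> shape_size f = shape_size h + a} =
        (\<Sum>t\<le>min b a. card {r. hstrip h r \<and> hstrip g r \<and>
         shape_size h = shape_size r + (b - t) \<and> shape_size g = shape_size r + (a - t)})"
        using card_common_extensions[OF h Suc(3)] by simp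
      also have "\<dots> = (\<Sum>t\<le>min b a. card {r \<in> R t. hstrip h r \<and> shape_size h = shape_size r + (b - t)})"
        unfolding R_def by (intro sum.cong refl arg_cong[of _ _ card]) auto
      finally show "(\<Sum>f | f \<in> E \<and> (hstrip f h \<and> shape_size f = shape_size h + a). kostka h A') =
         (\<Sum>t\<le>min b a. \<Sum>r | r \<in> R t \<and> (hstrip h r \<and> shape_size h = shape_size r + (b - t)). kostka h A')"
        by (simp add: sum_distrib_right)
    qed
    also have "\<dots> = (\<Sum>t\<le>min b a. \<Sum>h\<in>Hs. \<Sum>r | r \<in> R t \<and> (hstrip h r \<and> shape_size h = shape_size r + (b - t)). kostka h A')"
      by (rule sum.swap)
    also have "\<dots> = (\<Sum>t\<le>min b a. \<Sum>r\<in>R t. \<Sum>h | h \<in> Hs \<and> (hstrip h r \<and> shape_size h = shape_size r + (b - t)). kostka h A')"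
      by (intro sum.cong refl sum.swap_restrict fH fR)
    also have "\<dots> = (\<Sum>t\<le>min b a. \<Sum>r\<in>R t. \<Sum>N | N \<subseteq># A' \<and> size N = b - t. kostka r (A' - N))"
    proof (intro sum.cong refl)
      fix t r assume t: "t \<in> {..min b a}" and r: "r \<in> R t"
      have "{h \<in> Hs. hstrip h r \<and> shape_size h = shape_size r + (b - t)} = {h. hstrip h r \<and> shape_size h = shape_size r + (b - t)}"
        using r hstrip_shape_upper[OF Rsh[OF r]] unfolding Hs_def R_def by auto
      then show "(\<Sum>h | h \<in> Hs \<and> (hstrip h r \<and> shape_size h = shape_size r + (b - t)). kostka h A') =
           (\<Sum>N | N \<subseteq># A' \<and> size N = b - t. kostka r (A' - N))"
        using Suc.IH[OF A' Rsh[OF r]] by simp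
    qed
    also have "\<dots> = (\<Sum>t\<le>min b a. \<Sum>N | N \<subseteq># A' \<and> size N = b - t. \<Sum>r\<in>R t. kostka r (A' - N))"
      by (intro sum.cong refl sum.swap)
    \<comment> \<open>The branching rule, now read from right to left, puts back the
      \<open>a - t\<close> copies of \<open>v\<close> that remain in \<open>A\<close> once
      \<open>t\<close> of them have gone into \<open>N\<close>.\<close>
    also have "\<dots> = (\<Sum>t\<le>min b a. \<Sum>N | N \<subseteq># A' \<and> size N = b - t. kostka g (A - (N + replicate_mset t v)))"
    proof (intro sum.cong refl)
      fix t N assume t: "t \<in> {..min b a}" and N: "N \<in> {N. N \<subseteq># A' \<and> size N = b - t}"
      have "\<forall>x\<in>#A' - N. x < v" using A' by (meson in_diffD)
      from kostka_rec[OF Suc(3) this, where a = "a - t"]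
      have "(\<Sum>r\<in>R t. kostka r (A' - N)) = kostka g (A' - N + replicate_mset (a - t) v)" unfolding R_def by simp
      also have "A' - N + replicate_mset (a - t) v = A - (N + replicate_mset t v)"
      proof (rule multiset_eqI)
        fix x
        have "count N x \<le> count A' x" using N by (auto intro: mset_subset_eq_count)
        then show "count (A' - N + replicate_mset (a - t) v) x = count (A - (N + replicate_mset t v)) x"
          using t unfolding A by (auto simp: add.commute)
      qed
      finally show "(\<Sum>r\<in>R t. kostka r (A' - N)) = kostka g (A - (N + replicate_mset t v))" .
    qed
    also have "\<dots> = (\<Sum>N | N \<subseteq># A \<and> size N = b. kostka g (A - N))"
      unfolding A using A' by (intro sum_subset_mset_split[symmetric]) auto
    finally show ?case unfolding E_def .
  qed
  moreover have "\<forall>x\<in>#A. x < Suc (Max (set_mset A))" by (meson Max_ge finite_set_mset le_imp_less_Suc)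
  ultimately show ?thesis using assms by blast
qed

text \<open>Matrices of natural numbers with prescribed row and column sums, as multisets of positions.\<close>

definition contingency :: "'a multiset \<Rightarrow> 'b multiset \<Rightarrow> ('a \<times> 'b) multiset set" where
  "contingency A B = {M. image_mset fst M = A \<and> image_mset snd M = B}"

lemma finite_contingency: "finite (contingency A B)"
proof -
  have "contingency A B \<subseteq> {M. set_mset M \<subseteq> set_mset A \<times> set_mset B \<and> size M = size A}"
    unfolding contingency_def by force
  then show ?thesis by (rule finite_subset) (intro finite_multisets_of_size finite_SigmaI finite_set_mset)
qed

text \<open>\<open>N\<close> is the column labelled \<open>v\<close>, recorded by its row indices;
  the rest of the matrix has no entry in that column.\<close>

lemma card_contingency_rec:
  fixes A :: "'b multiset" and B :: "'a multiset"
  assumes v: "v \<notin># B"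
  shows "card (contingency A (B + replicate_mset b v)) = (\<Sum>N | N \<subseteq># A \<and> size N = b. card (contingency (A - N) B))"
proof -
  define to where "to M = (image_mset fst (filter_mset (\<lambda>p. snd p = v) M), filter_mset (\<lambda>p. snd p \<noteq> v) M)" for M :: "('b \<times> 'a) multiset"
  define fro where "fro = (\<lambda>(N, M). image_mset (\<lambda>x. (x :: 'b, v)) N + M)"
  have flt: "filter_mset (\<lambda>x. x = v) (B + replicate_mset b v) = replicate_mset b v"
    "filter_mset (\<lambda>x. x \<noteq> v) (B + replicate_mset b v) = B"
    using v by (auto intro!: multiset_eqI simp: count_eq_zero_iff)
  have "bij_betw to (contingency A (B + replicate_mset b v)) (Sigma {N. N \<subseteq># A \<and> size N = b} (\<lambda>N. contingency (A - N) B))"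
  proof (rule bij_betw_byWitness[where f'=fro])
    show "\<forall>M\<in>contingency A (B + replicate_mset b v). fro (to M) = M"
    proof
      fix M :: "('b \<times> 'a) multiset"
      have "image_mset (\<lambda>x. (x, v)) (image_mset fst (filter_mset (\<lambda>p. snd p = v) M)) = filter_mset (\<lambda>p. snd p = v) M"
        unfolding multiset.map_comp by (rule multiset.map_ident_strong) auto
      then show "fro (to M) = M" unfolding to_def fro_def by (simp add: multiset_partition[symmetric])
    qed
    show "\<forall>p\<in>Sigma {N. N \<subseteq># A \<and> size N = b} (\<lambda>N. contingency (A - N) B). to (fro p) = p"
    proof clarify
      fix N M assume M: "M \<in> contingency (A - N) B"
      have "snd p \<in># B" if "p \<in># M" for p using that M unfolding contingency_def by auto
      then have "\<forall>p\<in>#M. snd p \<noteq> v" using v by metis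
      then have flt: "filter_mset (\<lambda>p. snd p = v) M = {#}" "filter_mset (\<lambda>p. snd p \<noteq> v) M = M"
        by (auto simp: filter_mset_eq_conv)
      show "to (fro (N, M)) = (N, M)" unfolding to_def fro_def
        by (simp add: filter_mset_image_mset flt multiset.map_comp comp_def)
    qed
    show "to ` contingency A (B + replicate_mset b v) \<subseteq> Sigma {N. N \<subseteq># A \<and> size N = b} (\<lambda>N. contingency (A - N) B)"
    proof (rule image_subsetI)
      fix M assume M: "M \<in> contingency A (B + replicate_mset b v)"
      define M1 where "M1 = filter_mset (\<lambda>p. snd p = v) M"
      define M2 where "M2 = filter_mset (\<lambda>p. snd p \<noteq> v) M"
      have M12: "M = M1 + M2" unfolding M1_def M2_def by (rule multiset_partition)
      have A: "A = image_mset fst M1 + image_mset fst M2" and B: "image_mset snd M = B + replicate_mset b v"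
        using M M12 unfolding contingency_def by auto
      have "image_mset snd M1 = filter_mset (\<lambda>x. x = v) (image_mset snd M)"
        unfolding M1_def by (simp add: filter_mset_image_mset)
      also have "\<dots> = replicate_mset b v" unfolding B by (rule flt(1))
      finally have "size M1 = b" by (metis size_image_mset size_replicate_mset)
      moreover have "image_mset snd M2 = B"
      proof -
        have "image_mset snd M2 = filter_mset (\<lambda>x. x \<noteq> v) (image_mset snd M)"
          unfolding M2_def by (simp add: filter_mset_image_mset)
        also have "\<dots> = B" unfolding B by (rule flt(2))
        finally show ?thesis .
      qed
      ultimately have "(image_mset fst M1, M2) \<in> Sigma {N. N \<subseteq># A \<and> size N = b} (\<lambda>N. contingency (A - N) B)"
        using A unfolding contingency_def by auto
      then show "to M \<in> Sigma {N. N \<subseteq># A \<and> size N = b} (\<lambda>N. contingency (A - N) B)"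
        unfolding to_def M1_def M2_def .
    qed
    show "fro ` Sigma {N. N \<subseteq># A \<and> size N = b} (\<lambda>N. contingency (A - N) B) \<subseteq> contingency A (B + replicate_mset b v)"
      unfolding fro_def contingency_def by (auto simp: multiset.map_comp comp_def image_mset_const_eq)
  qed
  then show ?thesis by (intro card_bij_Sigma) (auto intro: finite_contingency finite_subset_mset)
qed

lemma card_contingency_empty: "card (contingency A ({#} :: 'b multiset)) = (if A = {#} then 1 else 0)"
proof -
  have "contingency A ({#} :: 'b multiset) = (if A = {#} then {{#}} else {})" unfolding contingency_def by auto
  then show ?thesis by (cases "A = {#}") simp_all
qed

text \<open>A proof without Robinson-Schensted insertion, by induction on the largest value of
  \<open>B\<close>. Branching strips that value from the tableau with content \<open>B\<close>,
  Pieri's rule turns the sum over enlarged shapes into a choice of \<open>N\<close> within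
  \<open>A\<close>, and \<open>N\<close> is the matching column of the matrix.\<close>

lemma kostka_cauchy:
  "(\<Sum>f | is_shape f \<and> shape_size f = size B. kostka f A * kostka f B) = card (contingency A B)"
proof -
  have "(\<Sum>f | is_shape f \<and> shape_size f = size B. kostka f A * kostka f B) = card (contingency A B)"
    if "\<forall>x\<in>#B. x < n" for n
    using that
  proof (induction n arbitrary: A B)
    case 0
    then have B: "B = {#}" by auto
    have z: "is_shape (\<lambda>_. 0)" unfolding is_shape_def by auto
    have "{f. is_shape f \<and> shape_size f = size B} = {\<lambda>_. 0}"
      using B shape_size_0_iff z by auto
    moreover have "kostka (\<lambda>_. 0) A = (if A = {#} then 1 else 0)"
      using kostka_size[OF z, of A] kostka_empty shape_size_0_iff[OF z] by auto
    ultimately show ?case using B by (simp add: kostka_empty card_contingency_empty)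
  next
    case (Suc v)
    define B' where "B' = filter_mset (\<lambda>x. x < v) B"
    define b where "b = count B v"
    have B: "B = B' + replicate_mset b v" unfolding B'_def b_def by (rule mset_split_top[OF Suc(2)])
    have B': "\<forall>x\<in>#B'. x < v" unfolding B'_def by auto
    define F where "F = {f. is_shape f \<and> shape_size f = size B}"
    define G where "G = {g. is_shape g \<and> shape_size g = size B'}"
    have fF: "finite F" and fG: "finite G" unfolding F_def G_def
      by (rule finite_subset[OF _ finite_shapes_of_size], auto)+
    have sB: "size B = size B' + b" using B by simp
    have "(\<Sum>f\<in>F. kostka f A * kostka f B) = (\<Sum>f\<in>F. \<Sum>g | g \<in> G \<and> (hstrip f g \<and> shape_size f = shape_size g + b). kostka f A * kostka g B')"
    proof (rule sum.cong[OF refl])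
      fix f assume f: "f \<in> F"
      then have fs: "is_shape f" unfolding F_def by auto
      have "{g. hstrip f g \<and> shape_size f = shape_size g + b} = {g \<in> G. hstrip f g \<and> shape_size f = shape_size g + b}"
        using f hstrip_shape_lower[OF fs] sB unfolding F_def G_def by auto
      then show "kostka f A * kostka f B = (\<Sum>g | g \<in> G \<and> (hstrip f g \<and> shape_size f = shape_size g + b). kostka f A * kostka g B')"
        unfolding B using kostka_rec[OF fs B', where a = b] by (simp add: sum_distrib_left)
    qed
    also have "\<dots> = (\<Sum>g\<in>G. \<Sum>f | f \<in> F \<and> (hstrip f g \<and> shape_size f = shape_size g + b). kostka f A * kostka g B')"
      by (rule sum.swap_restrict[OF fF fG])
    also have "\<dots> = (\<Sum>g\<in>G. \<Sum>N | N \<subseteq># A \<and> size N = b. kostka g (A - N) * kostka g B')"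
    proof (rule sum.cong[OF refl])
      fix g assume g: "g \<in> G"
      then have gs: "is_shape g" unfolding G_def by auto
      have "{f \<in> F. hstrip f g \<and> shape_size f = shape_size g + b} = {f. hstrip f g \<and> shape_size f = shape_size g + b}"
        using g hstrip_shape_upper[OF gs] sB unfolding F_def G_def by auto
      then show "(\<Sum>f | f \<in> F \<and> (hstrip f g \<and> shape_size f = shape_size g + b). kostka f A * kostka g B') =
        (\<Sum>N | N \<subseteq># A \<and> size N = b. kostka g (A - N) * kostka g B')"
        using kostka_down[OF gs, where b = b and A = A] by (simp flip: sum_distrib_right)
    qed
    also have "\<dots> = (\<Sum>N | N \<subseteq># A \<and> size N = b. \<Sum>g\<in>G. kostka g (A - N) * kostka g B')"
      by (rule sum.swap)
    also have "\<dots> = (\<Sum>N | N \<subseteq># A \<and> size N = b. card (contingency (A - N) B'))"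
      using Suc.IH[OF B'] unfolding G_def by simp
    also have "\<dots> = card (contingency A B)"
      unfolding B using B' by (intro card_contingency_rec[symmetric]) auto
    finally show ?case unfolding F_def .
  qed
  moreover have "\<forall>x\<in>#B. x < Suc (Max (set_mset B))" by (meson Max_ge finite_set_mset le_imp_less_Suc)
  ultimately show ?thesis by blast
qed

section \<open>Schur functions indexed by partitions\<close>

text \<open>Padding with zeros turns the lists into functions for which adding or removing a strip
  changes no length and neighbouring rows can be compared without case distinctions.\<close>

definition row_len :: "nat list \<Rightarrow> nat \<Rightarrow> nat" where
  "row_len l i = (if i < length l then l ! i else 0)"

text \<open>The dominant monomial attached to \<open>l\<close>, in which the variable
  \<open>i\<close> has exponent \<open>row_len l i\<close>. Writing it as an image of
  \<open>cells\<close> exhibits it as the content of the tableau filled with its own row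
  numbers.\<close>

definition row_content :: "nat list \<Rightarrow> nat multiset" where
  "row_content l = image_mset fst (mset_set (cells l))"

lemma cells_eq: "cells l = shape_cells (row_len l)"
  unfolding cells_def shape_cells_def row_len_def by (auto split: if_splits)

lemma row_len_shape:
  assumes "is_partition l" shows "is_shape (row_len l)"
proof -
  have "row_len l (Suc i) \<le> row_len l i" for i
    using assms unfolding is_partition_def row_len_def by (auto simp: sorted_wrt_iff_nth_less)
  moreover have "\<forall>i\<ge>length l. row_len l i = 0" by (auto simp: row_len_def)
  ultimately show ?thesis unfolding is_shape_def by blast
qed

text \<open>The two notions of tableau agree because in the diagram of a partition the cells to the
  left of a cell and above it are cells again.\<close>

lemma schur_eq_kostka: 
  assumes "is_partition l" shows "schur l M = int (kostka (row_len l) M)"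
proof -
  note f = row_len_shape[OF assms]
  have *: "j < row_len l i" if "i < i'" "j < row_len l i'" for i i' j
    using shape_mono[OF f, of i i'] that by simp
  have **: "(i, j) \<in> shape_cells (row_len l) \<longleftrightarrow> j < row_len l i" for i j
    by (simp add: shape_cells_def)
  have "ssyt l = tableaux (row_len l)"
    unfolding ssyt_def tableaux_def cells_eq **
    by (intro Collect_cong conj_cong refl all_cong1) (use * in auto)
  then show ?thesis unfolding schur_def kostka_def cells_eq by simp
qed

lemma row_len_size: "shape_size (row_len l) = sum_list l"
  by (subst shape_size_eq[of "length l"]) (auto simp: row_len_def sum_list_sum_nth lessThan_atLeast0)

lemma row_len_pos_iff: "is_partition l \<Longrightarrow> row_len l i \<noteq> 0 \<longleftrightarrow> i < length l"
  unfolding is_partition_def row_len_def by (metis nth_mem)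

lemma row_len_inj:
  assumes "is_partition l" "is_partition m" "row_len l = row_len m" shows "l = m"
proof -
  have "i < length l \<longleftrightarrow> i < length m" for i
    using row_len_pos_iff[OF assms(1), of i] row_len_pos_iff[OF assms(2), of i] assms(3) by simp
  then have "length l = length m" by (metis less_irrefl not_less_iff_gr_or_eq)
  then show ?thesis using assms(3) by (intro nth_equalityI) (auto simp: row_len_def fun_eq_iff split: if_splits dest: spec)
qed

lemma row_len_surj:
  assumes f: "is_shape f" obtains l where "is_partition l" "row_len l = f"
proof -
  obtain N where N: "\<forall>i\<ge>N. f i = 0" using f is_shape_def by auto
  have "{i. f i \<noteq> 0} = {..<card {i. f i \<noteq> 0}}"
  proof (rule lessThan_down_closed)
    have "i < N" if "f i \<noteq> 0" for i using N that by (meson leI)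
    then show "{i. f i \<noteq> 0} \<subseteq> {..<N}" by auto
  next
    fix x y assume "x < y" "y \<in> {i. f i \<noteq> 0}"
    then show "x \<in> {i. f i \<noteq> 0}" using shape_mono[OF f, of x y] by auto
  qed
  then obtain n where n: "{i. f i \<noteq> 0} = {..<n}" by blast
  then have iff: "f i \<noteq> 0 \<longleftrightarrow> i < n" for i by blast
  have "is_partition (map f [0..<n])"
    unfolding is_partition_def sorted_wrt_iff_nth_less using shape_mono[OF f] by (auto simp: less_imp_le) (metis iff)
  moreover have "row_len (map f [0..<n]) = f"
    using iff by (auto simp: row_len_def fun_eq_iff)
  ultimately show ?thesis using that by blast
qed

lemma bij_betw_row_len: "bij_betw row_len (partitions d) {f. is_shape f \<and> shape_size f = d}"
  unfolding bij_betw_def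
proof
  show "inj_on row_len (partitions d)"
    by (rule inj_onI) (auto simp: partitions_def intro: row_len_inj)
  show "row_len ` partitions d = {f. is_shape f \<and> shape_size f = d}"
  proof safe
    fix f assume "is_shape f" "d = shape_size f"
    then show "f \<in> row_len ` partitions (shape_size f)"
      by (metis (mono_tags) row_len_surj row_len_size image_eqI partitions_def mem_Collect_eq)
  qed (auto simp: partitions_def row_len_shape row_len_size)
qed

lemma schur_cauchy:
  "(\<Sum>l\<in>partitions (size B). schur l A * schur l B) = int (card (contingency A B))"
  unfolding kostka_cauchy[symmetric] sum.reindex_bij_betw[OF bij_betw_row_len, symmetric]
  by (simp add: schur_eq_kostka partitions_def)

lemma schur_size: "is_partition l \<Longrightarrow> schur l M \<noteq> 0 \<Longrightarrow> size M = sum_list l"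
  using kostka_size[OF row_len_shape] by (simp add: schur_eq_kostka row_len_size)

section \<open>Unitriangularity of the Kostka matrix\<close>

lemma count_content: "count (row_content l) i = row_len l i"
proof -
  have fin: "finite (cells l)"
    by (rule finite_subset[of _ "SIGMA i:{..<length l}. {..<l ! i}"]) (auto simp: cells_def)
  have "count (row_content l) i = card {p \<in> cells l. fst p = i}"
    unfolding row_content_def using fin by (simp add: count_conv_size_mset filter_mset_image_mset)
  also have "{p \<in> cells l. fst p = i} = (\<lambda>j. (i, j)) ` {..<row_len l i}"
    unfolding cells_def row_len_def by force
  also have "card \<dots> = row_len l i" by (subst card_image) (auto simp: inj_on_def)
  finally show ?thesis .
qed

lemma size_content: "is_partition l \<Longrightarrow> size (row_content l) = sum_list l"
  unfolding row_content_def cells_eq by (simp add: card_shape_cells row_len_shape row_len_size)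

lemma tableau_ge_row:
  assumes "is_shape f" "T \<in> tableaux f" "j < f i" shows "i \<le> T (i, j)"
  using assms(3)
proof (induction i)
  case (Suc i)
  then have "j < f i" using shape_mono[OF assms(1), of i "Suc i"] by simp
  moreover have "T (i, j) < T (Suc i, j)" using assms(2) Suc.prems unfolding tableaux_def by auto
  ultimately show ?case using Suc.IH by simp
qed simp

lemma card_cells_first_rows:
  fixes f :: "nat \<Rightarrow> nat" shows "card {(i, j). i < k \<and> j < f i} = (\<Sum>i<k. f i)"
proof -
  have "{(i, j). i < k \<and> j < f i} = (SIGMA i:{..<k}. {..<f i})" by auto
  then show ?thesis by simp
qed

lemma card_filter_content: 
  fixes T :: "nat \<times> nat \<Rightarrow> nat"
  assumes "is_shape f" "image_mset T (mset_set (shape_cells f)) = row_content m"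
  shows "card {c \<in> shape_cells f. T c < k} = (\<Sum>i<k. row_len m i)"
proof -
  have "card {c \<in> shape_cells f. T c < k} = size (filter_mset (\<lambda>x. x < k) (image_mset T (mset_set (shape_cells f))))"
    using finite_shape_cells[OF assms(1)] by (simp add: filter_mset_image_mset)
  also have "\<dots> = (\<Sum>i\<in>set_mset (filter_mset (\<lambda>x. x < k) (row_content m)). count (row_content m) i)"
    unfolding assms(2) size_multiset_overloaded_eq by (intro sum.cong) auto
  also have "\<dots> = (\<Sum>i<k. count (row_content m) i)"
    by (rule sum.mono_neutral_left) (auto simp: count_eq_zero_iff)
  finally show ?thesis by (simp add: count_content)
qed

text \<open>Column strictness makes every entry at least its row number, so the entries below
  \<open>k\<close> all sit in the first \<open>k\<close> rows; counting both sets of cells gives the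
  inequality.\<close>

lemma schur_content_dominance:
  assumes l: "is_partition l" and "schur l (row_content m) \<noteq> 0"
  shows "(\<Sum>i<k. row_len m i) \<le> (\<Sum>i<k. row_len l i)"
proof -
  let ?f = "row_len l"
  have f: "is_shape ?f" using row_len_shape[OF l] .
  obtain T where T: "T \<in> tableaux ?f" "image_mset T (mset_set (shape_cells ?f)) = row_content m"
    using assms(2) unfolding schur_eq_kostka[OF l] kostka_def by (metis (mono_tags, lifting) Collect_empty_eq card.empty of_nat_0)
  have "{c \<in> shape_cells ?f. T c < k} \<subseteq> {(i, j). i < k \<and> j < ?f i}"
    using tableau_ge_row[OF f T(1)] unfolding shape_cells_def by (auto intro: le_less_trans)
  moreover have "finite {(i, j). i < k \<and> j < ?f i}"
    by (rule finite_subset[OF _ finite_shape_cells[OF f]]) (auto simp: shape_cells_def)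
  ultimately have "card {c \<in> shape_cells ?f. T c < k} \<le> card {(i, j). i < k \<and> j < ?f i}"
    by (intro card_mono)
  then show ?thesis by (simp only: card_filter_content[OF f T(2)] card_cells_first_rows)
qed

text \<open>For equal shape and content the dominance count is an equality: the entries below
  \<open>k\<close> fill the first \<open>k\<close> rows completely for every \<open>k\<close>, which
  forces each cell to hold its row number.\<close>

lemma schur_content_self:
  assumes l: "is_partition l" shows "schur l (row_content l) = 1"
proof -
  let ?f = "row_len l"
  have f: "is_shape ?f" using row_len_shape[OF l] .
  have fin: "finite {(i, j). i < k \<and> j < ?f i}" for k
    by (rule finite_subset[OF _ finite_shape_cells[OF f]]) (auto simp: shape_cells_def)
  let ?T = "restrict fst (shape_cells ?f)"
  have "T = ?T" if T: "T \<in> tableaux ?f" "image_mset T (mset_set (shape_cells ?f)) = row_content l" for T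
  proof -
    have sub: "{c \<in> shape_cells ?f. T c < k} \<subseteq> {(i, j). i < k \<and> j < ?f i}" for k
      using tableau_ge_row[OF f T(1)] unfolding shape_cells_def by (auto intro: le_less_trans)
    have "{c \<in> shape_cells ?f. T c < k} = {(i, j). i < k \<and> j < ?f i}" for k
      by (rule card_subset_eq[OF fin sub]) (simp only: card_filter_content[OF f T(2)] card_cells_first_rows)
    then have "T (i, j) < Suc i" if "j < ?f i" for i j using that by (auto simp: set_eq_iff)
    then have "T (i, j) = i" if "j < ?f i" for i j
      using tableau_ge_row[OF f T(1) that] that by (simp add: le_antisym less_Suc_eq_le)
    moreover have "T c = undefined" if "c \<notin> shape_cells ?f" for c using T(1) that unfolding tableaux_def by auto
    ultimately show ?thesis unfolding shape_cells_def by (auto simp: fun_eq_iff)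
  qed
  moreover have "?T \<in> tableaux ?f"
    unfolding tableaux_def
  proof (intro CollectI conjI allI impI)
    fix i i' j assume h: "i < i'" "j < ?f i'"
    then have "j < ?f i" using shape_mono[OF f, of i i'] by simp
    then show "?T (i, j) < ?T (i', j)" using h by (simp add: shape_cells_def)
  qed (auto simp: shape_cells_def PiE_def)
  moreover have "image_mset ?T (mset_set (shape_cells ?f)) = row_content l"
    unfolding row_content_def cells_eq using finite_shape_cells[OF f] by (intro image_mset_cong) auto
  ultimately have "{T \<in> tableaux ?f. image_mset T (mset_set (shape_cells ?f)) = row_content l} = {?T}" by blast
  then show ?thesis unfolding schur_eq_kostka[OF l] kostka_def by simp
qed

lemma sum_row_len_Cons: "(\<Sum>i<Suc k. row_len (x # l) i) = x + (\<Sum>i<k. row_len l i)"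
proof -
  have "row_len (x # l) (Suc i) = row_len l i" for i by (simp add: row_len_def)
  then show ?thesis by (simp add: sum.lessThan_Suc_shift row_len_def[of _ 0] del: sum.lessThan_Suc)
qed

text \<open>Dominance is only a partial order. The first part in which two lists differ decides both
  comparisons, and the lexicographic order is the linear one in which \<open>partition_list\<close>
  is arranged, so triangularity with respect to it becomes triangularity of matrices.\<close>

lemma dominance_imp_lex:
  assumes "0 \<notin> set m" "\<And>k. (\<Sum>i<k. row_len m i) \<le> (\<Sum>i<k. row_len l i)"
  shows "m \<le> l"
  using assms
proof (induction m arbitrary: l)
  case (Cons x m)
  show ?case
  proof (cases l)
    case Nil
    then show ?thesis using Cons.prems(2)[of 1] Cons.prems(1) by (simp add: row_len_def)
  next
    case l: (Cons y l')
    have "x \<le> y" using Cons.prems(2)[of 1] by (simp add: l row_len_def)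
    moreover have "m \<le> l'" if "x = y"
    proof (rule Cons.IH)
      show "0 \<notin> set m" using Cons.prems(1) by simp
      show "(\<Sum>i<k. row_len m i) \<le> (\<Sum>i<k. row_len l' i)" for k
        using Cons.prems(2)[of "Suc k"] that unfolding l sum_row_len_Cons by simp
    qed
    ultimately show ?thesis by (auto simp: l)
  qed
qed simp

lemma schur_content_triangular:
  "is_partition l \<Longrightarrow> is_partition m \<Longrightarrow> schur l (row_content m) \<noteq> 0 \<Longrightarrow> m \<le> l"
  by (rule dominance_imp_lex) (auto simp: is_partition_def intro: schur_content_dominance)

section \<open>Schur expansions\<close>

text \<open>Stated for adjacent transpositions only, which is the form in which
  \<open>kostka_swap\<close> provides the symmetry; they generate all finitary permutations of the
  variables.\<close>

definition symmetric_series :: "series \<Rightarrow> bool" where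
  "symmetric_series f \<longleftrightarrow> (\<forall>v M. f (image_mset (transpose v (Suc v)) M) = f M)"

lemma symmetric_series_transpose:
  assumes "symmetric_series f" shows "f (image_mset (transpose a b) M) = f M"
proof -
  have *: "f (image_mset (transpose a (a + n)) M) = f M" for a n M
  proof (induction n arbitrary: M)
    case (Suc n)
    show ?case
    proof (cases "n = 0")
      case True
      then show ?thesis using assms by (simp add: symmetric_series_def)
    next
      case False
      let ?s = "transpose (a + n) (Suc (a + n))"
      \<comment> \<open>The longer transposition is conjugate to the shorter one by an adjacent
        transposition.\<close>
      have "transpose a (a + Suc n) = ?s \<circ> transpose a (a + n) \<circ> ?s"
        using False by (auto simp: fun_eq_iff transpose_def)
      then have "f (image_mset (transpose a (a + Suc n)) M)
         = f (image_mset ?s (image_mset (transpose a (a + n)) (image_mset ?s M)))"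
        by (simp add: multiset.map_comp comp_assoc)
      also have "\<dots> = f M" using assms Suc.IH by (simp add: symmetric_series_def)
      finally show ?thesis .
    qed
  qed simp
  show ?thesis
  proof (cases "a \<le> b")
    case True
    then show ?thesis using *[of a "b - a"] by simp
  next
    case False
    then show ?thesis using *[of b "a - b"] by (simp add: transpose_commute)
  qed
qed

lemma symmetric_series_permutes:
  assumes "symmetric_series f" "p permutes S" "finite S" shows "f (image_mset p M) = f M"
  using assms(2,3)
proof (induction p rule: permutes_induct)
  case (swap a b p)
  have "f (image_mset (transpose a b \<circ> p) M) = f (image_mset (transpose a b) (image_mset p M))"
    by (simp only: multiset.map_comp)
  then show ?case using symmetric_series_transpose[OF assms(1)] swap by metis
qed simp

text \<open>Within \<open>A \<union> B\<close> the complements of \<open>A\<close> and of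
  \<open>B\<close> have equal cardinality, so any bijection between them completes \<open>b\<close>
  to a permutation.\<close>

lemma bij_betw_extends_permutes:
  assumes b: "bij_betw b A B" and fin: "finite A"
  obtains p where "p permutes (A \<union> B)" "\<And>x. x \<in> A \<Longrightarrow> p x = b x"
proof -
  let ?S = "A \<union> B"
  have finB: "finite B" using b fin bij_betw_finite by blast
  have "card (?S - A) = card (?S - B)"
    using bij_betw_same_card[OF b] fin finB by (simp add: card_Diff_subset)
  then obtain c where c: "bij_betw c (?S - A) (?S - B)"
    using fin finB by (meson finite_Diff finite_UnI finite_same_card_bij)
  define p where "p x = (if x \<in> A then b x else if x \<in> B then c x else x)" for x
  have "bij_betw p A B" by (rule bij_betw_cong[THEN iffD2, OF _ b]) (simp add: p_def)
  moreover have "bij_betw p (?S - A) (?S - B)" by (rule bij_betw_cong[THEN iffD2, OF _ c]) (auto simp: p_def)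
  ultimately have "bij_betw p (A \<union> (?S - A)) (B \<union> (?S - B))" by (rule bij_betw_combine) auto
  moreover have "A \<union> (?S - A) = ?S" "B \<union> (?S - B) = ?S" by auto
  ultimately have "p permutes ?S" by (intro bij_imp_permutes) (auto simp: p_def)
  then show ?thesis using that by (simp add: p_def)
qed

text \<open>Sorting the variables of \<open>M\<close> by decreasing multiplicity gives
  \<open>l\<close>, and a permutation renames \<open>0, 1, ...\<close> to the sorted variables. The
  partition is chosen before \<open>f\<close>, so that a series and the Schur functions in its
  expansion can be compared at the same dominant monomial.\<close>

lemma symmetric_series_content:
  obtains l where "l \<in> partitions (size M)" "\<And>f. symmetric_series f \<Longrightarrow> f M = f (row_content l)"
proof -
  define xs where "xs = rev (sort_key (count M) (sorted_list_of_set (set_mset M)))"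
  define l where "l = map (count M) xs"
  have xs: "set xs = set_mset M" "distinct xs" unfolding xs_def by auto
  have "sorted_wrt (\<ge>) l" 
    unfolding l_def xs_def by (simp only: rev_map[symmetric] sorted_wrt_rev sorted_sort_key)
  moreover have "0 \<notin> set l"
  proof
    assume "0 \<in> set l"
    then obtain x where "count M x = 0" "x \<in> set xs" unfolding l_def by fastforce
    then show False using xs(1) by (simp add: count_eq_zero_iff)
  qed
  moreover have "sum_list l = size M"
    unfolding l_def size_multiset_overloaded_eq using xs by (simp add: sum_list_distinct_conv_sum_set)
  ultimately have l: "l \<in> partitions (size M)" unfolding partitions_def is_partition_def by simp
  have "bij_betw ((!) xs) {..<length xs} (set xs)" by (rule bij_betw_nth[OF xs(2)]) auto
  then obtain p where p: "p permutes ({..<length xs} \<union> set xs)" "\<And>i. i < length xs \<Longrightarrow> p i = xs ! i"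
    by (rule bij_betw_extends_permutes) auto
  have "image_mset p (row_content l) = M"
  proof (rule multiset_eqI)
    fix x
    have inj: "inj p" using p(1) permutes_inj by blast
    obtain y where y: "x = p y" using p(1) permutes_surj by (metis surj_def)
    have "count (image_mset p (row_content l)) (p y) = count (row_content l) y"
      by (simp add: count_conv_size_mset filter_mset_image_mset inj_eq[OF inj])
    then have "count (image_mset p (row_content l)) x = row_len l y" by (simp add: y count_content)
    also have "\<dots> = count M x"
    proof (cases "y < length xs")
      case True then show ?thesis using p(2) y by (simp add: row_len_def l_def)
    next
      case False
      have "x \<notin># M"
      proof
        assume "x \<in># M"
        then obtain i where "i < length xs" "xs ! i = x" using xs(1) by (metis in_set_conv_nth)
        then have "p i = p y" using p(2) y by simp
        then show False using inj False \<open>i < length xs\<close> by (auto simp: inj_eq)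
      qed
      then show ?thesis using False by (simp add: row_len_def l_def count_eq_zero_iff)
    qed
    finally show "count (image_mset p (row_content l)) x = count M x" .
  qed
  then have "f M = f (row_content l)" if "symmetric_series f" for f
    using symmetric_series_permutes[OF that p(1), of "row_content l"] by simp
  then show ?thesis using l that by blast
qed

section \<open>Symmetry and homogeneity of products of Schur functions\<close>

lemma symmetric_series_schur: "is_partition l \<Longrightarrow> symmetric_series (schur l)"
  unfolding symmetric_series_def using kostka_swap[OF row_len_shape] by (simp add: schur_eq_kostka)

lemma symmetric_series_one: "symmetric_series series_one"
  unfolding symmetric_series_def series_one_def by simp

lemma image_mset_transpose_cancel: "image_mset (transpose a b) (image_mset (transpose a b) M) = M"
  by (simp add: multiset.map_comp)

lemma symmetric_series_mult:
  assumes "symmetric_series f" "symmetric_series g" shows "symmetric_series (series_mult f g)"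
  unfolding symmetric_series_def
proof (intro allI)
  fix v M
  let ?t = "image_mset (transpose v (Suc v))"
  have t: "?t (?t N) = N" for N by (rule image_mset_transpose_cancel)
  have sub: "?t N \<subseteq># ?t M \<longleftrightarrow> N \<subseteq># M" for N M
    using image_mset_subseteq_mono t by metis
  show "series_mult f g (?t M) = series_mult f g M"
    unfolding series_mult_def
  proof (rule sum.reindex_bij_witness[where i = ?t and j = ?t])
    fix N assume N: "N \<in> {N. N \<subseteq># ?t M}"
    then show N': "?t N \<in> {N. N \<subseteq># M}" using sub[of N "?t M"] t by simp
    have "?t (?t M - N) = M - ?t N"
      using N by (simp add: image_mset_Diff t)
    then show "f (?t N) * g (M - ?t N) = f N * g (?t M - N)"
      using assms unfolding symmetric_series_def by metis
  qed (use t sub in auto)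
qed

lemma symmetric_series_schur_prod:
  "\<forall>b\<in>set bs. is_partition b \<Longrightarrow> symmetric_series (schur_prod bs)"
  by (induction bs) (auto simp: schur_prod_def symmetric_series_one symmetric_series_mult symmetric_series_schur)

lemma schur_prod_size:
  "\<forall>b\<in>set bs. is_partition b \<Longrightarrow> schur_prod bs M \<noteq> 0 \<Longrightarrow> size M = sum_list (map sum_list bs)"
proof (induction bs arbitrary: M)
  case Nil
  then show ?case by (auto simp: schur_prod_def series_one_def split: if_splits)
next
  case (Cons b bs)
  have "(\<Sum>N | N \<subseteq># M. schur b N * schur_prod bs (M - N)) \<noteq> 0"
    using Cons.prems(2) by (simp add: schur_prod_def series_mult_def)
  then obtain N where "N \<subseteq># M" "schur b N * schur_prod bs (M - N) \<noteq> 0"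
    by (metis (mono_tags, lifting) mem_Collect_eq sum.neutral)
  then have "size N = sum_list b" "size (M - N) = sum_list (map sum_list bs)" "size N \<le> size M"
    using Cons schur_size[of b N] by (auto dest: size_mset_mono)
  then show ?case using \<open>N \<subseteq># M\<close> by (simp add: size_Diff_submset)
qed

text \<open>Back substitution from the largest index downwards: row \<open>b\<close> of the new
  least index vanishes in all larger columns, so its coefficient can be chosen without disturbing
  the equations already solved. The unit diagonal keeps the solution integral.\<close>

lemma triangular_solve:
  fixes K :: "'a :: linorder \<Rightarrow> 'a \<Rightarrow> int"
  assumes "finite S" "\<And>l. l \<in> S \<Longrightarrow> K l l = 1" "\<And>l m. l \<in> S \<Longrightarrow> m \<in> S \<Longrightarrow> K l m \<noteq> 0 \<Longrightarrow> m \<le> l"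
  shows "\<exists>c. \<forall>m\<in>S. f m = (\<Sum>l\<in>S. c l * K l m)"
  using assms
proof (induction S rule: finite_linorder_min_induct)
  case (insert b A)
  then obtain c where c: "\<forall>m\<in>A. f m = (\<Sum>l\<in>A. c l * K l m)" by auto
  have nb: "b \<notin> A" using insert.hyps by auto
  define c' where "c' = c(b := f b - (\<Sum>l\<in>A. c l * K l b))"
  have c': "(\<Sum>l\<in>A. c' l * K l m) = (\<Sum>l\<in>A. c l * K l m)" for m
    using nb by (intro sum.cong) (auto simp: c'_def)
  have "K b m = 0" if "m \<in> A" for m
    using insert.prems(2)[of b m] insert.hyps that by force
  then have "\<forall>m\<in>insert b A. f m = (\<Sum>l\<in>insert b A. c' l * K l m)"
    using c nb insert by (auto simp: c') (simp add: c'_def)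
  then show ?case by blast
qed simp

text \<open>The coefficients are fixed by matching the dominant monomials of degree
  \<open>d\<close>, a unitriangular system; symmetry carries the equality to all other monomials of
  that degree, and both sides vanish in other degrees.\<close>

lemma symmetric_series_schur_expansion:
  assumes "symmetric_series f" "\<And>M. f M \<noteq> 0 \<Longrightarrow> size M = d"
  shows "\<exists>c. \<forall>M. f M = (\<Sum>l\<in>partitions d. c l * schur l M)"
proof -
  obtain c where c: "\<forall>m\<in>partitions d. f (row_content m) = (\<Sum>l\<in>partitions d. c l * schur l (row_content m))"
  proof -
    have "\<exists>c. \<forall>m\<in>partitions d. f (row_content m) = (\<Sum>l\<in>partitions d. c l * schur l (row_content m))"
      by (rule triangular_solve)
         (auto simp: finite_partitions[unfolded partitions_def] partitions_def schur_content_self intro: schur_content_triangular)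
    then show ?thesis using that by blast
  qed
  have "f M = (\<Sum>l\<in>partitions d. c l * schur l M)" for M
  proof (cases "size M = d")
    case True
    obtain m where m: "m \<in> partitions d" "\<And>f. symmetric_series f \<Longrightarrow> f M = f (row_content m)"
      using symmetric_series_content[of M] True by metis
    have eq: "schur l M = schur l (row_content m)" if "l \<in> partitions d" for l
      using that by (intro m(2) symmetric_series_schur) (simp add: partitions_def)
    have "f M = (\<Sum>l\<in>partitions d. c l * schur l (row_content m))" using m(2)[OF assms(1)] c m(1) by simp
    then show ?thesis using eq by simp
  next
    case False
    then have "schur l M = 0" if "l \<in> partitions d" for l
      using that schur_size[of l M] by (auto simp: partitions_def)
    moreover have "f M = 0" using assms(2) False by blast
    ultimately show ?thesis by simp
  qed
  then show ?thesis by blast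
qed

text \<open>Among the indices in the support, only the lexicographically largest one,
  \<open>k\<close>, has a Schur function containing the dominant monomial of \<open>k\<close>, and
  it occurs there with coefficient 1.\<close>

lemma schur_lin_indep:
  assumes fin: "finite {m. e m \<noteq> 0}" and part: "\<And>m. e m \<noteq> 0 \<Longrightarrow> is_partition m"
    and zero: "\<And>M. (\<Sum>m | e m \<noteq> 0. e m * schur m M) = 0"
  shows "e m = 0"
proof (rule ccontr)
  assume "e m \<noteq> 0"
  then have ne: "{m. e m \<noteq> 0} \<noteq> {}" by auto
  define k where "k = Max {m. e m \<noteq> 0}"
  have k: "e k \<noteq> 0" using Max_in[OF fin ne] by (simp add: k_def)
  have "e l * schur l (row_content k) = (if l = k then e k else 0)" if "e l \<noteq> 0" for l
  proof (cases "l = k")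
    case False
    have "l \<le> k" using that fin by (auto simp: k_def)
    then have "schur l (row_content k) = 0"
      using schur_content_triangular[OF part[OF that] part[OF k]] False by force
    then show ?thesis using False by simp
  qed (simp add: schur_content_self part k)
  then have "(\<Sum>l | e l \<noteq> 0. e l * schur l (row_content k)) = (\<Sum>l | e l \<noteq> 0. if l = k then e k else 0)"
    by (intro sum.cong) auto
  also have "\<dots> = e k" using fin k by simp
  finally show False using zero k by simp
qed

text \<open>This resolves the definite description in \<open>lr_coeff\<close>: existence comes from
  symmetry and homogeneity of the product, uniqueness from linear independence applied to the
  difference of two families.\<close>

lemma lr_coeff_expansion:
  assumes bs: "\<forall>b\<in>set bs. is_partition b"
  shows "lr_coeff l bs \<noteq> 0 \<Longrightarrow> is_partition l \<and> sum_list l = sum_list (map sum_list bs)"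
    and "schur_prod bs M = (\<Sum>l\<in>partitions (sum_list (map sum_list bs)). lr_coeff l bs * schur l M)"
proof -
  define d where "d = sum_list (map sum_list bs)"
  define P where "P c \<longleftrightarrow> finite {m. c m \<noteq> 0} \<and> (\<forall>m. c m \<noteq> 0 \<longrightarrow> is_partition m) \<and>
            schur_prod bs = (\<lambda>M. \<Sum>m | c m \<noteq> 0. c m * schur m M)" for c
  obtain c0 where c0: "\<And>M. schur_prod bs M = (\<Sum>l\<in>partitions d. c0 l * schur l M)"
    using symmetric_series_schur_expansion[OF symmetric_series_schur_prod[OF bs], of d] schur_prod_size[OF bs] d_def
    by metis
  define c where "c l = (if l \<in> partitions d then c0 l else 0)" for l
  have supp: "{m. c m \<noteq> 0} \<subseteq> partitions d" by (auto simp: c_def)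
  have sum_c: "schur_prod bs M = (\<Sum>l\<in>partitions d. c l * schur l M)" for M
    unfolding c0 by (intro sum.cong) (auto simp: c_def)
  also have "\<dots> M = (\<Sum>l | c l \<noteq> 0. c l * schur l M)" for M
    using supp by (intro sum.mono_neutral_right finite_partitions) auto
  finally have "schur_prod bs = (\<lambda>M. \<Sum>l | c l \<noteq> 0. c l * schur l M)" by blast
  then have Pc: "P c" unfolding P_def using supp finite_subset[OF supp finite_partitions]
    by (auto simp: partitions_def)
  have uniq: "c' = c" if c': "P c'" for c'
  proof
    fix m
    define e where "e m = c' m - c m" for m
    have fin: "finite ({m. c' m \<noteq> 0} \<union> {m. c m \<noteq> 0})" using Pc c' unfolding P_def by auto
    have sub: "{m. e m \<noteq> 0} \<subseteq> {m. c' m \<noteq> 0} \<union> {m. c m \<noteq> 0}" unfolding e_def by auto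
    have "e m = 0"
    proof (rule schur_lin_indep)
      show "finite {m. e m \<noteq> 0}" using sub fin by (rule finite_subset)
      show "is_partition m" if "e m \<noteq> 0" for m using sub that Pc c' unfolding P_def by auto
      fix M
      have ext: "(\<Sum>m | a m \<noteq> 0. a m * schur m M) = (\<Sum>m\<in>{m. c' m \<noteq> 0} \<union> {m. c m \<noteq> 0}. a m * schur m M)"
        if "{m. a m \<noteq> 0} \<subseteq> {m. c' m \<noteq> 0} \<union> {m. c m \<noteq> 0}" for a
        using that fin by (intro sum.mono_neutral_left) auto
      have "(\<Sum>m | c' m \<noteq> 0. c' m * schur m M) = (\<Sum>m | c m \<noteq> 0. c m * schur m M)"
        using Pc c' unfolding P_def by metis
      then show "(\<Sum>m | e m \<noteq> 0. e m * schur m M) = 0"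
        unfolding ext[OF sub] using ext[of c] ext[of c'] by (simp add: e_def left_diff_distrib sum_subtractf)
    qed
    then show "c' m = c m" by (simp add: e_def)
  qed
  have "(THE c. P c) = c" using Pc uniq by (rule the_equality)
  then have lr: "lr_coeff l bs = c l" for l unfolding lr_coeff_def P_def by simp
  show "lr_coeff l bs \<noteq> 0 \<Longrightarrow> is_partition l \<and> sum_list l = sum_list (map sum_list bs)"
    using supp unfolding lr d_def partitions_def by auto
  show "schur_prod bs M = (\<Sum>l\<in>partitions (sum_list (map sum_list bs)). lr_coeff l bs * schur l M)"
    unfolding lr using sum_c unfolding d_def .
qed

text \<open>One matrix per colour, with the margins of the matrices adding up to \<open>A\<close>
  and \<open>B\<close>. The colour is kept in the index of a single multiset so that such an object
  is the content of a function into triples, which is how it meets the symmetric group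
  later.\<close>

definition coloured_contingency :: "nat \<Rightarrow> 'a multiset \<Rightarrow> 'b multiset \<Rightarrow> ('a \<times> 'b \<times> nat) multiset set" where
  "coloured_contingency n A B = {M. image_mset fst M = A \<and> image_mset (\<lambda>p. fst (snd p)) M = B \<and>
     (\<forall>p\<in>#M. snd (snd p) < n)}"

lemma finite_coloured_contingency: "finite (coloured_contingency n A B)"
proof -
  have "coloured_contingency n A B \<subseteq> {M. set_mset M \<subseteq> set_mset A \<times> set_mset B \<times> {..<n} \<and> size M = size A}"
  proof
    fix M assume M: "M \<in> coloured_contingency n A B"
    then have A: "A = image_mset fst M" and B: "B = image_mset (\<lambda>p. fst (snd p)) M"
      and c: "\<forall>p\<in>#M. snd (snd p) < n" unfolding coloured_contingency_def by auto
    show "M \<in> {M. set_mset M \<subseteq> set_mset A \<times> set_mset B \<times> {..<n} \<and> size M = size A}"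
      unfolding A B using c by force
  qed
  then show ?thesis by (rule finite_subset) (intro finite_multisets_of_size finite_SigmaI finite_set_mset finite_lessThan)
qed

text \<open>The layer of colour \<open>n\<close> is split off; \<open>N\<close> and
  \<open>N'\<close> are its margins. The resulting sum has the form of a product of two series, each
  in two sets of variables.\<close>

lemma card_coloured_contingency_Suc:
  fixes A :: "'a multiset" and B :: "'b multiset"
  shows "card (coloured_contingency (Suc n) A B) = (\<Sum>N | N \<subseteq># A. \<Sum>N' | N' \<subseteq># B.
     card (contingency N N') * card (coloured_contingency n (A - N) (B - N')))"
proof -
  define drop_col where "drop_col = (\<lambda>p :: 'a \<times> 'b \<times> nat. (fst p, fst (snd p)))"
  define G where "G = {N. N \<subseteq># A} \<times> {N'. N' \<subseteq># B}"
  define H where "H = (\<lambda>(N, N'). contingency N N' \<times> coloured_contingency n (A - N) (B - N'))"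
  define hi where "hi M = image_mset drop_col (filter_mset (\<lambda>p. snd (snd p) = n) M)" for M
  define lo where "lo M = filter_mset (\<lambda>p. snd (snd p) \<noteq> n) M" for M :: "('a \<times> 'b \<times> nat) multiset"
  define to where "to M = ((image_mset fst (hi M), image_mset snd (hi M)), (hi M, lo M))" for M
  define fro where "fro = (\<lambda>(x :: 'a multiset \<times> 'b multiset, (M1, M2)). image_mset (\<lambda>(a :: 'a, b :: 'b). (a, b, n)) M1 + M2)"
  have "bij_betw to (coloured_contingency (Suc n) A B) (Sigma G H)"
  proof (rule bij_betw_byWitness[where f'=fro])
    show "\<forall>M\<in>coloured_contingency (Suc n) A B. fro (to M) = M"
    proof
      fix M :: "('a \<times> 'b \<times> nat) multiset"
      have "image_mset (\<lambda>(a, b). (a, b, n)) (hi M) = filter_mset (\<lambda>p. snd (snd p) = n) M"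
        unfolding hi_def multiset.map_comp by (rule multiset.map_ident_strong) (auto simp: drop_col_def)
      then show "fro (to M) = M" unfolding to_def fro_def lo_def by (simp add: multiset_partition[symmetric])
    qed
    show "\<forall>x\<in>Sigma G H. to (fro x) = x"
    proof clarify
      fix N N' M1 M2 assume "(M1, M2) \<in> H (N, N')"
      then have M: "M1 \<in> contingency N N'" "M2 \<in> coloured_contingency n (A - N) (B - N')"
        unfolding H_def by auto
      have flt: "filter_mset (\<lambda>p. snd (snd p) = n) M2 = {#}" "filter_mset (\<lambda>p. snd (snd p) \<noteq> n) M2 = M2"
        using M(2) unfolding coloured_contingency_def by (auto simp: filter_mset_eq_conv)
      have "hi (fro ((N, N'), M1, M2)) = M1"
        unfolding hi_def fro_def
        by (simp add: filter_mset_image_mset flt multiset.map_comp comp_def drop_col_def case_prod_unfold)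
      moreover have "lo (fro ((N, N'), M1, M2)) = M2"
        unfolding lo_def fro_def by (simp add: filter_mset_image_mset flt case_prod_unfold)
      ultimately show "to (fro ((N, N'), M1, M2)) = ((N, N'), M1, M2)"
        using M(1) unfolding to_def contingency_def by simp
    qed
    show "to ` coloured_contingency (Suc n) A B \<subseteq> Sigma G H"
    proof (rule image_subsetI)
      fix M assume M: "M \<in> coloured_contingency (Suc n) A B"
      have part: "M = filter_mset (\<lambda>p. snd (snd p) = n) M + lo M" unfolding lo_def by (rule multiset_partition)
      have "A = image_mset fst (filter_mset (\<lambda>p. snd (snd p) = n) M) + image_mset fst (lo M)"
        using M unfolding coloured_contingency_def by (metis (mono_tags, lifting) part image_mset_union mem_Collect_eq)
      then have A: "A = image_mset fst (hi M) + image_mset fst (lo M)"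
        unfolding hi_def by (simp add: multiset.map_comp comp_def drop_col_def)
      have "B = image_mset (\<lambda>p. fst (snd p)) (filter_mset (\<lambda>p. snd (snd p) = n) M) + image_mset (\<lambda>p. fst (snd p)) (lo M)"
        using M unfolding coloured_contingency_def by (metis (mono_tags, lifting) part image_mset_union mem_Collect_eq)
      then have B: "B = image_mset snd (hi M) + image_mset (\<lambda>p. fst (snd p)) (lo M)"
        unfolding hi_def by (simp add: multiset.map_comp comp_def drop_col_def)
      have "\<forall>p\<in>#lo M. snd (snd p) < n"
        using M unfolding coloured_contingency_def lo_def by force
      then have "lo M \<in> coloured_contingency n (A - image_mset fst (hi M)) (B - image_mset snd (hi M))"
        unfolding coloured_contingency_def A B by simp
      then show "to M \<in> Sigma G H"
        unfolding to_def G_def H_def contingency_def using A B by simp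
    qed
    show "fro ` Sigma G H \<subseteq> coloured_contingency (Suc n) A B"
    proof clarify
      fix N N' M1 M2 assume g: "(N, N') \<in> G" and "(M1, M2) \<in> H (N, N')"
      then have M: "M1 \<in> contingency N N'" "M2 \<in> coloured_contingency n (A - N) (B - N')"
        unfolding H_def by auto
      show "fro ((N, N'), M1, M2) \<in> coloured_contingency (Suc n) A B"
        using M g unfolding fro_def contingency_def coloured_contingency_def G_def
        by (auto simp: multiset.map_comp comp_def case_prod_unfold less_SucI)
    qed
  qed
  moreover have "finite G" unfolding G_def using finite_subset_mset[of A "\<lambda>_. True"] finite_subset_mset[of B "\<lambda>_. True"] by simp
  moreover have "finite (H g)" for g
    unfolding H_def by (auto simp: finite_contingency finite_coloured_contingency split: prod.split)
  ultimately have "card (coloured_contingency (Suc n) A B) = (\<Sum>g\<in>G. card (H g))"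
    by (intro card_bij_Sigma)
  then show ?thesis unfolding G_def H_def sum.cartesian_product
    by (simp add: case_prod_unfold card_cartesian_product)
qed

text \<open>A finite stand-in for all \<open>n\<close>-tuples of partitions: once \<open>D\<close>
  bounds the size of the content, a tuple with a larger member has a product of Schur functions with
  coefficient 0 there.\<close>

definition partition_lists_le :: "nat \<Rightarrow> nat \<Rightarrow> nat list list set" where
  "partition_lists_le n D = {bs. set bs \<subseteq> (\<Union>e\<le>D. partitions e) \<and> length bs = n}"

lemma schur_cauchy_le:
  assumes "size B \<le> D"
  shows "(\<Sum>l\<in>(\<Union>e\<le>D. partitions e). schur l A * schur l B) = int (card (contingency A B))"
proof -
  have "(\<Sum>l\<in>(\<Union>e\<le>D. partitions e). schur l A * schur l B) = (\<Sum>l\<in>partitions (size B). schur l A * schur l B)"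
    using assms schur_size[of _ B]
    by (intro sum.mono_neutral_right) (auto simp: finite_partitions, auto simp: partitions_def)
  then show ?thesis by (simp add: schur_cauchy)
qed

text \<open>The head of a tuple yields the layer of the new colour, by the ordinary Cauchy identity,
  and the tail yields the other colours. The bound \<open>D\<close> stays fixed during the induction
  while \<open>A\<close> and \<open>B\<close> shrink to \<open>A - N\<close> and
  \<open>B - N'\<close>.\<close>

lemma schur_prod_cauchy:
  assumes "size A \<le> D" "size B \<le> D"
  shows "(\<Sum>bs\<in>partition_lists_le n D. schur_prod bs A * schur_prod bs B) = int (card (coloured_contingency n A B))"
  using assms
proof (induction n arbitrary: A B)
  case 0
  have "coloured_contingency 0 A B = (if A = {#} \<and> B = {#} then {{#}} else {})"
    unfolding coloured_contingency_def by (auto simp: set_mset_eq_empty_iff[symmetric] simp del: set_mset_eq_empty_iff)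
  moreover have "partition_lists_le 0 D = {[]}" unfolding partition_lists_le_def by auto
  ultimately show ?case by (simp add: schur_prod_def series_one_def)
next
  case (Suc n)
  let ?P = "\<Union>e\<le>D. partitions e"
  have "(\<Sum>bs\<in>partition_lists_le (Suc n) D. schur_prod bs A * schur_prod bs B) =
    (\<Sum>(bs, b)\<in>partition_lists_le n D \<times> ?P. schur_prod (b # bs) A * schur_prod (b # bs) B)"
    unfolding partition_lists_le_def lists_length_Suc_eq
    by (subst sum.reindex) (auto simp: inj_on_def intro!: sum.cong)
  also have "\<dots> = (\<Sum>bs\<in>partition_lists_le n D. \<Sum>b\<in>?P. \<Sum>N | N \<subseteq># A. \<Sum>N' | N' \<subseteq># B.
       (schur b N * schur b N') * (schur_prod bs (A - N) * schur_prod bs (B - N')))"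
    unfolding sum.cartesian_product[symmetric]
    by (simp add: schur_prod_def series_mult_def sum_product mult_ac)
  also have "\<dots> = (\<Sum>bs\<in>partition_lists_le n D. \<Sum>N | N \<subseteq># A. \<Sum>N' | N' \<subseteq># B. \<Sum>b\<in>?P.
       (schur b N * schur b N') * (schur_prod bs (A - N) * schur_prod bs (B - N')))"
    by (intro sum.cong refl) (subst sum.swap, intro sum.cong refl sum.swap)
  also have "\<dots> = (\<Sum>N | N \<subseteq># A. \<Sum>N' | N' \<subseteq># B. \<Sum>bs\<in>partition_lists_le n D. \<Sum>b\<in>?P.
       (schur b N * schur b N') * (schur_prod bs (A - N) * schur_prod bs (B - N')))"
    by (subst sum.swap, intro sum.cong refl sum.swap)
  also have "\<dots> = (\<Sum>N | N \<subseteq># A. \<Sum>N' | N' \<subseteq># B.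
      (\<Sum>b\<in>?P. schur b N * schur b N') * (\<Sum>bs\<in>partition_lists_le n D. schur_prod bs (A - N) * schur_prod bs (B - N')))"
    by (intro sum.cong refl) (simp only: sum_distrib_left sum_distrib_right)
  also have "\<dots> = (\<Sum>N | N \<subseteq># A. \<Sum>N' | N' \<subseteq># B.
      int (card (contingency N N')) * int (card (coloured_contingency n (A - N) (B - N'))))"
  proof (intro sum.cong refl)
    fix N N' assume N: "N \<in> {N. N \<subseteq># A}" "N' \<in> {N'. N' \<subseteq># B}"
    have "size N' \<le> D" using N size_mset_mono[of N' B] Suc.prems by simp
    moreover have "size (A - N) \<le> D" "size (B - N') \<le> D"
      using Suc.prems N by (simp_all add: size_Diff_submset)
    ultimately show "(\<Sum>b\<in>?P. schur b N * schur b N') * (\<Sum>bs\<in>partition_lists_le n D. schur_prod bs (A - N) * schur_prod bs (B - N'))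
      = int (card (contingency N N')) * int (card (coloured_contingency n (A - N) (B - N')))"
      using Suc.IH schur_cauchy_le by simp
  qed
  also have "\<dots> = int (card (coloured_contingency (Suc n) A B))"
    by (simp add: card_coloured_contingency_Suc)
  finally show ?case .
qed

lemma finite_partition_lists_le: "finite (partition_lists_le n D)"
  unfolding partition_lists_le_def by (rule finite_lists_length_eq) (auto simp: finite_partitions)

text \<open>Expanding both factors of \<open>schur_prod bs A * schur_prod bs B\<close> in Schur
  functions and summing over \<open>bs\<close> produces exactly the sums that define
  \<open>a_coeff\<close>. In matrix form the left-hand side is an entry of the transposed Kostka
  matrix times \<open>A_mat\<close> times the Kostka matrix.\<close>

lemma a_coeff_generating:
  assumes A: "size A = d" and B: "size B = d"
  shows "(\<Sum>l\<in>partitions d. \<Sum>m\<in>partitions d. schur l A * a_coeff n l m * schur m B) =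
     int (card (coloured_contingency n A B))"
proof -
  \<comment> \<open>Products of Schur functions are homogeneous, so only tuples of total size
    \<open>d\<close> can involve a partition of \<open>d\<close>; this makes the support summed over
    in \<open>a_coeff\<close> finite.\<close>
  define S where "S = {bs \<in> partition_lists_le n d. sum_list (map sum_list bs) = d}"
  have finS: "finite S" unfolding S_def using finite_partition_lists_le by auto
  have parts: "\<forall>b\<in>set bs. is_partition b" if "bs \<in> partition_lists_le n d" for bs
    using that unfolding partition_lists_le_def partitions_def by auto
  have a: "a_coeff n l m = (\<Sum>bs\<in>S. lr_coeff l bs * lr_coeff m bs)" if "l \<in> partitions d" "m \<in> partitions d" for l m
    unfolding a_coeff_def
  proof (rule sum.mono_neutral_left[OF finS])
    show "{bs. length bs = n \<and> (\<forall>b\<in>set bs. is_partition b) \<and> lr_coeff l bs * lr_coeff m bs \<noteq> 0} \<subseteq> S"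
    proof clarify
      fix bs assume bs: "n = length bs" "\<forall>b\<in>set bs. is_partition b" "lr_coeff l bs * lr_coeff m bs \<noteq> 0"
      have tot: "sum_list (map sum_list bs) = d"
        using lr_coeff_expansion(1)[OF bs(2), of l] bs(3) that by (auto simp: partitions_def)
      moreover have "sum_list b \<le> d" if "b \<in> set bs" for b
        using member_le_sum_list[of "sum_list b" "map sum_list bs"] that tot by simp
      ultimately show "bs \<in> S" using bs unfolding S_def partition_lists_le_def partitions_def by auto
    qed
    show "\<forall>bs\<in>S - {bs. length bs = n \<and> (\<forall>b\<in>set bs. is_partition b) \<and> lr_coeff l bs * lr_coeff m bs \<noteq> 0}.
        lr_coeff l bs * lr_coeff m bs = 0"
      using parts unfolding S_def by (auto simp: partition_lists_le_def)
  qed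
  have "(\<Sum>l\<in>partitions d. \<Sum>m\<in>partitions d. schur l A * a_coeff n l m * schur m B) =
    (\<Sum>l\<in>partitions d. \<Sum>m\<in>partitions d. \<Sum>bs\<in>S. (lr_coeff l bs * schur l A) * (lr_coeff m bs * schur m B))"
    by (intro sum.cong refl) (simp add: a sum_distrib_left sum_distrib_right mult_ac)
  also have "\<dots> = (\<Sum>l\<in>partitions d. \<Sum>bs\<in>S. \<Sum>m\<in>partitions d. (lr_coeff l bs * schur l A) * (lr_coeff m bs * schur m B))"
    by (intro sum.cong refl sum.swap)
  also have "\<dots> = (\<Sum>bs\<in>S. \<Sum>l\<in>partitions d. \<Sum>m\<in>partitions d. (lr_coeff l bs * schur l A) * (lr_coeff m bs * schur m B))"
    by (rule sum.swap)
  also have "\<dots> = (\<Sum>bs\<in>S. schur_prod bs A * schur_prod bs B)"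
  proof (rule sum.cong[OF refl])
    fix bs assume bs: "bs \<in> S"
    have "schur_prod bs M = (\<Sum>l\<in>partitions d. lr_coeff l bs * schur l M)" for M
      using lr_coeff_expansion(2)[OF parts, of bs M] bs unfolding S_def by auto
    then show "(\<Sum>l\<in>partitions d. \<Sum>m\<in>partitions d. (lr_coeff l bs * schur l A) * (lr_coeff m bs * schur m B)) = schur_prod bs A * schur_prod bs B"
      by (simp add: sum_product)
  qed
  also have "\<dots> = (\<Sum>bs\<in>partition_lists_le n d. schur_prod bs A * schur_prod bs B)"
    using schur_prod_size[OF parts, of _ A] A finite_partition_lists_le unfolding S_def
    by (intro sum.mono_neutral_left) auto
  also have "\<dots> = int (card (coloured_contingency n A B))"
    using A B by (intro schur_prod_cauchy) auto
  finally show ?thesis .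
qed

section \<open>Permutation characters\<close>

abbreviation pinv :: "(nat \<Rightarrow> nat) \<Rightarrow> nat \<Rightarrow> nat" where "pinv \<equiv> Hilbert_Choice.inv"

abbreviation perms :: "nat \<Rightarrow> (nat \<Rightarrow> nat) set" where "perms d \<equiv> {p. p permutes {..<d}}"

definition fn_content :: "nat \<Rightarrow> (nat \<Rightarrow> 'a) \<Rightarrow> 'a multiset" where
  "fn_content d f = image_mset f (mset_set {..<d})"

definition fixed_fns :: "nat \<Rightarrow> (nat \<Rightarrow> nat) \<Rightarrow> (nat \<Rightarrow> 'a) set" where
  "fixed_fns d s = {f \<in> {..<d} \<rightarrow>\<^sub>E UNIV. \<forall>i<d. f (s i) = f i}"

text \<open>The character of the permutation representation on the functions with content \<open>A\<close>.\<close>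

definition perm_char :: "nat \<Rightarrow> nat multiset \<Rightarrow> (nat \<Rightarrow> nat) \<Rightarrow> nat" where
  "perm_char d A s = card {f \<in> fixed_fns d s. fn_content d f = A}"

text \<open>The character of the permutation representation on all colourings of the
  \<open>d\<close> points with \<open>n\<close> colours, that is, of the \<open>d\<close>-th tensor
  power of an \<open>n\<close>-dimensional space.\<close>

definition colour_char :: "nat \<Rightarrow> nat \<Rightarrow> (nat \<Rightarrow> nat) \<Rightarrow> nat" where
  "colour_char d n s = card {f \<in> fixed_fns d s. \<forall>x\<in>#fn_content d f. x < n}"

text \<open>The content is a complete invariant of the orbits of the symmetric group acting on
  functions by rearranging the arguments; the orbit counting below rests on this.\<close>

lemma fn_content_eq_iff:
  "fn_content d f = fn_content d g \<longleftrightarrow> (\<exists>t. t permutes {..<d} \<and> (\<forall>i<d. f i = g (t i)))"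
proof
  assume "fn_content d f = fn_content d g"
  then obtain t where "t permutes {..<d}" "\<forall>x\<in>{..<d}. f x = g (t x)"
    unfolding fn_content_def by (rule image_mset_eq_implies_permutes[rotated]) auto
  then show "\<exists>t. t permutes {..<d} \<and> (\<forall>i<d. f i = g (t i))" by auto
next
  assume "\<exists>t. t permutes {..<d} \<and> (\<forall>i<d. f i = g (t i))"
  then obtain t where t: "t permutes {..<d}" "\<forall>i<d. f i = g (t i)" by blast
  have "fn_content d f = image_mset (g \<circ> t) (mset_set {..<d})"
    unfolding fn_content_def using t(2) by (intro image_mset_cong) auto
  also have "\<dots> = image_mset g (image_mset t (mset_set {..<d}))" by (simp only: multiset.map_comp)
  also have "image_mset t (mset_set {..<d}) = mset_set {..<d}"
    using t(1) by (simp add: image_mset_mset_set permutes_inj_on permutes_image)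
  finally show "fn_content d f = fn_content d g" unfolding fn_content_def .
qed

lemma fn_content_cong: "(\<And>i. i < d \<Longrightarrow> f i = g i) \<Longrightarrow> fn_content d f = fn_content d g"
  unfolding fn_content_def by (intro image_mset_cong) auto

lemma fn_content_map: "fn_content d (\<lambda>i. h (f i)) = image_mset h (fn_content d f)"
  unfolding fn_content_def by (simp add: multiset.map_comp comp_def)

lemma ex_fn_content: "size M = d \<Longrightarrow> \<exists>f \<in> {..<d} \<rightarrow>\<^sub>E UNIV. fn_content d f = M"
proof -
  assume "size M = d"
  moreover obtain xs where "mset xs = M" using ex_mset by blast
  ultimately have xs: "mset xs = M" "length xs = d" by auto
  have "fn_content d (restrict ((!) xs) {..<d}) = fn_content d ((!) xs)" by (rule fn_content_cong) simp
  also have "\<dots> = mset (map ((!) xs) [0..<length xs])"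
    unfolding fn_content_def xs(2)[symmetric] by (simp add: mset_map lessThan_atLeast0)
  also have "\<dots> = M" by (simp only: map_nth xs(1))
  finally show ?thesis by (intro bexI[of _ "restrict ((!) xs) {..<d}"]) auto
qed

lemma finite_fn_content: "finite {f \<in> {..<d} \<rightarrow>\<^sub>E UNIV. set_mset (fn_content d f) \<subseteq> S}" if "finite S"
proof -
  have "{f \<in> {..<d} \<rightarrow>\<^sub>E UNIV. set_mset (fn_content d f) \<subseteq> S} \<subseteq> {..<d} \<rightarrow>\<^sub>E S"
    unfolding fn_content_def PiE_def Pi_def by auto
  then show ?thesis using that by (meson finite_PiE finite_lessThan finite_subset)
qed

lemma finite_fixed_fns: "finite {f \<in> fixed_fns d s. fn_content d f = M}"
  by (rule finite_subset[OF _ finite_fn_content[of "set_mset M" d]]) (auto simp: fixed_fns_def)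

lemma fn_content_restrict_comp:
  "p permutes {..<d} \<Longrightarrow> fn_content d (restrict (f \<circ> p) {..<d}) = fn_content d f"
  unfolding fn_content_eq_iff by (intro exI[of _ p]) auto

lemma fn_content_restrict_map:
  "fn_content d (restrict (\<lambda>i. h (f i)) {..<d}) = image_mset h (fn_content d f)"
  unfolding fn_content_map[symmetric] by (rule fn_content_cong) simp

lemma fixed_fns_undefined: "f \<in> fixed_fns d s \<Longrightarrow> \<not> i < d \<Longrightarrow> undefined = f i"
  unfolding fixed_fns_def by (auto simp: PiE_def extensional_def)

lemma fixed_fns_restrict_map:
  assumes "s permutes {..<d}" "f \<in> fixed_fns d s"
  shows "restrict (\<lambda>i. h (f i)) {..<d} \<in> fixed_fns d s"
  using assms(2) permutes_in_image[OF assms(1)] unfolding fixed_fns_def by auto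

text \<open>Burnside's count for a single orbit, carried out without stabilizers. With a fixed
  \<open>g\<close> in the orbit, the condition that \<open>s\<close> fixes \<open>f\<close> is
  traded for the condition that \<open>s\<close> carries \<open>g\<close> to \<open>f\<close>, and
  each \<open>s\<close> carries \<open>g\<close> to exactly one function.\<close>

lemma fixed_fns_burnside:
  assumes "size M = d"
  shows "(\<Sum>s\<in>perms d. card {f \<in> fixed_fns d s. fn_content d f = M}) = fact d"
proof -
  define C where "C = {f \<in> {..<d} \<rightarrow>\<^sub>E UNIV. fn_content d f = M}"
  define P where "P = perms d"
  have finC: "finite C" unfolding C_def
    by (rule finite_subset[OF _ finite_fn_content[of "set_mset M" d]]) auto
  have finP: "finite P" unfolding P_def by (simp add: finite_permutations)
  obtain g where g: "g \<in> C" using ex_fn_content[OF assms] unfolding C_def by auto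
  have "(\<Sum>s\<in>P. card {f \<in> fixed_fns d s. fn_content d f = M}) = (\<Sum>s\<in>P. \<Sum>f | f \<in> C \<and> (\<forall>i<d. f (s i) = f i). 1)"
    by (intro sum.cong refl) (auto simp: C_def fixed_fns_def intro: arg_cong[of _ _ card])
  also have "\<dots> = (\<Sum>f\<in>C. \<Sum>s | s \<in> P \<and> (\<forall>i<d. f (s i) = f i). 1)"
    by (rule sum.swap_restrict[OF finP finC])
  \<comment> \<open>Writing \<open>f\<close> as \<open>g\<close> after \<open>t\<close>, the map
    sending \<open>s\<close> to \<open>t \<circ> s\<close> is a bijection between the two sets of
    permutations.\<close>
  also have "\<dots> = (\<Sum>f\<in>C. \<Sum>s | s \<in> P \<and> (\<forall>i<d. g (s i) = f i). 1)"
  proof (rule sum.cong[OF refl])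
    fix f assume f: "f \<in> C"
    then have "fn_content d f = fn_content d g" using g unfolding C_def by simp
    then obtain t where t: "t permutes {..<d}" "\<forall>i<d. f i = g (t i)" unfolding fn_content_eq_iff by blast
    have lt: "s i < d" if "s permutes {..<d}" "i < d" for s i using permutes_in_image[OF that(1)] that(2) by simp
    have "(\<Sum>s | s \<in> P \<and> (\<forall>i<d. f (s i) = f i). 1) = (\<Sum>s | s \<in> P \<and> (\<forall>i<d. g (s i) = f i). 1)"
    proof (rule sum.reindex_bij_witness[where i = "\<lambda>s. pinv t \<circ> s" and j = "\<lambda>s. t \<circ> s"])
      fix s assume "s \<in> {s. s \<in> P \<and> (\<forall>i<d. f (s i) = f i)}"
      then have s: "s permutes {..<d}" "\<forall>i<d. f (s i) = f i" unfolding P_def by auto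
      show "pinv t \<circ> (t \<circ> s) = s" using t(1) by (simp add: o_assoc permutes_inv_o)
      show "t \<circ> s \<in> {s. s \<in> P \<and> (\<forall>i<d. g (s i) = f i)}"
        using s t lt unfolding P_def by (auto intro: permutes_compose)
    next
      fix s assume "s \<in> {s. s \<in> P \<and> (\<forall>i<d. g (s i) = f i)}"
      then have s: "s permutes {..<d}" "\<forall>i<d. g (s i) = f i" unfolding P_def by auto
      have i: "pinv t permutes {..<d}" using t(1) by (rule permutes_inv)
      show "t \<circ> (pinv t \<circ> s) = s" using t(1) by (simp add: o_assoc permutes_inv_o)
      have "f (pinv t (s j)) = f j" if "j < d" for j
        using t(2) lt[OF i lt[OF s(1) that]] s(2) that t(1) by (simp add: permutes_inverses)
      then show "pinv t \<circ> s \<in> {s. s \<in> P \<and> (\<forall>i<d. f (s i) = f i)}"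
        using permutes_compose[OF s(1) i] unfolding P_def by auto
    qed simp
    then show "(\<Sum>s | s \<in> P \<and> (\<forall>i<d. f (s i) = f i). 1) = (\<Sum>s | s \<in> P \<and> (\<forall>i<d. g (s i) = f i). 1)" .
  qed
  also have "\<dots> = (\<Sum>s\<in>P. \<Sum>f | f \<in> C \<and> (\<forall>i<d. g (s i) = f i). 1)"
    by (rule sum.swap_restrict[OF finC finP])
  also have "\<dots> = (\<Sum>s\<in>P. 1)"
  proof (rule sum.cong[OF refl])
    fix s assume "s \<in> P"
    then have s: "s permutes {..<d}" unfolding P_def by simp
    define r where "r = restrict (g \<circ> s) {..<d}"
    have "r \<in> C" using g fn_content_restrict_comp[OF s, of g] unfolding C_def r_def by simp
    moreover have "\<forall>i<d. g (s i) = r i" unfolding r_def by simp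
    moreover have "f = r" if f: "f \<in> C" "\<forall>i<d. g (s i) = f i" for f
    proof
      fix i show "f i = r i"
        using f unfolding C_def r_def by (cases "i < d") (simp_all add: PiE_def extensional_def)
    qed
    ultimately have "{f \<in> C. \<forall>i<d. g (s i) = f i} = {r}" by blast
    then show "(\<Sum>f | f \<in> C \<and> (\<forall>i<d. g (s i) = f i). 1) = (1 :: nat)" by simp
  qed
  also have "\<dots> = fact d" unfolding P_def by (simp add: card_permutations)
  finally show ?thesis unfolding P_def .
qed

text \<open>Being fixed is tested coordinate by coordinate, and the two margins and the colour bound
  constrain one coordinate each; hence the product.\<close>

lemma fixed_fns_triple:
  assumes s: "s permutes {..<d}"
  shows "card {f \<in> fixed_fns d s. fn_content d f \<in> coloured_contingency n A B}
     = perm_char d A s * perm_char d B s * colour_char d n s"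
proof -
  define FA where "FA = {f \<in> fixed_fns d s. fn_content d f = A}"
  define FB where "FB = {f \<in> fixed_fns d s. fn_content d f = B}"
  define FC where "FC = {f \<in> fixed_fns d s. \<forall>x\<in>#fn_content d f. x < n}"
  define F where "F = {f \<in> fixed_fns d s. fn_content d f \<in> coloured_contingency n A B}"
  define to where "to f = (restrict (\<lambda>i. fst (f i)) {..<d}, restrict (\<lambda>i. fst (snd (f i))) {..<d}, restrict (\<lambda>i. snd (snd (f i))) {..<d})"
    for f :: "nat \<Rightarrow> nat \<times> nat \<times> nat"
  define fro where "fro = (\<lambda>(f :: nat \<Rightarrow> nat, g :: nat \<Rightarrow> nat, h :: nat \<Rightarrow> nat). restrict (\<lambda>i. (f i, g i, h i)) {..<d})"
  have lt: "s i < d" if "i < d" for i using permutes_in_image[OF s] that by simp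
  have "bij_betw to F (FA \<times> FB \<times> FC)"
  proof (rule bij_betw_byWitness[where f'=fro])
    show "\<forall>f\<in>F. fro (to f) = f"
      unfolding F_def to_def fro_def by (auto simp: fun_eq_iff intro: fixed_fns_undefined)
    show "\<forall>x\<in>FA \<times> FB \<times> FC. to (fro x) = x"
      unfolding FA_def FB_def FC_def to_def fro_def by (auto simp: fun_eq_iff intro: fixed_fns_undefined)
    show "to ` F \<subseteq> FA \<times> FB \<times> FC"
    proof (rule image_subsetI)
      fix f assume f: "f \<in> F"
      then have fs: "f \<in> fixed_fns d s" unfolding F_def by simp
      show "to f \<in> FA \<times> FB \<times> FC"
        using f fixed_fns_restrict_map[OF s fs, of fst] fixed_fns_restrict_map[OF s fs, of "\<lambda>p. fst (snd p)"]
          fixed_fns_restrict_map[OF s fs, of "\<lambda>p. snd (snd p)"]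
        unfolding F_def FA_def FB_def FC_def to_def coloured_contingency_def
        by (simp add: fn_content_restrict_map[of d fst f] fn_content_restrict_map[of d "\<lambda>p. fst (snd p)" f]
            fn_content_restrict_map[of d "\<lambda>p. snd (snd p)" f])
    qed
    show "fro ` (FA \<times> FB \<times> FC) \<subseteq> F"
    proof clarify
      fix f g h assume fgh: "f \<in> FA" "g \<in> FB" "h \<in> FC"
      have fxd: "fro (f, g, h) \<in> fixed_fns d s"
        using fgh lt unfolding FA_def FB_def FC_def fixed_fns_def fro_def by auto
      have "image_mset fst (fn_content d (fro (f, g, h))) = fn_content d f"
        "image_mset (\<lambda>p. fst (snd p)) (fn_content d (fro (f, g, h))) = fn_content d g"
        "image_mset (\<lambda>p. snd (snd p)) (fn_content d (fro (f, g, h))) = fn_content d h"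
        unfolding fn_content_map[symmetric] by (rule fn_content_cong, simp add: fro_def)+
      moreover have "\<forall>p\<in>#fn_content d (fro (f, g, h)). snd (snd p) < n"
        using fgh calculation(3) unfolding FC_def by (metis (mono_tags, lifting) image_eqI mem_Collect_eq set_image_mset)
      ultimately show "fro (f, g, h) \<in> F"
        using fgh fxd unfolding F_def FA_def FB_def coloured_contingency_def by auto
    qed
  qed
  then have "card F = card (FA \<times> FB \<times> FC)" by (rule bij_betw_same_card)
  then show ?thesis
    unfolding F_def FA_def FB_def FC_def perm_char_def colour_char_def by (simp add: card_cartesian_product)
qed

text \<open>Every coloured matrix is the content of one orbit of functions into triples, and each
  orbit contributes \<open>d!\<close> pairs of a permutation and a function fixed by it.\<close>

lemma perm_char_sum:
  assumes A: "size A = d" and B: "size B = d"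
  shows "(\<Sum>s\<in>perms d. perm_char d A s * perm_char d B s * colour_char d n s)
    = fact d * card (coloured_contingency n A B)"
proof -
  have size: "size M = d" if "M \<in> coloured_contingency n A B" for M
    using that A unfolding coloured_contingency_def by auto
  have "(\<Sum>s\<in>perms d. perm_char d A s * perm_char d B s * colour_char d n s)
    = (\<Sum>s\<in>perms d. \<Sum>M\<in>coloured_contingency n A B. card {f \<in> fixed_fns d s. fn_content d f = M})"
  proof (rule sum.cong[OF refl])
    fix s assume "s \<in> perms d"
    then have s: "s permutes {..<d}" by simp
    have "{f \<in> fixed_fns d s. fn_content d f \<in> coloured_contingency n A B} =
      (\<Union>M\<in>coloured_contingency n A B. {f \<in> fixed_fns d s. fn_content d f = M})" by auto
    also have "card \<dots> = (\<Sum>M\<in>coloured_contingency n A B. card {f \<in> fixed_fns d s. fn_content d f = M})"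
      by (intro card_UN_disjoint) (auto simp: finite_coloured_contingency finite_fixed_fns)
    finally show "perm_char d A s * perm_char d B s * colour_char d n s = \<dots>"
      unfolding fixed_fns_triple[OF s] .
  qed
  also have "\<dots> = (\<Sum>M\<in>coloured_contingency n A B. \<Sum>s\<in>perms d. card {f \<in> fixed_fns d s. fn_content d f = M})"
    by (rule sum.swap)
  also have "\<dots> = (\<Sum>M\<in>coloured_contingency n A B. fact d)"
    by (intro sum.cong refl fixed_fns_burnside size)
  finally show ?thesis by simp
qed

text \<open>Relabelling the points by \<open>h\<close> leaves the content unchanged; the predicate
  \<open>Q\<close> lets the same bijection serve \<open>perm_char\<close> and
  \<open>colour_char\<close>.\<close>

lemma fixed_fns_conj:
  assumes s: "s permutes {..<d}" and h: "h permutes {..<d}"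
  shows "card {f \<in> fixed_fns d (h \<circ> s \<circ> pinv h). Q (fn_content d f)} = card {f \<in> fixed_fns d s. Q (fn_content d f)}"
proof -
  let ?h' = "pinv h"
  have h': "?h' permutes {..<d}" using h by (rule permutes_inv)
  have lt: "p i < d \<longleftrightarrow> i < d" if "p permutes {..<d}" for p i using permutes_in_image[OF that] by simp
  have hh: "h (?h' i) = i" "?h' (h i) = i" for i using permutes_inverses[OF h] by auto
  have "bij_betw (\<lambda>f. restrict (f \<circ> h) {..<d}) {f \<in> fixed_fns d (h \<circ> s \<circ> ?h'). Q (fn_content d f)} {f \<in> fixed_fns d s. Q (fn_content d f)}"
  proof (rule bij_betw_byWitness[where f' = "\<lambda>f. restrict (f \<circ> ?h') {..<d}"])
    show "\<forall>f\<in>{f \<in> fixed_fns d (h \<circ> s \<circ> ?h'). Q (fn_content d f)}. restrict (restrict (f \<circ> h) {..<d} \<circ> ?h') {..<d} = f"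
      using hh lt[OF h'] by (auto simp: fun_eq_iff intro: fixed_fns_undefined)
    show "\<forall>f\<in>{f \<in> fixed_fns d s. Q (fn_content d f)}. restrict (restrict (f \<circ> ?h') {..<d} \<circ> h) {..<d} = f"
      using hh lt[OF h] by (auto simp: fun_eq_iff intro: fixed_fns_undefined)
    show "(\<lambda>f. restrict (f \<circ> h) {..<d}) ` {f \<in> fixed_fns d (h \<circ> s \<circ> ?h'). Q (fn_content d f)} \<subseteq> {f \<in> fixed_fns d s. Q (fn_content d f)}"
    proof (rule image_subsetI)
      fix f assume f: "f \<in> {f \<in> fixed_fns d (h \<circ> s \<circ> ?h'). Q (fn_content d f)}"
      have "f (h (s i)) = f (h i)" if "i < d" for i
      proof -
        have "f ((h \<circ> s \<circ> ?h') (h i)) = f (h i)" using f that lt[OF h] unfolding fixed_fns_def by blast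
        then show ?thesis by (simp add: hh)
      qed
      then show "restrict (f \<circ> h) {..<d} \<in> {f \<in> fixed_fns d s. Q (fn_content d f)}"
        using f fn_content_restrict_comp[OF h, of f] lt[OF s] unfolding fixed_fns_def by simp
    qed
    show "(\<lambda>f. restrict (f \<circ> ?h') {..<d}) ` {f \<in> fixed_fns d s. Q (fn_content d f)} \<subseteq> {f \<in> fixed_fns d (h \<circ> s \<circ> ?h'). Q (fn_content d f)}"
    proof (rule image_subsetI)
      fix f assume f: "f \<in> {f \<in> fixed_fns d s. Q (fn_content d f)}"
      have "f (s (?h' i)) = f (?h' i)" if "i < d" for i
        using f that lt[OF h'] unfolding fixed_fns_def by blast
      then show "restrict (f \<circ> ?h') {..<d} \<in> {f \<in> fixed_fns d (h \<circ> s \<circ> ?h'). Q (fn_content d f)}"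
        using f fn_content_restrict_comp[OF h', of f] lt[OF s] lt[OF h] lt[OF h'] unfolding fixed_fns_def by (simp add: hh)
    qed
  qed
  then show ?thesis by (rule bij_betw_same_card)
qed

lemma perm_char_conj:
  "s permutes {..<d} \<Longrightarrow> h permutes {..<d} \<Longrightarrow> perm_char d A (h \<circ> s \<circ> pinv h) = perm_char d A s"
  unfolding perm_char_def by (rule fixed_fns_conj)

lemma colour_char_conj:
  "s permutes {..<d} \<Longrightarrow> h permutes {..<d} \<Longrightarrow> colour_char d n (h \<circ> s \<circ> pinv h) = colour_char d n s"
  unfolding colour_char_def by (rule fixed_fns_conj)

lemma fixed_fns_inv:
  assumes s: "s permutes {..<d}" shows "fixed_fns d (pinv s) = fixed_fns d s"
proof -
  have sub: "fixed_fns d s \<subseteq> fixed_fns d (pinv s)" if s: "s permutes {..<d}" for s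
  proof
    fix f assume f: "f \<in> fixed_fns d s"
    have "f (pinv s i) = f i" if "i < d" for i
    proof -
      have "pinv s i < d" using permutes_in_image[OF permutes_inv[OF s]] that by simp
      then have "f (s (pinv s i)) = f (pinv s i)" using f unfolding fixed_fns_def by blast
      then show ?thesis by (simp add: permutes_inverses[OF s])
    qed
    then show "f \<in> fixed_fns d (pinv s)" using f unfolding fixed_fns_def by auto
  qed
  show ?thesis
    using sub[OF permutes_inv[OF s]] sub[OF s] unfolding permutes_inv_inv[OF s] by (rule subset_antisym)
qed

lemma perm_char_inv: "s permutes {..<d} \<Longrightarrow> perm_char d A (pinv s) = perm_char d A s"
  unfolding perm_char_def by (simp add: fixed_fns_inv)

text \<open>A colouring is fixed exactly when it is constant on the orbits of \<open>s\<close>, so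
  it amounts to a free choice of a colour per orbit. The exponent is the number of orbits on
  \<open>{..<d}\<close>, with fixed points as orbits of their own.\<close>

lemma colour_char_power:
  assumes s: "s permutes {..<d}" shows "\<exists>k. colour_char d n s = n ^ k"
proof -
  have perm: "permutation s" using s permutation_permutes by blast
  have lt: "s i < d" if "i < d" for i using permutes_in_image[OF s] that by simp
  define Q where "Q = orbit s ` {..<d}"
  define F where "F = {f \<in> fixed_fns d s. \<forall>x\<in>#fn_content d f. x < n}"
  have F: "f \<in> F \<longleftrightarrow> f \<in> {..<d} \<rightarrow>\<^sub>E {..<n} \<and> (\<forall>i<d. f (s i) = f i)" for f
    unfolding F_def fixed_fns_def fn_content_def by (auto simp: PiE_def Pi_def)
  have const: "f j = f i" if f: "f \<in> F" and i: "i < d" and j: "j \<in> orbit s i" for f i j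
  proof -
    have "j < d \<and> f j = f i" using j
    proof (induction rule: orbit.induct)
      case base then show ?case using f i lt by (simp add: F)
    next
      case (step y) then show ?case using f lt by (simp add: F)
    qed
    then show ?thesis by simp
  qed
  have "bij_betw (\<lambda>g. restrict (\<lambda>i. g (orbit s i)) {..<d}) (Q \<rightarrow>\<^sub>E {..<n}) F"
  proof (rule bij_betw_byWitness[where f' = "\<lambda>f. restrict (\<lambda>O'. f (SOME i. i \<in> O')) Q"])
    have some: "(SOME j. j \<in> orbit s i) \<in> orbit s i" for i
      by (rule someI) (rule permutation_self_in_orbit[OF perm])
    have orb: "orbit s j = orbit s i" if "j \<in> orbit s i" for i j
      using that
    proof (induction rule: orbit.induct)
      case base show ?case by (rule permutation_orbit_step[OF perm])
    next
      case (step y) then show ?case using permutation_orbit_step[OF perm, of y] by simp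
    qed
    have some_lt: "(SOME j. j \<in> orbit s i) < d" if "i < d" for i
      using some[of i] permutes_orbit_subset[OF s, of i] that by auto
    show "\<forall>g\<in>Q \<rightarrow>\<^sub>E {..<n}. restrict (\<lambda>O'. restrict (\<lambda>i. g (orbit s i)) {..<d} (SOME i. i \<in> O')) Q = g"
    proof
      fix g assume g: "g \<in> Q \<rightarrow>\<^sub>E {..<n}"
      show "restrict (\<lambda>O'. restrict (\<lambda>i. g (orbit s i)) {..<d} (SOME i. i \<in> O')) Q = g"
      proof
        fix O' show "restrict (\<lambda>O'. restrict (\<lambda>i. g (orbit s i)) {..<d} (SOME i. i \<in> O')) Q O' = g O'"
        proof (cases "O' \<in> Q")
          case True
          then obtain i where i: "i < d" "O' = orbit s i" unfolding Q_def by auto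
          show ?thesis using True i some_lt[OF i(1)] orb[OF some[of i]] by simp
        next
          case False then show ?thesis using g by (auto simp: PiE_def extensional_def)
        qed
      qed
    qed
    show "\<forall>f\<in>F. restrict (\<lambda>i. restrict (\<lambda>O'. f (SOME i. i \<in> O')) Q (orbit s i)) {..<d} = f"
    proof
      fix f assume f: "f \<in> F"
      show "restrict (\<lambda>i. restrict (\<lambda>O'. f (SOME i. i \<in> O')) Q (orbit s i)) {..<d} = f"
      proof
        fix i show "restrict (\<lambda>i. restrict (\<lambda>O'. f (SOME i. i \<in> O')) Q (orbit s i)) {..<d} i = f i"
        proof (cases "i < d")
          case True
          then show ?thesis using const[OF f True some] by (simp add: Q_def)
        next
          case False then show ?thesis using f by (auto simp: F PiE_def extensional_def)
        qed
      qed
    qed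
    show "(\<lambda>g. restrict (\<lambda>i. g (orbit s i)) {..<d}) ` (Q \<rightarrow>\<^sub>E {..<n}) \<subseteq> F"
      using lt permutation_orbit_step[OF perm] unfolding image_subset_iff F Q_def
      by (auto simp: PiE_def Pi_def)
    show "(\<lambda>f. restrict (\<lambda>O'. f (SOME i. i \<in> O')) Q) ` F \<subseteq> Q \<rightarrow>\<^sub>E {..<n}"
    proof (rule image_subsetI)
      fix f assume f: "f \<in> F"
      have "f (SOME j. j \<in> orbit s i) < n" if "i < d" for i
        using const[OF f that some] f that by (auto simp: F PiE_def Pi_def)
      then show "restrict (\<lambda>O'. f (SOME i. i \<in> O')) Q \<in> Q \<rightarrow>\<^sub>E {..<n}" unfolding Q_def by auto
    qed
  qed
  then have "card F = card (Q \<rightarrow>\<^sub>E {..<n})" by (metis bij_betw_same_card)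
  also have "\<dots> = n ^ card Q" by (simp add: card_PiE Q_def)
  finally show ?thesis unfolding colour_char_def F_def by blast
qed

section \<open>Young tableaux\<close>

lemma std_entry_Cons: "std_entry (x # l) 0 j = j" "std_entry (x # l) (Suc i) j = x + std_entry l i j"
  by (simp_all add: std_entry_def)

lemma cells_Cons: "(0, j) \<in> cells (x # l) \<longleftrightarrow> j < x" "(Suc i, j) \<in> cells (x # l) \<longleftrightarrow> (i, j) \<in> cells l"
  by (simp_all add: cells_def)

lemma std_entry_less: "(i, j) \<in> cells l \<Longrightarrow> std_entry l i j < sum_list l"
proof (induction l arbitrary: i)
  case (Cons x l)
  then show ?case by (cases i) (auto simp: std_entry_Cons cells_Cons)
qed (simp add: cells_def)

lemma std_entry_inj:
  "(i, j) \<in> cells l \<Longrightarrow> (i', j') \<in> cells l \<Longrightarrow> std_entry l i j = std_entry l i' j' \<Longrightarrow> i = i' \<and> j = j'"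
proof (induction l arbitrary: i i')
  case (Cons x l)
  then show ?case by (cases i; cases i') (auto simp: std_entry_Cons cells_Cons)
qed (simp add: cells_def)

lemma std_entry_surj: "x < sum_list l \<Longrightarrow> \<exists>i j. (i, j) \<in> cells l \<and> std_entry l i j = x"
proof (induction l arbitrary: x)
  case (Cons y l)
  show ?case
  proof (cases "x < y")
    case True
    then show ?thesis by (intro exI[of _ 0] exI[of _ x]) (simp add: std_entry_Cons cells_Cons)
  next
    case False
    then have "x - y < sum_list l" using Cons.prems by auto
    then obtain i j where "(i, j) \<in> cells l" "std_entry l i j = x - y" using Cons.IH by blast
    then show ?thesis using False
      by (intro exI[of _ "Suc i"] exI[of _ j]) (simp add: std_entry_Cons cells_Cons)
  qed
qed simp

text \<open>With \<open>col_of\<close> it inverts \<open>std_entry\<close>. For numbers that are not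
  entries of the tableau the description has no witness and the value is unspecified, so uses are
  bounded by \<open>sum_list l\<close>.\<close>

definition row_of :: "nat list \<Rightarrow> nat \<Rightarrow> nat" where
  "row_of l x = (THE i. \<exists>j. (i, j) \<in> cells l \<and> std_entry l i j = x)"

definition col_of :: "nat list \<Rightarrow> nat \<Rightarrow> nat" where
  "col_of l x = (THE j. \<exists>i. (i, j) \<in> cells l \<and> std_entry l i j = x)"

lemma row_of_std_entry: "(i, j) \<in> cells l \<Longrightarrow> row_of l (std_entry l i j) = i"
  unfolding row_of_def by (rule the_equality) (use std_entry_inj in blast)+

lemma col_of_std_entry: "(i, j) \<in> cells l \<Longrightarrow> col_of l (std_entry l i j) = j"
  unfolding col_of_def by (rule the_equality) (use std_entry_inj in blast)+

lemma pos_of: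
  assumes "x < sum_list l"
  shows "(row_of l x, col_of l x) \<in> cells l" "std_entry l (row_of l x) (col_of l x) = x"
proof -
  obtain i j where "(i, j) \<in> cells l" "std_entry l i j = x" using std_entry_surj[OF assms] by blast
  then show "(row_of l x, col_of l x) \<in> cells l" "std_entry l (row_of l x) (col_of l x) = x"
    using row_of_std_entry col_of_std_entry by auto
qed

text \<open>Turns the stabilization of whole rows or columns into a pointwise condition. A
  permutation that maps a finite block into itself maps it onto itself.\<close>

lemma permutes_image_blocks_iff:
  fixes d :: nat
  assumes p: "p permutes {..<d}"
  shows "(\<forall>i. p ` {x. x < d \<and> f x = i} = {x. x < d \<and> f x = i}) \<longleftrightarrow> (\<forall>x<d. f (p x) = f x)"
proof
  assume L: "\<forall>i. p ` {x. x < d \<and> f x = i} = {x. x < d \<and> f x = i}"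
  show "\<forall>x<d. f (p x) = f x"
  proof (intro allI impI)
    fix x assume "x < d"
    then have "p x \<in> {y. y < d \<and> f y = f x}" using spec[OF L, of "f x"] by blast
    then show "f (p x) = f x" by simp
  qed
next
  assume R: "\<forall>x<d. f (p x) = f x"
  show "\<forall>i. p ` {x. x < d \<and> f x = i} = {x. x < d \<and> f x = i}"
  proof
    fix i
    have "p x < d" if "x < d" for x using permutes_in_image[OF p] that by simp
    then have "p ` {x. x < d \<and> f x = i} \<subseteq> {x. x < d \<and> f x = i}" using R by auto
    then show "p ` {x. x < d \<and> f x = i} = {x. x < d \<and> f x = i}"
    proof (rule endo_inj_surj[rotated])
      show "finite {x. x < d \<and> f x = i}" by (rule finite_subset[of _ "{..<d}"]) auto
    qed (rule permutes_inj_on[OF p])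
  qed
qed

lemma row_block: "{std_entry l i j | j. (i, j) \<in> cells l} = {x. x < sum_list l \<and> row_of l x = i}"
proof (intro equalityI subsetI)
  fix x assume "x \<in> {x. x < sum_list l \<and> row_of l x = i}"
  then have "x = std_entry l i (col_of l x) \<and> (i, col_of l x) \<in> cells l" using pos_of[of x l] by auto
  then show "x \<in> {std_entry l i j | j. (i, j) \<in> cells l}" by blast
qed (auto simp: std_entry_less row_of_std_entry)

lemma col_block: "{std_entry l i j | i. (i, j) \<in> cells l} = {x. x < sum_list l \<and> col_of l x = j}"
proof (intro equalityI subsetI)
  fix x assume "x \<in> {x. x < sum_list l \<and> col_of l x = j}"
  then have "x = std_entry l (row_of l x) j \<and> (row_of l x, j) \<in> cells l" using pos_of[of x l] by auto
  then show "x \<in> {std_entry l i j | i. (i, j) \<in> cells l}" by blast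
qed (auto simp: std_entry_less col_of_std_entry)

lemma row_group_iff:
  "p \<in> row_group l \<longleftrightarrow> p permutes {..<sum_list l} \<and> (\<forall>x<sum_list l. row_of l (p x) = row_of l x)"
  unfolding row_group_def row_block mem_Collect_eq by (rule conj_cong[OF refl permutes_image_blocks_iff])

lemma col_group_iff:
  "p \<in> col_group l \<longleftrightarrow> p permutes {..<sum_list l} \<and> (\<forall>x<sum_list l. col_of l (p x) = col_of l x)"
  unfolding col_group_def col_block mem_Collect_eq by (rule conj_cong[OF refl permutes_image_blocks_iff])

section \<open>Column lengths and counting cells by columns\<close>

lemma card_columns:
  fixes S :: "(nat \<times> nat) set"
  assumes "finite S" "\<And>i j. (i, j) \<in> S \<Longrightarrow> j < J"
  shows "card S = (\<Sum>j<J. card {i. (i, j) \<in> S})"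
proof (rule card_bij_Sigma)
  show "bij_betw prod.swap S (SIGMA j:{..<J}. {i. (i, j) \<in> S})"
    by (rule bij_betw_byWitness[where f' = prod.swap]) (use assms(2) in auto)
  show "finite {i. (i, j) \<in> S}" for j
    by (rule finite_subset[of _ "fst ` S"]) (use assms(1) in \<open>force+\<close>)
qed simp

text \<open>The parts of the conjugate partition.\<close>

definition col_len :: "nat list \<Rightarrow> nat \<Rightarrow> nat" where
  "col_len l j = card {i. j < row_len l i}"

lemma col_len_iff: assumes "is_partition l" shows "i < col_len l j \<longleftrightarrow> j < row_len l i"
proof -
  note f = row_len_shape[OF assms]
  have "{i. j < row_len l i} = {..<card {i. j < row_len l i}}"
  proof (rule lessThan_down_closed)
    show "{i. j < row_len l i} \<subseteq> {..<length l}" by (auto simp: row_len_def split: if_splits)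
  next
    fix x y assume "x < y" "y \<in> {i. j < row_len l i}"
    then show "x \<in> {i. j < row_len l i}" using shape_mono[OF f, of x y] by simp
  qed
  then show ?thesis unfolding col_len_def by blast
qed

lemma card_rows_below:
  assumes "is_partition l"
  shows "card {x. x < sum_list l \<and> row_of l x < k} = (\<Sum>i<k. row_len l i)"
proof -
  have cells: "(i, j) \<in> cells l \<longleftrightarrow> j < row_len l i" for i j
    unfolding cells_eq shape_cells_def by simp
  have "bij_betw (\<lambda>x. (row_of l x, col_of l x)) {x. x < sum_list l \<and> row_of l x < k} {(i, j). i < k \<and> j < row_len l i}"
    by (rule bij_betw_byWitness[where f' = "\<lambda>(i, j). std_entry l i j"])
       (auto simp: pos_of row_of_std_entry col_of_std_entry std_entry_less cells[symmetric])
  from bij_betw_same_card[OF this] show ?thesis by (simp only: card_cells_first_rows)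
qed

lemma card_column:
  assumes "is_partition l"
  shows "card {x. x < sum_list l \<and> col_of l x = j} = col_len l j"
proof -
  have cells: "(i, j) \<in> cells l \<longleftrightarrow> j < row_len l i" for i j
    unfolding cells_eq shape_cells_def by simp
  have "bij_betw (\<lambda>x. row_of l x) {x. x < sum_list l \<and> col_of l x = j} {i. j < row_len l i}"
    by (rule bij_betw_byWitness[where f' = "\<lambda>i. std_entry l i j"])
       (auto simp: pos_of row_of_std_entry col_of_std_entry std_entry_less cells[symmetric])
  then show ?thesis unfolding col_len_def by (rule bij_betw_same_card)
qed

text \<open>If no two entries share both a row of the standard tableau of shape \<open>l\<close> and a column of the
  image under \<open>w\<close> of the one of shape \<open>m\<close>, then the pairs (row, column) form a set with at most
  \<open>min k (col_len m j)\<close> members of column \<open>j\<close> in the first \<open>k\<close> rows, whence \<open>m\<close> dominates \<open>l\<close>; for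
  \<open>l = m\<close> all these bounds are attained and the set is the diagram itself.\<close>

lemma young_dichotomy:
  assumes l: "l \<in> partitions d" and m: "m \<in> partitions d" and w: "w permutes {..<d}"
    and inj: "inj_on (\<lambda>x. (row_of l x, col_of m (pinv w x))) {..<d}"
  shows "l \<le> m" and "l = m \<Longrightarrow> \<exists>p\<in>row_group l. \<exists>q\<in>col_group l. w = p \<circ> q"
proof -
  let ?w' = "pinv w"
  have pl: "is_partition l" "sum_list l = d" and pm: "is_partition m" "sum_list m = d"
    using l m unfolding partitions_def by auto
  have w': "?w' permutes {..<d}" using w by (rule permutes_inv)
  have ww: "w (?w' x) = x" "?w' (w x) = x" for x using permutes_inverses[OF w] by auto
  have lt: "p x < d \<longleftrightarrow> x < d" if "p permutes {..<d}" for p x using permutes_in_image[OF that] by simp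
  define \<phi> where "\<phi> x = (row_of l x, col_of m (?w' x))" for x
  define S where "S = \<phi> ` {..<d}"
  have inj\<phi>: "inj_on \<phi> {..<d}" using inj unfolding \<phi>_def .
  have finS: "finite S" unfolding S_def by simp
  have colS: "j < d" if ij: "(i, j) \<in> S" for i j
  proof -
    obtain x where "x < d" "j = col_of m (?w' x)" using ij unfolding S_def \<phi>_def by auto
    then have "(row_of m (?w' x), j) \<in> cells m" using pos_of(1)[of "?w' x" m] pm lt[OF w'] by simp
    then show ?thesis unfolding cells_def using pm(2) by (auto dest: elem_le_sum_list)
  qed
  have rowsS: "card {c \<in> S. fst c < k} = (\<Sum>i<k. row_len l i)" for k
  proof -
    have "{c \<in> S. fst c < k} = \<phi> ` {x. x < sum_list l \<and> row_of l x < k}"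
      unfolding S_def \<phi>_def using pl by auto
    moreover have "inj_on \<phi> {x. x < sum_list l \<and> row_of l x < k}"
      using inj\<phi> by (rule inj_on_subset) (use pl in auto)
    ultimately show ?thesis using card_rows_below[OF pl(1)] by (simp add: card_image)
  qed
  have colS_card: "card {i. (i, j) \<in> S} = col_len m j" and finc: "finite {i. (i, j) \<in> S}" for j
  proof -
    show "finite {i. (i, j) \<in> S}" by (rule finite_subset[of _ "fst ` S"]) (use finS in \<open>force+\<close>)
    have "{i. (i, j) \<in> S} = (\<lambda>y. row_of l (w y)) ` {y. y < sum_list m \<and> col_of m y = j}"
    proof (intro equalityI subsetI)
      fix i assume "i \<in> {i. (i, j) \<in> S}"
      then obtain x where "x < d" "i = row_of l x" "j = col_of m (?w' x)" unfolding S_def \<phi>_def by auto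
      then show "i \<in> (\<lambda>y. row_of l (w y)) ` {y. y < sum_list m \<and> col_of m y = j}"
        using lt[OF w'] pm(2) by (intro image_eqI[of _ _ "?w' x"]) (auto simp: ww)
    next
      fix i assume "i \<in> (\<lambda>y. row_of l (w y)) ` {y. y < sum_list m \<and> col_of m y = j}"
      then obtain y where "y < d" "i = row_of l (w y)" "j = col_of m y" using pm(2) by auto
      then have "(i, j) = \<phi> (w y)" "w y \<in> {..<d}" by (simp_all add: \<phi>_def ww lt[OF w])
      then show "i \<in> {i. (i, j) \<in> S}" unfolding S_def by blast
    qed
    moreover have "inj_on (\<lambda>y. row_of l (w y)) {y. y < sum_list m \<and> col_of m y = j}"
    proof (rule inj_onI)
      fix y y' assume y: "y \<in> {y. y < sum_list m \<and> col_of m y = j}" "y' \<in> {y. y < sum_list m \<and> col_of m y = j}"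
        and e: "row_of l (w y) = row_of l (w y')"
      have "\<phi> (w y) = \<phi> (w y')" unfolding \<phi>_def using y e by (simp add: ww)
      then have "w y = w y'" using inj\<phi> y pm(2) lt[OF w] by (auto dest: inj_onD)
      then have "?w' (w y) = ?w' (w y')" by simp
      then show "y = y'" by (simp only: ww)
    qed
    ultimately show "card {i. (i, j) \<in> S} = col_len m j"
      using card_column[OF pm(1)] by (simp add: card_image)
  qed
  define a where "a k j = card {i. i < k \<and> (i, j) \<in> S}" for k j
  have a_le: "a k j \<le> min k (col_len m j)" for k j
  proof -
    have "a k j \<le> card {..<k}" unfolding a_def by (intro card_mono) auto
    moreover have "a k j \<le> card {i. (i, j) \<in> S}" unfolding a_def by (intro card_mono finc) auto
    ultimately show ?thesis by (simp add: colS_card)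
  qed
  have sum_a: "(\<Sum>i<k. row_len l i) = (\<Sum>j<d. a k j)" for k
  proof -
    have "card {c \<in> S. fst c < k} = (\<Sum>j<d. card {i. (i, j) \<in> {c \<in> S. fst c < k}})"
      by (rule card_columns) (use finS colS in auto)
    then show ?thesis unfolding rowsS a_def by (simp add: conj_commute)
  qed
  have sum_m: "(\<Sum>i<k. row_len m i) = (\<Sum>j<d. min k (col_len m j))" for k
  proof -
    have "card {(i, j). i < k \<and> j < row_len m i} = (\<Sum>j<d. card {i. (i, j) \<in> {(i, j). i < k \<and> j < row_len m i}})"
    proof (rule card_columns)
      show "finite {(i, j). i < k \<and> j < row_len m i}"
        by (rule finite_subset[OF _ finite_shape_cells[OF row_len_shape[OF pm(1)]]]) (auto simp: shape_cells_def)
      show "j < d" if "(i, j) \<in> {(i, j). i < k \<and> j < row_len m i}" for i j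
        using that pm(2) elem_le_sum_list[of i m] by (auto simp: row_len_def split: if_splits)
    qed
    also have "\<dots> = (\<Sum>j<d. min k (col_len m j))"
    proof (rule sum.cong[OF refl])
      fix j
      have "{i. (i, j) \<in> {(i, j). i < k \<and> j < row_len m i}} = {..<min k (col_len m j)}"
        using col_len_iff[OF pm(1)] by auto
      then show "card {i. (i, j) \<in> {(i, j). i < k \<and> j < row_len m i}} = min k (col_len m j)" by simp
    qed
    finally show ?thesis by (simp only: card_cells_first_rows)
  qed
  have "(\<Sum>i<k. row_len l i) \<le> (\<Sum>i<k. row_len m i)" for k
    unfolding sum_a sum_m by (intro sum_mono a_le)
  then show "l \<le> m" using pl(1) unfolding is_partition_def by (intro dominance_imp_lex) auto
  assume lm: "l = m"
  have full: "(i, j) \<in> S \<longleftrightarrow> j < row_len m i" for i j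
  proof (cases "j < d")
    case True
    let ?k = "col_len m j"
    \<comment> \<open>Here \<open>k\<close> is the length of column \<open>j\<close>, so that the
      bound for this column equals its full length. As the bounds add up to the sum that is
      attained, each of them is attained.\<close>
    have "(\<Sum>j<d. a ?k j) = (\<Sum>j<d. min ?k (col_len m j))" using sum_a[of ?k] sum_m[of ?k] lm by simp
    then have "a ?k j = min ?k (col_len m j)"
      by (rule sum_mono_inv) (use a_le True in auto)
    then have "{i. i < ?k \<and> (i, j) \<in> S} = {..<?k}"
      unfolding a_def by (intro card_subset_eq) auto
    then have "{..<?k} \<subseteq> {i. (i, j) \<in> S}" by auto
    then have "{..<?k} = {i. (i, j) \<in> S}" by (intro card_subset_eq finc) (simp_all add: colS_card)
    then show ?thesis using col_len_iff[OF pm(1), of i j] by auto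
  next
    case False
    moreover have "row_len m i \<le> d" using pm(2) elem_le_sum_list[of i m] by (auto simp: row_len_def)
    ultimately show ?thesis using colS by force
  qed
  have cells: "(i, j) \<in> cells l \<longleftrightarrow> (i, j) \<in> S" for i j
    unfolding full lm cells_eq shape_cells_def by simp
  \<comment> \<open>Within its row, \<open>x\<close> is moved to the column in which
    \<open>pinv w x\<close> stands; this cell exists because \<open>S\<close> is the whole diagram.
    Then \<open>p\<close> preserves rows and \<open>p \<circ> w\<close> preserves columns.\<close>
  define p where "p x = (if x < d then std_entry l (row_of l x) (col_of l (?w' x)) else x)" for x
  have p_cell: "(row_of l x, col_of l (?w' x)) \<in> cells l" if "x < d" for x
    unfolding cells S_def \<phi>_def using that lm by auto
  have p_lt: "p x < d" if "x < d" for x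
    using std_entry_less[OF p_cell[OF that]] that pl(2) by (simp add: p_def)
  have row_p: "row_of l (p x) = row_of l x" and col_p: "col_of l (p x) = col_of l (?w' x)" if "x < d" for x
    using row_of_std_entry[OF p_cell[OF that]] col_of_std_entry[OF p_cell[OF that]] that by (simp_all add: p_def)
  have "inj_on p {..<d}"
  proof (rule inj_onI)
    fix x y assume xy: "x \<in> {..<d}" "y \<in> {..<d}" "p x = p y"
    then have "\<phi> x = \<phi> y" using row_p[of x] row_p[of y] col_p[of x] col_p[of y] unfolding \<phi>_def lm[symmetric] by simp
    then show "x = y" using inj\<phi> xy by (auto dest: inj_onD)
  qed
  moreover from this have "p ` {..<d} = {..<d}" by (intro endo_inj_surj) (auto simp: p_lt)
  ultimately have "bij_betw p {..<d} {..<d}" unfolding bij_betw_def by blast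
  then have pp: "p permutes {..<d}" by (rule bij_imp_permutes) (simp add: p_def)
  define q where "q = p \<circ> w"
  have qp: "q permutes {..<d}" unfolding q_def by (rule permutes_compose[OF w pp])
  have "p \<in> row_group l" unfolding row_group_iff using pp row_p pl(2) by simp
  then have "pinv p \<in> row_group l"
    unfolding row_group_iff
  proof (intro conjI allI impI)
    show "pinv p permutes {..<sum_list l}" using permutes_inv[OF pp] pl(2) by simp
    fix x assume "x < sum_list l"
    then have "pinv p x < d" using lt[OF permutes_inv[OF pp]] pl(2) by simp
    from row_p[OF this] show "row_of l (pinv p x) = row_of l x"
      by (simp add: permutes_inverses[OF pp])
  qed
  moreover have "q \<in> col_group l"
    unfolding col_group_iff q_def using qp pl(2) col_p lt[OF w] by (simp add: q_def ww)
  moreover have "w = pinv p \<circ> q"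
    unfolding q_def by (simp add: o_assoc permutes_inv_o[OF pp])
  ultimately show "\<exists>p\<in>row_group l. \<exists>q\<in>col_group l. w = p \<circ> q" by blast
qed

section \<open>Young symmetrizers\<close>

lemma pinv_comp: "p permutes S \<Longrightarrow> q permutes S \<Longrightarrow> pinv (p \<circ> q) = pinv q \<circ> pinv p"
  by (intro o_inv_distrib permutes_bij)

lemma pinv_cancel:
  assumes "p permutes S"
  shows "pinv p \<circ> (p \<circ> x) = x" "p \<circ> (pinv p \<circ> x) = x" "pinv p \<circ> p = id" "p \<circ> pinv p = id" "pinv (pinv p) = p"
  using permutes_inverses[OF assms] permutes_inv_inv[OF assms] by (auto simp: fun_eq_iff)

lemma permutes_less_iff: "p permutes {..<d} \<Longrightarrow> p x < d \<longleftrightarrow> x < (d :: nat)"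
  using permutes_in_image[of p "{..<d}" x] by simp

lemma permutation_lessThan: "p permutes {..<d :: nat} \<Longrightarrow> permutation p"
  by (rule permutes_imp_permutation) auto

lemma row_group_permutes: "p \<in> row_group l \<Longrightarrow> p permutes {..<sum_list l}"
  and col_group_permutes: "p \<in> col_group l \<Longrightarrow> p permutes {..<sum_list l}"
  by (simp_all add: row_group_iff col_group_iff)

lemma row_group_inv: "p \<in> row_group l \<Longrightarrow> pinv p \<in> row_group l"
  unfolding row_group_iff
proof (elim conjE, intro conjI allI impI)
  fix x assume p: "p permutes {..<sum_list l}" "\<forall>x<sum_list l. row_of l (p x) = row_of l x" and x: "x < sum_list l"
  have "pinv p x < sum_list l" using permutes_less_iff[OF permutes_inv[OF p(1)]] x by simp
  then have "row_of l (p (pinv p x)) = row_of l (pinv p x)" using p(2) by blast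
  then show "row_of l (pinv p x) = row_of l x" by (simp add: permutes_inverses[OF p(1)])
qed (rule permutes_inv)

lemma col_group_inv: "p \<in> col_group l \<Longrightarrow> pinv p \<in> col_group l"
  unfolding col_group_iff
proof (elim conjE, intro conjI allI impI)
  fix x assume p: "p permutes {..<sum_list l}" "\<forall>x<sum_list l. col_of l (p x) = col_of l x" and x: "x < sum_list l"
  have "pinv p x < sum_list l" using permutes_less_iff[OF permutes_inv[OF p(1)]] x by simp
  then have "col_of l (p (pinv p x)) = col_of l (pinv p x)" using p(2) by blast
  then show "col_of l (pinv p x) = col_of l x" by (simp add: permutes_inverses[OF p(1)])
qed (rule permutes_inv)

lemma row_group_comp_left:
  assumes p: "p \<in> row_group l" and x: "x permutes {..<sum_list l}"
  shows "p \<circ> x \<in> row_group l \<longleftrightarrow> x \<in> row_group l"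
  using p x permutes_compose[OF x row_group_permutes[OF p]] permutes_less_iff[OF x] unfolding row_group_iff by simp

lemma col_group_comp:
  assumes p: "p \<in> col_group l" and q: "q \<in> col_group l" shows "p \<circ> q \<in> col_group l"
  using assms permutes_compose[OF col_group_permutes[OF q] col_group_permutes[OF p]]
    permutes_less_iff[OF col_group_permutes[OF q]] unfolding col_group_iff by simp

lemma col_group_comp_right:
  assumes q: "q \<in> col_group l" and x: "x permutes {..<sum_list l}"
  shows "x \<circ> q \<in> col_group l \<longleftrightarrow> x \<in> col_group l"
proof
  assume "x \<circ> q \<in> col_group l"
  from col_group_comp[OF this col_group_inv[OF q]] show "x \<in> col_group l"
    by (simp add: comp_assoc pinv_cancel[OF col_group_permutes[OF q]])
qed (rule col_group_comp[OF _ q])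

lemma id_in_row_group: "id \<in> row_group l" and id_in_col_group: "id \<in> col_group l"
  by (simp_all add: row_group_iff col_group_iff permutes_id)

lemma row_col_group_Int:
  assumes "p \<in> row_group l" "p \<in> col_group l" shows "p = id"
proof
  fix x
  have p: "p permutes {..<sum_list l}" using assms(1) row_group_permutes by blast
  show "p x = id x"
  proof (cases "x < sum_list l")
    case True
    then have "row_of l (p x) = row_of l x" "col_of l (p x) = col_of l x"
      using assms unfolding row_group_iff col_group_iff by auto
    then show ?thesis using pos_of(2)[of x l] pos_of(2)[of "p x" l] True permutes_less_iff[OF p] by simp
  next
    case False then show ?thesis using permutes_not_in[OF p] by simp
  qed
qed

section \<open>Translation behaviour of the Young symmetrizer\<close>

lemma young_symmetrizer_alt:
  "young_symmetrizer l w = (\<Sum>q\<in>perms (sum_list l).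
     if q \<in> row_group l \<and> pinv q \<circ> w \<in> col_group l then of_int (sign (pinv q \<circ> w)) else 0)"
  unfolding young_symmetrizer_def group_alg_mult_def by (intro sum.cong) auto

lemma young_symmetrizer_left:
  assumes p: "p \<in> row_group l"
  shows "young_symmetrizer l (p \<circ> w) = young_symmetrizer l w"
proof -
  note pp = row_group_permutes[OF p]
  show ?thesis
    unfolding young_symmetrizer_alt
    by (subst setum_permutations_compose_left[OF pp])
       (auto intro!: sum.cong simp: row_group_comp_left[OF p] pinv_comp[OF pp] comp_assoc pinv_cancel[OF pp])
qed

lemma young_symmetrizer_right:
  assumes q: "q \<in> col_group l" and w: "w permutes {..<sum_list l}"
  shows "young_symmetrizer l (w \<circ> q) = of_int (sign q) * young_symmetrizer l w"
proof -
  note qp = col_group_permutes[OF q]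
  have sgn: "sign ((pinv x \<circ> w) \<circ> q) = sign q * sign (pinv x \<circ> w)" and
    mem: "(pinv x \<circ> w) \<circ> q \<in> col_group l \<longleftrightarrow> pinv x \<circ> w \<in> col_group l" if "x permutes {..<sum_list l}" for x
    using permutes_compose[OF w permutes_inv[OF that]] qp col_group_comp_right[OF q]
    by (auto simp: sign_compose permutation_lessThan)
  show ?thesis
    unfolding young_symmetrizer_alt sum_distrib_left comp_assoc[symmetric]
    by (intro sum.cong refl) (auto simp: sgn mem)
qed

text \<open>The row and column groups meet only in the identity, so the identity has a single
  factorization into a row and a column permutation. This normalization is what later allows scalars
  to be read off at \<open>id\<close>.\<close>

lemma young_symmetrizer_id: "young_symmetrizer l id = 1"
proof -
  have "q \<in> row_group l \<and> pinv q \<circ> id \<in> col_group l \<longleftrightarrow> q = id" if q: "q permutes {..<sum_list l}" for q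
    using row_col_group_Int[of q l] col_group_inv[of "pinv q" l] id_in_row_group id_in_col_group
    by (auto simp: pinv_cancel[OF q])
  then have "young_symmetrizer l id = (\<Sum>q\<in>perms (sum_list l). if q = id then 1 else 0)"
    unfolding young_symmetrizer_alt by (intro sum.cong refl) simp
  also have "\<dots> = 1" by (simp add: finite_permutations permutes_id)
  finally show ?thesis .
qed

lemma young_symmetrizer_outside:
  assumes "\<not> w permutes {..<sum_list l}" shows "young_symmetrizer l w = 0"
  unfolding young_symmetrizer_alt
proof (intro sum.neutral ballI)
  fix q assume "q \<in> {q. q permutes {..<sum_list l}}"
  then have q: "q permutes {..<sum_list l}" by simp
  have "pinv q \<circ> w \<notin> col_group l"
  proof
    assume "pinv q \<circ> w \<in> col_group l"
    from permutes_compose[OF col_group_permutes[OF this] q] show False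
      using assms by (simp add: pinv_cancel[OF q])
  qed
  then show "(if q \<in> row_group l \<and> pinv q \<circ> w \<in> col_group l then of_int (sign (pinv q \<circ> w)) else 0) = 0" by simp
qed

lemma young_symmetrizer_outside_comp:
  assumes "\<not> w permutes {..<sum_list l}" and q: "q permutes {..<sum_list l}"
  shows "young_symmetrizer l (pinv q \<circ> w) = 0"
proof (rule young_symmetrizer_outside)
  show "\<not> pinv q \<circ> w permutes {..<sum_list l}"
    using permutes_compose[OF _ q, of "pinv q \<circ> w"] assms by (auto simp: pinv_cancel[OF q])
qed

text \<open>The behaviour of coefficient functions of elements \<open>a x b\<close> of the group
  algebra, with \<open>a\<close> the sum over the row group of \<open>l\<close> and \<open>b\<close>
  the signed sum over the column group of \<open>m\<close>. The shapes may differ, which is how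
  orthogonality of distinct characters arises.\<close>

definition equivariant :: "nat list \<Rightarrow> nat list \<Rightarrow> ((nat \<Rightarrow> nat) \<Rightarrow> 'k :: field_char_0) \<Rightarrow> bool" where
  "equivariant l m F \<longleftrightarrow> (\<forall>w. w permutes {..<sum_list l} \<longrightarrow>
     (\<forall>p\<in>row_group l. F (p \<circ> w) = F w) \<and> (\<forall>q\<in>col_group m. F (w \<circ> q) = of_int (sign q) * F w))"

text \<open>A transposition of two entries that share both a row and a column contributes the sign
  \<open>-1\<close>.\<close>

lemma equivariant_zero_or_inj:
  fixes F :: "(nat \<Rightarrow> nat) \<Rightarrow> 'k :: field_char_0"
  assumes F: "equivariant l m F" and lm: "sum_list l = d" "sum_list m = d" and w: "w permutes {..<d}"
    and "F w \<noteq> 0"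
  shows "inj_on (\<lambda>x. (row_of l x, col_of m (pinv w x))) {..<d}"
proof (rule inj_onI, rule ccontr)
  fix x y assume x: "x \<in> {..<d}" and y: "y \<in> {..<d}" and "x \<noteq> y"
    and e: "(row_of l x, col_of m (pinv w x)) = (row_of l y, col_of m (pinv w y))"
  define t where "t = transpose x y"
  define q where "q = transpose (pinv w x) (pinv w y)"
  note w' = permutes_less_iff[OF permutes_inv[OF w]]
  have ne: "pinv w x \<noteq> pinv w y" using \<open>x \<noteq> y\<close> permutes_inj[OF permutes_inv[OF w]] by (simp add: inj_eq)
  have "t permutes {..<d}" "q permutes {..<d}"
    unfolding t_def q_def using x y w' by (simp_all add: permutes_swap_id)
  then have t: "t \<in> row_group l" and q: "q \<in> col_group m"
    unfolding row_group_iff col_group_iff lm using e by (auto simp: t_def q_def transpose_def)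
  have "t \<circ> w = w \<circ> q"
  proof
    fix z
    have "w z = x \<longleftrightarrow> z = pinv w x" "w z = y \<longleftrightarrow> z = pinv w y"
      using permutes_inverses[OF w] by metis+
    then show "(t \<circ> w) z = (w \<circ> q) z"
      unfolding t_def q_def by (auto simp: transpose_def permutes_inverses[OF w])
  qed
  then have "F w = of_int (sign q) * F w" using F t q w unfolding equivariant_def lm by metis
  also have "sign q = - 1" unfolding q_def using ne by (simp add: sign_swap_id)
  finally have "F w + F w = 0" by (simp add: eq_neg_iff_add_eq_0)
  then have "2 * F w = 0" by (simp only: mult_2)
  then show False using \<open>F w \<noteq> 0\<close> by simp
qed

lemma equivariant_zero:
  assumes F: "equivariant l m F" and lm: "l \<in> partitions d" "m \<in> partitions d" and w: "w permutes {..<d}"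
    and "\<not> l \<le> m"
  shows "F w = 0"
  using equivariant_zero_or_inj[OF F _ _ w] young_dichotomy(1)[OF lm w] lm assms(5)
  by (auto simp: partitions_def)

text \<open>At products of a row and a column permutation the value is forced by the one at
  \<open>id\<close>; every other permutation admits a transposition that kills both sides. So these
  functions form a line, spanned by the symmetrizer.\<close>

lemma equivariant_unique:
  assumes F: "equivariant l l F" and l: "l \<in> partitions d" and w: "w permutes {..<d}"
  shows "F w = F id * young_symmetrizer l w"
proof -
  have d: "sum_list l = d" using l by (simp add: partitions_def)
  have c: "equivariant l l (young_symmetrizer l :: _ \<Rightarrow> 'a)"
    unfolding equivariant_def using young_symmetrizer_left young_symmetrizer_right by blast
  show ?thesis
  proof (cases "inj_on (\<lambda>x. (row_of l x, col_of l (pinv w x))) {..<d}")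
    case True
    then obtain p q where p: "p \<in> row_group l" and q: "q \<in> col_group l" and pq: "w = p \<circ> q"
      using young_dichotomy(2)[OF l l w _ refl] by blast
    have val: "G w = of_int (sign q) * G id" if G: "equivariant l l G" for G :: "_ \<Rightarrow> 'a"
    proof -
      have "G w = G q" using G p col_group_permutes[OF q] unfolding equivariant_def pq by blast
      also have "G q = G (id \<circ> q)" by simp
      also have "\<dots> = of_int (sign q) * G id" using G q permutes_id unfolding equivariant_def by blast
      finally show ?thesis .
    qed
    show ?thesis using val[OF F] val[OF c] by (simp add: young_symmetrizer_id)
  next
    case False
    then have "F w = 0" "young_symmetrizer l w = (0 :: 'a)"
      using equivariant_zero_or_inj[OF F d d w] equivariant_zero_or_inj[OF c d d w] by blast+
    then show ?thesis by simp
  qed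
qed

text \<open>The sum is the coefficient of \<open>w\<close> in \<open>x u c\<close>, with
  \<open>c\<close> the symmetrizer of \<open>m\<close>. The invariance of \<open>x\<close> acts from
  the left and that of \<open>c\<close> from the right, so the \<open>u\<close> in between is
  arbitrary.\<close>

lemma group_alg_mult_young_equivariant:
  fixes x :: "(nat \<Rightarrow> nat) \<Rightarrow> 'k :: field_char_0"
  assumes lm: "sum_list l = d" "sum_list m = d" and u: "u permutes {..<d}"
    and x: "\<And>p t. p \<in> row_group l \<Longrightarrow> t permutes {..<d} \<Longrightarrow> x (p \<circ> t) = x t"
  shows "equivariant l m (\<lambda>w. \<Sum>t\<in>perms d. x t * young_symmetrizer m (pinv u \<circ> pinv t \<circ> w))"
  unfolding equivariant_def lm
proof (intro allI impI conjI ballI)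
  fix w p assume w: "w permutes {..<d}" and p: "p \<in> row_group l"
  have pp: "p permutes {..<d}" using row_group_permutes[OF p] lm by simp
  show "(\<Sum>t\<in>perms d. x t * young_symmetrizer m (pinv u \<circ> pinv t \<circ> (p \<circ> w))) =
    (\<Sum>t\<in>perms d. x t * young_symmetrizer m (pinv u \<circ> pinv t \<circ> w))"
    by (subst setum_permutations_compose_left[OF pp])
       (auto intro!: sum.cong simp: x[OF p] pinv_comp[OF pp] comp_assoc pinv_cancel[OF pp])
next
  fix w q assume w: "w permutes {..<d}" and q: "q \<in> col_group m"
  have "young_symmetrizer m (pinv u \<circ> pinv t \<circ> (w \<circ> q)) = of_int (sign q) * (young_symmetrizer m (pinv u \<circ> pinv t \<circ> w) :: 'k)"
    if t: "t permutes {..<d}" for t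
  proof -
    have "pinv u \<circ> pinv t \<circ> w permutes {..<sum_list m}"
      unfolding lm using w t u by (intro permutes_compose permutes_inv)
    from young_symmetrizer_right[OF q this] show ?thesis by (simp add: comp_assoc)
  qed
  then show "(\<Sum>t\<in>perms d. x t * young_symmetrizer m (pinv u \<circ> pinv t \<circ> (w \<circ> q))) =
    of_int (sign q) * (\<Sum>t\<in>perms d. x t * young_symmetrizer m (pinv u \<circ> pinv t \<circ> w))"
    unfolding sum_distrib_left by (intro sum.cong) auto
qed

text \<open>The factor by which the symmetrizer is idempotent up to scaling, read off at
  \<open>id\<close>, where the symmetrizer has value 1. Classically it is \<open>d!\<close> divided
  by the dimension of the representation.\<close>

definition young_scalar :: "nat list \<Rightarrow> 'k :: field_char_0" where
  "young_scalar l = group_alg_mult (sum_list l) (young_symmetrizer l) (young_symmetrizer l) id"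

lemma young_symmetrizer_square:
  assumes l: "l \<in> partitions d"
  shows "group_alg_mult d (young_symmetrizer l) (young_symmetrizer l) w = (young_scalar l :: 'k :: field_char_0) * young_symmetrizer l w"
proof (cases "w permutes {..<d}")
  case True
  have d: "sum_list l = d" using l by (simp add: partitions_def)
  have "equivariant l l (group_alg_mult d (young_symmetrizer l) (young_symmetrizer l) :: _ \<Rightarrow> 'k)"
    using group_alg_mult_young_equivariant[OF d d permutes_id, where x = "young_symmetrizer l :: _ \<Rightarrow> 'k"]
      young_symmetrizer_left[where l = l and 'a = 'k]
    by (simp add: group_alg_mult_def[abs_def])
  from equivariant_unique[OF this l True] show ?thesis unfolding young_scalar_def d .
next
  case False
  have d: "sum_list l = d" using l by (simp add: partitions_def)
  have "young_symmetrizer l (pinv q \<circ> w) = (0 :: 'k)" if "q permutes {..<d}" for q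
    using young_symmetrizer_outside_comp that False d by blast
  then show ?thesis using young_symmetrizer_outside[of w l, where 'a = 'k] False d
    by (simp add: group_alg_mult_def)
qed

text \<open>In group algebra terms, this computes the sum over \<open>u\<close> of the coefficient of the identity in
  \<open>x u c u\<^sup>-\<^sup>1\<close>, where \<open>c\<close> is the Young symmetrizer.\<close>

lemma young_pairing:
  fixes x :: "(nat \<Rightarrow> nat) \<Rightarrow> 'k :: field_char_0"
  assumes l: "l \<in> partitions d" and m: "m \<in> partitions d"
    and x: "\<And>p t. p \<in> row_group l \<Longrightarrow> t permutes {..<d} \<Longrightarrow> x (p \<circ> t) = x t"
  shows "\<not> l \<le> m \<Longrightarrow> (\<Sum>u\<in>perms d. \<Sum>t\<in>perms d. x t * young_symmetrizer m (pinv u \<circ> pinv t \<circ> u)) = 0"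
    and "l = m \<Longrightarrow> (\<Sum>u\<in>perms d. \<Sum>t\<in>perms d. x t * young_symmetrizer m (pinv u \<circ> pinv t \<circ> u))
       = young_scalar l * (\<Sum>t\<in>perms d. x t * young_symmetrizer l (pinv t))"
proof -
  have d: "sum_list l = d" "sum_list m = d" using l m by (simp_all add: partitions_def)
  define F where "F u w = (\<Sum>t\<in>perms d. x t * young_symmetrizer m (pinv u \<circ> pinv t \<circ> w))" for u w
  have eq: "equivariant l m (F u)" if "u permutes {..<d}" for u
    unfolding F_def by (rule group_alg_mult_young_equivariant[OF d that x])
  show "(\<Sum>u\<in>perms d. \<Sum>t\<in>perms d. x t * young_symmetrizer m (pinv u \<circ> pinv t \<circ> u)) = 0"
    if "\<not> l \<le> m"
    unfolding F_def[symmetric] using equivariant_zero[OF eq l m _ that] by (intro sum.neutral) auto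
  show "(\<Sum>u\<in>perms d. \<Sum>t\<in>perms d. x t * young_symmetrizer m (pinv u \<circ> pinv t \<circ> u))
       = young_scalar l * (\<Sum>t\<in>perms d. x t * young_symmetrizer l (pinv t))" if lm: "l = m"
  proof -
    \<comment> \<open>\<open>F u\<close> is the symmetrizer times \<open>F u id\<close>. This
      separates \<open>u\<close> from the argument and leaves a square of the symmetrizer, in which
      the sum over \<open>u\<close> collapses.\<close>
    have "(\<Sum>u\<in>perms d. F u u) = (\<Sum>u\<in>perms d. F u id * young_symmetrizer l u)"
    proof (rule sum.cong[OF refl])
      fix u assume "u \<in> perms d"
      then have u: "u permutes {..<d}" by simp
      have "equivariant l l (F u)" using eq[OF u] lm by simp
      from equivariant_unique[OF this l u] show "F u u = F u id * young_symmetrizer l u" .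
    qed
    also have "\<dots> = (\<Sum>u\<in>perms d. \<Sum>t\<in>perms d.
       x t * (young_symmetrizer l u * young_symmetrizer l (pinv u \<circ> pinv t)))"
      unfolding F_def lm sum_distrib_right by (intro sum.cong refl) (simp add: mult_ac)
    also have "\<dots> = (\<Sum>t\<in>perms d. \<Sum>u\<in>perms d.
       x t * (young_symmetrizer l u * young_symmetrizer l (pinv u \<circ> pinv t)))"
      by (rule sum.swap)
    also have "\<dots> = (\<Sum>t\<in>perms d. x t * group_alg_mult d (young_symmetrizer l) (young_symmetrizer l) (pinv t))"
      unfolding group_alg_mult_def sum_distrib_left ..
    also have "\<dots> = young_scalar l * (\<Sum>t\<in>perms d. x t * young_symmetrizer l (pinv t))"
      unfolding young_symmetrizer_square[OF l] by (simp add: sum_distrib_left mult_ac)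
    finally show ?thesis unfolding F_def .
  qed
qed

section \<open>The character formula\<close>

lemma sum_fun_eq: "sum f A = (\<lambda>y. \<Sum>x\<in>A. f x y)"
  by (induction A rule: infinite_finite_induct) (auto simp: fun_eq_iff)

text \<open>The right-hand side is the trace of the operator with kernel \<open>k\<close> on all functions supported on
  \<open>X\<close>; this operator maps into \<open>V\<close> and agrees with \<open>U\<close> there.\<close>

lemma trace_on_kernel:
  fixes V :: "('b \<Rightarrow> 'k :: field) set"
  assumes X: "finite X" and V: "fun_space.subspace V"
    and supp: "\<And>v y. v \<in> V \<Longrightarrow> y \<notin> X \<Longrightarrow> v y = 0"
    and k: "\<And>x. x \<in> X \<Longrightarrow> k x \<in> V"
    and U: "\<And>v. v \<in> V \<Longrightarrow> U v = (\<lambda>y. \<Sum>x\<in>X. v x * k x y)"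
  shows "trace_on V U = (\<Sum>x\<in>X. k x x)"
proof -
  define B where "B = (SOME B. fun_space.independent B \<and> fun_space.span B = V)"
  have spanV: "fun_space.span V = V" using V by (rule fun_space.span_eq_iff[THEN iffD2])
  obtain B0 where "B0 \<subseteq> V" "fun_space.independent B0" "V \<subseteq> fun_space.span B0"
    by (rule fun_space.maximal_independent_subset)
  moreover from this have "fun_space.span B0 = V" using fun_space.span_mono[of B0 V] spanV by blast
  ultimately have "\<exists>B. fun_space.independent B \<and> fun_space.span B = V" by blast
  then have ind: "fun_space.independent B" and span: "fun_space.span B = V"
    unfolding B_def by (metis (mono_tags, lifting) someI_ex)+
  define \<delta> where "\<delta> x y = (if y = x then 1 else 0 :: 'k)" for x y :: 'b
  have "V \<subseteq> fun_space.span (\<delta> ` X)"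
  proof
    fix v assume v: "v \<in> V"
    have "v = (\<Sum>x\<in>X. (\<lambda>y. v x * \<delta> x y))"
      unfolding sum_fun_eq using supp[OF v] X by (auto simp: fun_eq_iff \<delta>_def if_distrib cong: if_cong)
    moreover have "(\<Sum>x\<in>X. (\<lambda>y. v x * \<delta> x y)) \<in> fun_space.span (\<delta> ` X)"
      by (intro fun_space.span_sum fun_space.span_scale fun_space.span_base) auto
    ultimately show "v \<in> fun_space.span (\<delta> ` X)" by simp
  qed
  moreover have BV: "B \<subseteq> V" using fun_space.span_superset span by blast
  \<comment> \<open>An independent set in the span of the finitely many point masses on
    \<open>X\<close> is finite, which the coordinate sums below require.\<close>
  ultimately have finB: "finite B"
    using fun_space.independent_span_bound[OF _ ind, of "\<delta> ` X"] X by auto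
  let ?r = "fun_space.representation B"
  have rep: "?r (U b) = (\<lambda>b'. \<Sum>x\<in>X. b x * ?r (k x) b')" if "b \<in> B" for b
  proof -
    have Ub: "U b = (\<Sum>x\<in>X. (\<lambda>y. b x * k x y))" unfolding sum_fun_eq using U BV that by auto
    have "?r (U b) = (\<lambda>b'. \<Sum>x\<in>X. ?r (\<lambda>y. b x * k x y) b')"
      unfolding Ub using k span by (intro fun_space.representation_sum[OF ind] fun_space.span_scale) auto
    also have "\<dots> = (\<lambda>b'. \<Sum>x\<in>X. b x * ?r (k x) b')"
      using k span by (intro ext sum.cong refl) (simp add: fun_space.representation_scale[OF ind])
    finally show ?thesis .
  qed
  have "trace_on V U = (\<Sum>b\<in>B. \<Sum>x\<in>X. b x * ?r (k x) b)"
    unfolding trace_on_def Let_def B_def[symmetric] by (intro sum.cong refl) (simp add: rep)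
  also have "\<dots> = (\<Sum>x\<in>X. \<Sum>b\<in>B. b x * ?r (k x) b)" by (rule sum.swap)
  also have "\<dots> = (\<Sum>x\<in>X. k x x)"
  proof (rule sum.cong[OF refl])
    fix x assume x: "x \<in> X"
    have "(\<Sum>b\<in>B. (\<lambda>y. ?r (k x) b * b y)) = k x"
      by (rule fun_space.sum_representation_eq[OF ind]) (use k[OF x] span finB in auto)
    then show "(\<Sum>b\<in>B. b x * ?r (k x) b) = k x x" unfolding sum_fun_eq by (metis (no_types, lifting) mult.commute sum.cong)
  qed
  finally show ?thesis .
qed

section \<open>The left ideal generated by the symmetrizer\<close>

lemma irrep_subspace: "fun_space.subspace (irrep l :: (_ \<Rightarrow> 'k :: field) set)"
proof (rule fun_space.subspaceI)
  let ?c = "young_symmetrizer l :: _ \<Rightarrow> 'k" and ?d = "sum_list l"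
  show "0 \<in> irrep l" unfolding irrep_def
    by (rule image_eqI[of _ _ "\<lambda>_. 0"]) (auto simp: group_alg_mult_def group_alg_def fun_eq_iff)
  show "f + g \<in> irrep l" if fg: "f \<in> irrep l" "g \<in> irrep l" for f g :: "_ \<Rightarrow> 'k"
  proof -
    obtain x y where xy: "x \<in> group_alg ?d" "f = group_alg_mult ?d x ?c" "y \<in> group_alg ?d" "g = group_alg_mult ?d y ?c"
      using fg unfolding irrep_def by auto
    have "f + g = group_alg_mult ?d (\<lambda>p. x p + y p) ?c"
      unfolding xy by (auto simp: group_alg_mult_def fun_eq_iff sum.distrib algebra_simps)
    moreover have "(\<lambda>p. x p + y p) \<in> group_alg ?d" using xy unfolding group_alg_def by auto
    ultimately show ?thesis unfolding irrep_def by blast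
  qed
  show "(\<lambda>y. a * f y) \<in> irrep l" if f: "f \<in> irrep l" for a :: 'k and f
  proof -
    obtain x where x: "x \<in> group_alg ?d" "f = group_alg_mult ?d x ?c"
      using f unfolding irrep_def by auto
    have "(\<lambda>y. a * f y) = group_alg_mult ?d (\<lambda>p. a * x p) ?c"
      unfolding x by (auto simp: group_alg_mult_def fun_eq_iff sum_distrib_left mult_ac)
    moreover have "(\<lambda>p. a * x p) \<in> group_alg ?d" using x unfolding group_alg_def by auto
    ultimately show ?thesis unfolding irrep_def by blast
  qed
qed

lemma irrep_support:
  assumes "v \<in> irrep l" "\<not> p permutes {..<sum_list l}" shows "v p = 0"
  using assms(1) unfolding irrep_def group_alg_mult_def
  by (auto simp: young_symmetrizer_outside_comp[OF assms(2)])

lemma translate_in_irrep: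
  assumes "z permutes {..<sum_list l}"
  shows "(\<lambda>y. a * young_symmetrizer l (pinv z \<circ> y)) \<in> irrep l"
  unfolding irrep_def
proof (rule image_eqI)
  let ?x = "\<lambda>p. if p = z then a else 0"
  show "?x \<in> group_alg (sum_list l)" using assms unfolding group_alg_def by auto
  have "(\<Sum>q\<in>perms (sum_list l). ?x q * young_symmetrizer l (pinv q \<circ> y)) =
     (\<Sum>q\<in>perms (sum_list l). if q = z then a * young_symmetrizer l (pinv z \<circ> y) else 0)" for y
    by (intro sum.cong) auto
  then show "(\<lambda>y. a * young_symmetrizer l (pinv z \<circ> y)) = group_alg_mult (sum_list l) ?x (young_symmetrizer l)"
    unfolding group_alg_mult_def using assms by (intro ext) (simp add: finite_permutations)
qed

text \<open>Right multiplication by the symmetrizer \<open>c\<close> is a scalar on the ideal: its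
  elements have the form \<open>x c\<close>, and \<open>c c\<close> is a multiple of
  \<open>c\<close>.\<close>

lemma irrep_mult_young:
  assumes l: "l \<in> partitions d" and v: "v \<in> irrep l"
  shows "(\<Sum>x\<in>perms d. v x * young_symmetrizer l (pinv x \<circ> p)) = young_scalar l * v p"
proof -
  have d: "sum_list l = d" using l by (simp add: partitions_def)
  let ?c = "young_symmetrizer l :: _ \<Rightarrow> 'a"
  obtain x where v: "v = group_alg_mult d x ?c" using v unfolding irrep_def d by auto
  have "(\<Sum>q\<in>perms d. v q * ?c (pinv q \<circ> p)) =
     (\<Sum>q\<in>perms d. \<Sum>r\<in>perms d. x r * (?c (pinv r \<circ> q) * ?c (pinv q \<circ> p)))"
    unfolding v group_alg_mult_def sum_distrib_right by (intro sum.cong refl) (simp add: mult_ac)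
  also have "\<dots> = (\<Sum>r\<in>perms d. \<Sum>q\<in>perms d. x r * (?c (pinv r \<circ> q) * ?c (pinv q \<circ> p)))"
    by (rule sum.swap)
  also have "\<dots> = (\<Sum>r\<in>perms d. x r * group_alg_mult d ?c ?c (pinv r \<circ> p))"
  proof (rule sum.cong[OF refl])
    fix r assume "r \<in> perms d"
    then have r: "r permutes {..<d}" by simp
    show "(\<Sum>q\<in>perms d. x r * (?c (pinv r \<circ> q) * ?c (pinv q \<circ> p))) = x r * group_alg_mult d ?c ?c (pinv r \<circ> p)"
      unfolding group_alg_mult_def sum_distrib_left
      by (subst setum_permutations_compose_left[OF r])
         (auto intro!: sum.cong simp: pinv_comp[OF r] comp_assoc pinv_cancel[OF r])
  qed
  also have "\<dots> = young_scalar l * v p"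
    unfolding young_symmetrizer_square[OF l] unfolding v group_alg_mult_def sum_distrib_left
    by (intro sum.cong refl) (simp add: mult_ac)
  finally show ?thesis .
qed

text \<open>Right multiplication by the symmetrizer has a kernel with 1 everywhere on the diagonal,
  so its trace on the ideal is \<open>d!\<close>, nonzero in characteristic 0. If the scalar
  vanished, the operator and hence its trace would be 0.\<close>

lemma young_scalar_nonzero:
  assumes l: "l \<in> partitions d" shows "(young_scalar l :: 'k :: field_char_0) \<noteq> 0"
proof
  assume 0: "(young_scalar l :: 'k) = 0"
  have d: "sum_list l = d" using l by (simp add: partitions_def)
  let ?c = "young_symmetrizer l :: _ \<Rightarrow> 'k"
  let ?U = "\<lambda>v y. \<Sum>x\<in>perms d. v x * ?c (pinv x \<circ> y)"
  have fin: "finite (perms d)" by (simp add: finite_permutations)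
  have supp: "v y = 0" if "v \<in> irrep l" "y \<notin> perms d" for v :: "_ \<Rightarrow> 'k" and y
    using irrep_support[OF that(1)] that(2) d by simp
  have "trace_on (irrep l) ?U = (\<Sum>x\<in>perms d. ?c (pinv x \<circ> x))"
  proof (rule trace_on_kernel[where k = "\<lambda>x y. ?c (pinv x \<circ> y)"])
    show "(\<lambda>y. ?c (pinv x \<circ> y)) \<in> irrep l" if "x \<in> perms d" for x
      using translate_in_irrep[of x l 1] that d by simp
  qed (use fin irrep_subspace supp in simp_all)
  also have "\<dots> = (\<Sum>x\<in>perms d. 1)"
    by (intro sum.cong refl) (auto simp: pinv_cancel young_symmetrizer_id)
  finally have 1: "trace_on (irrep l) ?U = fact d" by (simp add: card_permutations)
  have "trace_on (irrep l) ?U = (\<Sum>x\<in>perms d. (0 :: (nat \<Rightarrow> nat) \<Rightarrow> 'k) x)"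
  proof (rule trace_on_kernel[where k = "\<lambda>x. 0"])
    show "0 \<in> irrep l" by (rule fun_space.subspace_0[OF irrep_subspace])
    show "?U v = (\<lambda>y. \<Sum>x\<in>perms d. v x * 0 y)" if "v \<in> irrep l" for v
      using irrep_mult_young[OF l that] 0 by (simp add: fun_eq_iff)
  qed (use fin irrep_subspace supp in simp_all)
  then show False using 1 by simp
qed

text \<open>Right multiplication by the symmetrizer, divided by \<open>young_scalar l\<close>,
  projects onto the ideal. Followed by the action of \<open>s\<close> it has an explicit kernel on
  the group, so the trace is a sum of diagonal values and no basis of the ideal is chosen.\<close>

lemma irr_char_formula:
  assumes l: "l \<in> partitions d" and s: "s permutes {..<d}"
  shows "irr_char l s = (\<Sum>g\<in>perms d. young_symmetrizer l (pinv g \<circ> pinv s \<circ> g)) / (young_scalar l :: 'k :: field_char_0)"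
proof -
  have d: "sum_list l = d" using l by (simp add: partitions_def)
  let ?c = "young_symmetrizer l :: _ \<Rightarrow> 'k"
  let ?n = "young_scalar l :: 'k"
  have fin: "finite (perms d)" by (simp add: finite_permutations)
  have supp: "v y = 0" if "v \<in> irrep l" "y \<notin> perms d" for v :: "_ \<Rightarrow> 'k" and y
    using irrep_support[OF that(1)] that(2) d by simp
  have "irr_char l s = (\<Sum>x\<in>perms d. 1 / ?n * ?c (pinv (s \<circ> x) \<circ> x))"
    unfolding irr_char_def
  proof (rule trace_on_kernel[where k = "\<lambda>x y. 1 / ?n * ?c (pinv (s \<circ> x) \<circ> y)"])
    show "(\<lambda>y. 1 / ?n * ?c (pinv (s \<circ> x) \<circ> y)) \<in> irrep l" if "x \<in> perms d" for x
      using that s d by (intro translate_in_irrep) (auto intro: permutes_compose)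
    show "perm_act s v = (\<lambda>y. \<Sum>x\<in>perms d. v x * (1 / ?n * ?c (pinv (s \<circ> x) \<circ> y)))" if v: "v \<in> irrep l" for v
    proof
      fix y
      have "?n * perm_act s v y = (\<Sum>x\<in>perms d. v x * ?c (pinv x \<circ> (pinv s \<circ> y)))"
        unfolding perm_act_def using irrep_mult_young[OF l v] by simp
      also have "\<dots> = (\<Sum>x\<in>perms d. v x * ?c (pinv (s \<circ> x) \<circ> y))"
        by (intro sum.cong refl) (auto simp: pinv_comp[OF s] comp_assoc)
      finally have "perm_act s v y = (\<Sum>x\<in>perms d. v x * ?c (pinv (s \<circ> x) \<circ> y)) / ?n"
        using young_scalar_nonzero[OF l, where 'k = 'k] by (simp add: field_simps)
      then show "perm_act s v y = (\<Sum>x\<in>perms d. v x * (1 / ?n * ?c (pinv (s \<circ> x) \<circ> y)))"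
        by (simp add: sum_divide_distrib)
    qed
  qed (use fin irrep_subspace supp in simp_all)
  also have "\<dots> = (\<Sum>x\<in>perms d. ?c (pinv x \<circ> pinv s \<circ> x)) / ?n"
    unfolding sum_divide_distrib by (intro sum.cong refl) (auto simp: pinv_comp[OF s])
  finally show ?thesis .
qed

section \<open>Orthogonality relations\<close>

text \<open>The average over the conjugates of the argument without the factor
  \<open>1 / d!\<close>. Irreducible characters are of this form up to a scalar, and so are
  permutation characters.\<close>

definition conj_sum :: "nat \<Rightarrow> ((nat \<Rightarrow> nat) \<Rightarrow> 'k :: field_char_0) \<Rightarrow> (nat \<Rightarrow> nat) \<Rightarrow> 'k" where
  "conj_sum d x s = (\<Sum>g\<in>perms d. x (pinv g \<circ> s \<circ> g))"

lemma conj_sum_conj: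
  assumes h: "h permutes {..<d}"
  shows "conj_sum d x (h \<circ> s \<circ> pinv h) = conj_sum d x s"
  unfolding conj_sum_def
  by (subst setum_permutations_compose_left[OF h])
     (auto intro!: sum.cong simp: pinv_comp[OF h] comp_assoc pinv_cancel[OF h])

text \<open>The second factor is a class function, so conjugating \<open>s\<close> by a
  \<open>g\<close> from the first sum undoes that \<open>g\<close>, and all \<open>d!\<close> terms
  of the first sum agree. The inverse in the first factor turns the rest into coefficients of the
  identity in products of group algebra elements.\<close>

lemma conj_sum_pairing:
  "(\<Sum>s\<in>perms d. conj_sum d x (pinv s) * conj_sum d y s)
     = fact d * (\<Sum>u\<in>perms d. \<Sum>t\<in>perms d. x t * y (pinv u \<circ> pinv t \<circ> u))"
proof -
  have "(\<Sum>s\<in>perms d. conj_sum d x (pinv s) * conj_sum d y s) =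
     (\<Sum>s\<in>perms d. \<Sum>g\<in>perms d. x (pinv g \<circ> pinv s \<circ> g) * conj_sum d y s)"
    by (subst (1) conj_sum_def) (simp add: sum_distrib_right)
  also have "\<dots> = (\<Sum>g\<in>perms d. \<Sum>s\<in>perms d. x (pinv g \<circ> pinv s \<circ> g) * conj_sum d y s)"
    by (rule sum.swap)
  also have "\<dots> = (\<Sum>g\<in>perms d. \<Sum>s\<in>perms d. x (pinv s) * conj_sum d y s)"
  proof (rule sum.cong[OF refl])
    fix g assume "g \<in> perms d"
    then have g: "g permutes {..<d}" by simp
    note g' = permutes_inv[OF g]
    have "(\<Sum>s\<in>perms d. x (pinv g \<circ> pinv s \<circ> g) * conj_sum d y s) =
      (\<Sum>s\<in>perms d. x (pinv g \<circ> pinv (g \<circ> s \<circ> pinv g) \<circ> g) * conj_sum d y (g \<circ> s \<circ> pinv g))"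
      by (subst setum_permutations_compose_left[OF g], subst sum_permutations_compose_right[OF g'])
         (simp only: comp_assoc)
    also have "\<dots> = (\<Sum>s\<in>perms d. x (pinv s) * conj_sum d y s)"
    proof (rule sum.cong[OF refl])
      fix s assume "s \<in> perms d"
      then have s: "s permutes {..<d}" by simp
      have "pinv (g \<circ> s \<circ> pinv g) = g \<circ> pinv s \<circ> pinv g"
        using g s g' by (simp add: pinv_comp permutes_compose pinv_cancel[OF g] comp_assoc)
      then show "x (pinv g \<circ> pinv (g \<circ> s \<circ> pinv g) \<circ> g) * conj_sum d y (g \<circ> s \<circ> pinv g) = x (pinv s) * conj_sum d y s"
        unfolding conj_sum_conj[OF g] by (simp add: comp_assoc pinv_cancel[OF g])
    qed
    finally show "(\<Sum>s\<in>perms d. x (pinv g \<circ> pinv s \<circ> g) * conj_sum d y s) = (\<Sum>s\<in>perms d. x (pinv s) * conj_sum d y s)" .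
  qed
  also have "\<dots> = fact d * (\<Sum>s\<in>perms d. x (pinv s) * conj_sum d y s)" by (simp add: card_permutations)
  also have "(\<Sum>s\<in>perms d. x (pinv s) * conj_sum d y s) = (\<Sum>s\<in>perms d. x s * conj_sum d y (pinv s))"
    by (subst sum_permutations_inverse) (auto intro!: sum.cong simp: pinv_cancel)
  also have "\<dots> = (\<Sum>t\<in>perms d. \<Sum>u\<in>perms d. x t * y (pinv u \<circ> pinv t \<circ> u))"
    unfolding conj_sum_def sum_distrib_left ..
  also have "\<dots> = (\<Sum>u\<in>perms d. \<Sum>t\<in>perms d. x t * y (pinv u \<circ> pinv t \<circ> u))" by (rule sum.swap)
  finally show ?thesis .
qed

text \<open>The class of \<open>p q\<close> contains \<open>q p\<close>, the inverse of \<open>p\<^sup>-\<^sup>1 q\<^sup>-\<^sup>1\<close>.\<close>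

lemma conj_sum_young_inv:
  assumes d: "sum_list l = d" and s: "s permutes {..<d}"
  shows "conj_sum d (young_symmetrizer l) (pinv s) = conj_sum d (young_symmetrizer l) s"
proof -
  define b where "b w = (if w \<in> col_group l then of_int (sign w) else 0 :: 'a)" for w
  have b_inv: "b (pinv w) = b w" if w: "w permutes {..<d}" for w
  proof -
    have "pinv w \<in> col_group l \<longleftrightarrow> w \<in> col_group l"
      using col_group_inv[of w l] col_group_inv[of "pinv w" l] by (auto simp: pinv_cancel[OF w])
    then show ?thesis unfolding b_def by (simp add: sign_inverse permutation_lessThan[OF w])
  qed
  have ys: "young_symmetrizer l w = (\<Sum>q\<in>perms d. if q \<in> row_group l then b (pinv q \<circ> w) else 0)" for w
    unfolding young_symmetrizer_alt d b_def by (intro sum.cong) auto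
  have "conj_sum d (young_symmetrizer l) (pinv s) =
    (\<Sum>q\<in>perms d. \<Sum>g\<in>perms d. if q \<in> row_group l then b (pinv q \<circ> (pinv g \<circ> pinv s \<circ> g)) else 0)"
    unfolding conj_sum_def ys by (rule sum.swap)
  also have "\<dots> = (\<Sum>q\<in>perms d. \<Sum>g\<in>perms d. if q \<in> row_group l then b (q \<circ> (pinv g \<circ> s \<circ> g)) else 0)"
  proof (rule sum.cong[OF refl])
    fix q assume "q \<in> perms d"
    then have q: "q permutes {..<d}" by simp
    note q' = permutes_inv[OF q]
    \<comment> \<open>After this substitution the argument is the inverse of
      \<open>q \<circ> (pinv g \<circ> s \<circ> g)\<close>, and \<open>b\<close> takes equal values
      at inverse permutations.\<close>
    have "(\<Sum>g\<in>perms d. b (pinv q \<circ> (pinv g \<circ> pinv s \<circ> g))) = (\<Sum>g\<in>perms d. b (pinv q \<circ> (pinv (g \<circ> pinv q) \<circ> pinv s \<circ> (g \<circ> pinv q))))"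
      by (rule sum_permutations_compose_right[OF q'])
    also have "\<dots> = (\<Sum>g\<in>perms d. b (q \<circ> (pinv g \<circ> s \<circ> g)))"
    proof (rule sum.cong[OF refl])
      fix g assume "g \<in> perms d"
      then have g: "g permutes {..<d}" by simp
      have w: "q \<circ> (pinv g \<circ> s \<circ> g) permutes {..<d}"
        using g q s by (intro permutes_compose permutes_inv)
      have "pinv (q \<circ> (pinv g \<circ> s \<circ> g)) = pinv g \<circ> pinv s \<circ> g \<circ> pinv q"
        using pinv_comp[OF q permutes_compose[OF permutes_compose[OF g s] permutes_inv[OF g]]]
          pinv_comp[OF permutes_inv[OF g] permutes_compose[OF g s]] pinv_comp[OF s g]
        by (simp add: pinv_cancel[OF g] comp_assoc)
      moreover have "pinv q \<circ> (pinv (g \<circ> pinv q) \<circ> pinv s \<circ> (g \<circ> pinv q)) = pinv g \<circ> pinv s \<circ> g \<circ> pinv q"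
        by (simp add: pinv_comp[OF g q'] pinv_cancel[OF q] comp_assoc)
      ultimately show "b (pinv q \<circ> (pinv (g \<circ> pinv q) \<circ> pinv s \<circ> (g \<circ> pinv q))) = b (q \<circ> (pinv g \<circ> s \<circ> g))"
        using b_inv[OF w] by simp
    qed
    finally show "(\<Sum>g\<in>perms d. if q \<in> row_group l then b (pinv q \<circ> (pinv g \<circ> pinv s \<circ> g)) else 0) =
        (\<Sum>g\<in>perms d. if q \<in> row_group l then b (q \<circ> (pinv g \<circ> s \<circ> g)) else 0)"
      by (cases "q \<in> row_group l") simp_all
  qed
  also have "\<dots> = (\<Sum>q\<in>perms d. \<Sum>g\<in>perms d. if pinv q \<in> row_group l then b (pinv q \<circ> (pinv g \<circ> s \<circ> g)) else 0)"
    by (rule sum_permutations_inverse)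
  also have "\<dots> = (\<Sum>q\<in>perms d. \<Sum>g\<in>perms d. if q \<in> row_group l then b (pinv q \<circ> (pinv g \<circ> s \<circ> g)) else 0)"
  proof (intro sum.cong refl)
    fix q g assume "q \<in> perms d"
    then have q: "q permutes {..<d}" by simp
    have "pinv q \<in> row_group l \<longleftrightarrow> q \<in> row_group l"
      using row_group_inv[of q l] row_group_inv[of "pinv q" l] by (auto simp: pinv_cancel[OF q])
    then show "(if pinv q \<in> row_group l then b (pinv q \<circ> (pinv g \<circ> s \<circ> g)) else 0) =
       (if q \<in> row_group l then b (pinv q \<circ> (pinv g \<circ> s \<circ> g)) else 0)" by simp
  qed
  also have "\<dots> = conj_sum d (young_symmetrizer l) s"
    unfolding conj_sum_def ys by (rule sum.swap)
  finally show ?thesis .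
qed

text \<open>In the pairings one factor is evaluated at \<open>s\<close> and the other at
  \<open>pinv s\<close>; with both forms at hand an irreducible character can stand in either
  place.\<close>

lemma irr_char_conj_sum:
  assumes l: "l \<in> partitions d" and s: "s permutes {..<d}"
  shows "irr_char l s = conj_sum d (young_symmetrizer l) s / (young_scalar l :: 'k :: field_char_0)"
    and "irr_char l s = conj_sum d (young_symmetrizer l) (pinv s) / (young_scalar l :: 'k :: field_char_0)"
proof -
  show 1: "irr_char l s = conj_sum d (young_symmetrizer l) (pinv s) / (young_scalar l :: 'k)"
    unfolding conj_sum_def by (rule irr_char_formula[OF l s])
  have "sum_list l = d" using l by (simp add: partitions_def)
  then show "irr_char l s = conj_sum d (young_symmetrizer l) s / (young_scalar l :: 'k)"
    unfolding 1 by (simp add: conj_sum_young_inv[OF _ s])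
qed

lemma irr_char_conj:
  assumes l: "l \<in> partitions d" and s: "s permutes {..<d}" and h: "h permutes {..<d}"
  shows "irr_char l (h \<circ> s \<circ> pinv h) = (irr_char l s :: 'k :: field_char_0)"
proof -
  have "h \<circ> s \<circ> pinv h permutes {..<d}" using s h by (intro permutes_compose permutes_inv)
  from irr_char_conj_sum(1)[OF l this, where 'k = 'k] show ?thesis
    unfolding conj_sum_conj[OF h] irr_char_conj_sum(1)[OF l s] .
qed

text \<open>The common source of two relations: with the symmetrizer for \<open>x\<close> it gives
  orthonormality of the irreducible characters, with the indicator of the row group the
  unitriangularity of their pairing with permutation characters.\<close>

lemma irr_char_pairing:
  fixes x :: "(nat \<Rightarrow> nat) \<Rightarrow> 'k :: field_char_0"
  assumes l: "l \<in> partitions d" and m: "m \<in> partitions d"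
    and x: "\<And>p t. p \<in> row_group l \<Longrightarrow> t permutes {..<d} \<Longrightarrow> x (p \<circ> t) = x t"
  shows "\<not> l \<le> m \<Longrightarrow> (\<Sum>s\<in>perms d. conj_sum d x (pinv s) * irr_char m s) = 0"
    and "l = m \<Longrightarrow> (\<Sum>s\<in>perms d. conj_sum d x (pinv s) * irr_char m s)
      = fact d * (\<Sum>t\<in>perms d. x t * young_symmetrizer l (pinv t))"
proof -
  have "(\<Sum>s\<in>perms d. conj_sum d x (pinv s) * irr_char m s)
    = (\<Sum>s\<in>perms d. conj_sum d x (pinv s) * conj_sum d (young_symmetrizer m) s) / young_scalar m"
    unfolding sum_divide_distrib by (intro sum.cong refl) (simp add: irr_char_conj_sum(1)[OF m])
  then have *: "(\<Sum>s\<in>perms d. conj_sum d x (pinv s) * irr_char m s) = fact d *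
     (\<Sum>u\<in>perms d. \<Sum>t\<in>perms d. x t * young_symmetrizer m (pinv u \<circ> pinv t \<circ> u)) / young_scalar m"
    by (simp only: conj_sum_pairing)
  show "\<not> l \<le> m \<Longrightarrow> (\<Sum>s\<in>perms d. conj_sum d x (pinv s) * irr_char m s) = 0"
    unfolding * using young_pairing(1)[OF l m x] by simp
  show "l = m \<Longrightarrow> (\<Sum>s\<in>perms d. conj_sum d x (pinv s) * irr_char m s)
      = fact d * (\<Sum>t\<in>perms d. x t * young_symmetrizer l (pinv t))"
    unfolding * using young_pairing(2)[OF l m x] young_scalar_nonzero[OF m, where 'k = 'k] by simp
qed

text \<open>The vanishing is available only when \<open>l \<le> m\<close> fails. For distinct
  \<open>l\<close> and \<open>m\<close> one of the two comparisons fails, and the sum is symmetric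
  in them.\<close>

lemma irr_char_orthonormal:
  assumes l: "l \<in> partitions d" and m: "m \<in> partitions d"
  shows "(\<Sum>s\<in>perms d. irr_char l s * irr_char m s) = (if l = m then fact d else 0 :: 'k :: field_char_0)"
proof -
  have eq: "(\<Sum>s\<in>perms d. irr_char l s * irr_char m s)
      = (\<Sum>s\<in>perms d. conj_sum d (young_symmetrizer l) (pinv s) * irr_char m s) / (young_scalar l :: 'k)"
    if l: "l \<in> partitions d" for l m
    unfolding sum_divide_distrib
    by (intro sum.cong refl) (simp add: irr_char_conj_sum(2)[OF l])
  have zero: "(\<Sum>s\<in>perms d. irr_char l s * irr_char m s) = (0 :: 'k)"
    if "l \<in> partitions d" "m \<in> partitions d" "\<not> l \<le> m" for l m
    unfolding eq[OF that(1)] using irr_char_pairing(1)[where x = "young_symmetrizer l :: _ \<Rightarrow> 'k", OF that(1,2) young_symmetrizer_left that(3)] by simp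
  show ?thesis
  proof (cases "l = m")
    case True
    have "(\<Sum>t\<in>perms d. young_symmetrizer l t * young_symmetrizer l (pinv t)) = (young_scalar l :: 'k)"
      using l by (simp add: young_scalar_def group_alg_mult_def partitions_def)
    then show ?thesis
      unfolding eq[OF l] using irr_char_pairing(2)[where x = "young_symmetrizer l :: _ \<Rightarrow> 'k", OF l m young_symmetrizer_left True]
        young_scalar_nonzero[OF l, where 'k = 'k] True by simp
  next
    case False
    then consider "\<not> l \<le> m" | "\<not> m \<le> l" by force
    then show ?thesis
    proof cases
      case 1 then show ?thesis using zero[OF l m] False by simp
    next
      case 2 then show ?thesis using zero[OF m l] False by (simp add: mult.commute)
    qed
  qed
qed

section \<open>Pairing permutation characters with irreducible ones\<close>

lemma fn_content_row_of: assumes "l \<in> partitions d" shows "fn_content d (row_of l) = row_content l"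
proof -
  have d: "sum_list l = d" using assms by (simp add: partitions_def)
  have bij: "bij_betw (\<lambda>(i, j). std_entry l i j) (cells l) {..<d}"
    by (rule bij_betw_byWitness[where f' = "\<lambda>x. (row_of l x, col_of l x)"])
       (auto simp: d[symmetric] pos_of row_of_std_entry col_of_std_entry std_entry_less)
  have fin: "finite (cells l)" using bij by (simp add: bij_betw_finite)
  have "mset_set {..<d} = image_mset (\<lambda>(i, j). std_entry l i j) (mset_set (cells l))"
    using bij by (simp add: bij_betw_def image_mset_mset_set)
  then have "fn_content d (row_of l) = image_mset (\<lambda>c. row_of l (case c of (i, j) \<Rightarrow> std_entry l i j)) (mset_set (cells l))"
    unfolding fn_content_def by (simp add: multiset.map_comp comp_def)
  also have "\<dots> = image_mset fst (mset_set (cells l))"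
    using fin by (intro image_mset_cong) (auto simp: row_of_std_entry)
  finally show ?thesis unfolding row_content_def .
qed

text \<open>Orbit counting: the functions with content \<open>row_content l\<close> are the \<open>row_of l \<circ> pinv g\<close>, each of
  them obtained from as many \<open>g\<close> as the row group has elements.\<close>

lemma perm_char_conj_sum:
  assumes l: "l \<in> partitions d" and s: "s permutes {..<d}"
  shows "of_nat (perm_char d (row_content l) s) * of_nat (card (row_group l)) = 
    conj_sum d (\<lambda>p. if p \<in> row_group l then 1 else 0 :: 'k :: field_char_0) s"
proof -
  have d: "sum_list l = d" using l by (simp add: partitions_def)
  define F where "F = {f \<in> fixed_fns d s. fn_content d f = row_content l}"
  have finP: "finite (perms d)" by (simp add: finite_permutations)
  have finF: "finite F" unfolding F_def by (rule finite_fixed_fns)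
  have fiber: "card {g \<in> perms d. \<forall>i<d. f i = row_of l (pinv g i)} = card (row_group l)" if f: "f \<in> F" for f
  proof -
    have "fn_content d f = fn_content d (row_of l)" using f fn_content_row_of[OF l] unfolding F_def by simp
    then obtain t where t: "t permutes {..<d}" "\<forall>i<d. f i = row_of l (t i)" unfolding fn_content_eq_iff by blast
    have "bij_betw (\<lambda>g. t \<circ> g) {g \<in> perms d. \<forall>i<d. f i = row_of l (pinv g i)} (row_group l)"
    proof (rule bij_betw_byWitness[where f' = "\<lambda>p. pinv t \<circ> p"])
      show "(\<lambda>g. t \<circ> g) ` {g \<in> perms d. \<forall>i<d. f i = row_of l (pinv g i)} \<subseteq> row_group l"
      proof (rule image_subsetI)
        fix g assume "g \<in> {g \<in> perms d. \<forall>i<d. f i = row_of l (pinv g i)}"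
        then have g: "g permutes {..<d}" "\<forall>i<d. f i = row_of l (pinv g i)" by auto
        have "row_of l (t (g x)) = row_of l x" if "x < d" for x
        proof -
          have gx: "g x < d" using permutes_less_iff[OF g(1)] that by simp
          have "row_of l (t (g x)) = f (g x)" using t(2) gx by simp
          also have "\<dots> = row_of l (pinv g (g x))" using g(2) gx by blast
          finally show ?thesis by (simp add: permutes_inverses[OF g(1)])
        qed
        then show "t \<circ> g \<in> row_group l" unfolding row_group_iff d using permutes_compose[OF g(1) t(1)] by simp
      qed
      show "(\<lambda>p. pinv t \<circ> p) ` row_group l \<subseteq> {g \<in> perms d. \<forall>i<d. f i = row_of l (pinv g i)}"
      proof (rule image_subsetI)
        fix p assume p: "p \<in> row_group l"
        have pp: "p permutes {..<d}" using row_group_permutes[OF p] d by simp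
        have "row_of l (pinv (pinv t \<circ> p) i) = f i" if "i < d" for i
        proof -
          have "pinv (pinv t \<circ> p) i = pinv p (t i)"
            by (simp add: pinv_comp[OF permutes_inv[OF t(1)] pp] pinv_cancel[OF t(1)])
          moreover have "t i < d" using permutes_less_iff[OF t(1)] that by simp
          ultimately show ?thesis using row_group_inv[OF p] t(2) that unfolding row_group_iff d by simp
        qed
        then show "pinv t \<circ> p \<in> {g \<in> perms d. \<forall>i<d. f i = row_of l (pinv g i)}"
          using permutes_compose[OF pp permutes_inv[OF t(1)]] by simp
      qed
    qed (auto simp: pinv_cancel[OF t(1)])
    then show ?thesis by (rule bij_betw_same_card)
  qed
  have "perm_char d (row_content l) s * card (row_group l) = (\<Sum>f\<in>F. \<Sum>g | g \<in> perms d \<and> (\<forall>i<d. f i = row_of l (pinv g i)). 1)"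
    using fiber by (simp add: perm_char_def F_def)
  also have "\<dots> = (\<Sum>g\<in>perms d. \<Sum>f | f \<in> F \<and> (\<forall>i<d. f i = row_of l (pinv g i)). 1)"
    by (rule sum.swap_restrict[OF finF finP])
  also have "\<dots> = (\<Sum>g\<in>perms d. if pinv g \<circ> s \<circ> g \<in> row_group l then 1 else 0)"
  proof (rule sum.cong[OF refl])
    fix g assume "g \<in> perms d"
    then have g: "g permutes {..<d}" by simp
    define r where "r = restrict (row_of l \<circ> pinv g) {..<d}"
    have lt: "x < d \<Longrightarrow> g x < d" "x < d \<Longrightarrow> pinv g x < d" "x < d \<Longrightarrow> s x < d" for x
      using permutes_less_iff[OF g] permutes_less_iff[OF permutes_inv[OF g]] permutes_less_iff[OF s] by auto
    have rF: "r \<in> F \<longleftrightarrow> pinv g \<circ> s \<circ> g \<in> row_group l"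
    proof -
      have "fn_content d r = row_content l"
        unfolding r_def fn_content_restrict_comp[OF permutes_inv[OF g]] by (rule fn_content_row_of[OF l])
      then have "r \<in> F \<longleftrightarrow> (\<forall>i<d. row_of l (pinv g (s i)) = row_of l (pinv g i))"
        unfolding F_def fixed_fns_def r_def using lt by auto
      also have "\<dots> \<longleftrightarrow> (\<forall>x<d. row_of l (pinv g (s (g x))) = row_of l x)"
      proof (intro iffI allI impI)
        fix x assume h: "\<forall>i<d. row_of l (pinv g (s i)) = row_of l (pinv g i)" and "x < d"
        then show "row_of l (pinv g (s (g x))) = row_of l x"
          using lt(1)[of x] by (simp add: permutes_inverses[OF g])
      next
        fix i assume h: "\<forall>x<d. row_of l (pinv g (s (g x))) = row_of l x" and "i < d"
        then have "row_of l (pinv g (s (g (pinv g i)))) = row_of l (pinv g i)" using lt(2)[of i] by blast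
        then show "row_of l (pinv g (s i)) = row_of l (pinv g i)" by (simp add: permutes_inverses[OF g])
      qed
      also have "\<dots> \<longleftrightarrow> pinv g \<circ> s \<circ> g \<in> row_group l"
        unfolding row_group_iff d using permutes_compose[OF permutes_compose[OF g s] permutes_inv[OF g]]
        by (simp add: comp_assoc)
      finally show ?thesis .
    qed
    have uniq: "f = r" if "f \<in> F" "\<forall>i<d. f i = row_of l (pinv g i)" for f
    proof
      fix i show "f i = r i"
        using that unfolding F_def fixed_fns_def r_def by (cases "i < d") (simp_all add: PiE_def extensional_def)
    qed
    have "\<forall>i<d. r i = row_of l (pinv g i)" unfolding r_def by simp
    then have "{f \<in> F. \<forall>i<d. f i = row_of l (pinv g i)} = (if pinv g \<circ> s \<circ> g \<in> row_group l then {r} else {})"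
      using uniq rF by (auto split: if_splits)
    then show "(\<Sum>f | f \<in> F \<and> (\<forall>i<d. f i = row_of l (pinv g i)). 1) = (if pinv g \<circ> s \<circ> g \<in> row_group l then 1 else 0 :: nat)"
      by simp
  qed
  finally have "of_nat (perm_char d (row_content l) s * card (row_group l)) =
    (of_nat (\<Sum>g\<in>perms d. if pinv g \<circ> s \<circ> g \<in> row_group l then 1 else 0) :: 'k)" by (rule arg_cong)
  then show ?thesis unfolding conj_sum_def by (simp only: of_nat_mult of_nat_sum if_distrib[of of_nat] of_nat_1 of_nat_0)
qed

text \<open>Up to the order of the row group, the permutation character is the
  \<open>conj_sum\<close> of the indicator of that group, so \<open>irr_char_pairing\<close>
  applies. For equal shapes the symmetrizer is 1 on the row group, which again contributes its
  order, and the two cancel.\<close>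

lemma perm_char_irr_char:
  assumes l: "l \<in> partitions d" and m: "m \<in> partitions d"
  shows "\<not> l \<le> m \<Longrightarrow> (\<Sum>s\<in>perms d. of_nat (perm_char d (row_content l) s) * irr_char m s) = (0 :: 'k :: field_char_0)"
    and "(\<Sum>s\<in>perms d. of_nat (perm_char d (row_content l) s) * irr_char l s) = (fact d :: 'k)"
proof -
  have d: "sum_list l = d" using l by (simp add: partitions_def)
  let ?a = "\<lambda>p. if p \<in> row_group l then 1 else 0 :: 'k"
  let ?R = "of_nat (card (row_group l)) :: 'k"
  have sub: "row_group l \<subseteq> perms d" using row_group_permutes[of _ l] d by auto
  have "finite (row_group l)" using finite_subset[OF sub] by (simp add: finite_permutations)
  then have R: "?R \<noteq> 0" using id_in_row_group[of l] by auto
  have eq: "(\<Sum>s\<in>perms d. of_nat (perm_char d (row_content l) s) * irr_char m s) * ?R = (\<Sum>s\<in>perms d. conj_sum d ?a (pinv s) * irr_char m s)" for m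
    unfolding sum_distrib_right
  proof (rule sum.cong[OF refl])
    fix s assume "s \<in> perms d"
    then have s: "s permutes {..<d}" by simp
    have "conj_sum d ?a (pinv s) = of_nat (perm_char d (row_content l) s) * ?R"
      using perm_char_conj_sum[OF l permutes_inv[OF s], where 'k = 'k] by (simp add: perm_char_inv[OF s])
    then show "of_nat (perm_char d (row_content l) s) * irr_char m s * ?R = conj_sum d ?a (pinv s) * irr_char m s"
      by (simp add: mult_ac)
  qed
  have inv: "?a (p \<circ> t) = ?a t" if "p \<in> row_group l" "t permutes {..<d}" for p t
    using row_group_comp_left[OF that(1)] that(2) d by simp
  show "(\<Sum>s\<in>perms d. of_nat (perm_char d (row_content l) s) * irr_char m s) = (0 :: 'k)" if "\<not> l \<le> m"
    using irr_char_pairing(1)[OF l m inv that] eq[of m] R by simp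
  have "(\<Sum>t\<in>perms d. ?a t * young_symmetrizer l (pinv t)) = (\<Sum>t\<in>perms d. ?a t)"
  proof (intro sum.cong refl)
    fix t
    have "young_symmetrizer l (pinv t) = (1 :: 'k)" if "t \<in> row_group l"
      using young_symmetrizer_left[OF row_group_inv[OF that], of id, where 'a = 'k] by (simp add: young_symmetrizer_id)
    then show "?a t * young_symmetrizer l (pinv t) = ?a t" by simp
  qed
  also have "\<dots> = ?R" using sub by (simp add: sum.If_cases finite_permutations Int_absorb1)
  finally have "(\<Sum>s\<in>perms d. conj_sum d ?a (pinv s) * irr_char l s) = fact d * ?R"
    using irr_char_pairing(2)[OF l l inv refl] by simp
  then show "(\<Sum>s\<in>perms d. of_nat (perm_char d (row_content l) s) * irr_char l s) = (fact d :: 'k)"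
    using eq[of l] R by simp
qed

section \<open>Cycle types\<close>

definition cycle_product :: "nat list list \<Rightarrow> nat \<Rightarrow> nat" where
  "cycle_product cs = foldr (\<circ>) (map cycle_of_list cs) id"

lemma cycle_product_simps: "cycle_product [] = id" "cycle_product (c # cs) = cycle_of_list c \<circ> cycle_product cs"
  by (simp_all add: cycle_product_def)

lemma cycle_product_permutes: "cycle_product cs permutes set (concat cs)"
proof (induction cs)
  case (Cons c cs)
  have "cycle_of_list c permutes set (concat (c # cs))" by (rule permutes_subset[OF cycle_permutes]) simp
  moreover have "cycle_product cs permutes set (concat (c # cs))" by (rule permutes_subset[OF Cons.IH]) simp
  ultimately show ?case by (simp only: cycle_product_simps permutes_compose)
qed (simp add: cycle_product_simps id_def)

lemma cycle_product_apply:
  assumes "distinct (concat cs)" "c \<in> set cs" "x \<in> set c"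
  shows "cycle_product cs x = cycle_of_list c x"
  using assms
proof (induction cs)
  case (Cons c0 cs)
  show ?case
  proof (cases "x \<in> set c0")
    case True
    then have x: "x \<notin> set (concat cs)" using Cons.prems(1) by auto
    then have "c = c0" using Cons.prems by auto
    moreover have "cycle_product cs x = x" using permutes_not_in[OF cycle_product_permutes x] .
    ultimately show ?thesis by (simp add: cycle_product_simps)
  next
    case False
    then have c: "c \<in> set cs" using Cons.prems by auto
    have dist: "distinct (concat cs)" "set c0 \<inter> set (concat cs) = {}" using Cons.prems(1) by simp_all
    have "cycle_product cs x = cycle_of_list c x" by (rule Cons.IH[OF dist(1) c Cons.prems(3)])
    moreover have "cycle_of_list c x \<in> set c" by (simp add: permutes_in_image[OF cycle_permutes] Cons.prems(3))
    then have "cycle_of_list c x \<in> set (concat cs)" using c by auto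
    then have "cycle_of_list c x \<notin> set c0" using dist(2) by blast
    then have "cycle_of_list c0 (cycle_of_list c x) = cycle_of_list c x" by (rule id_outside_supp)
    ultimately show ?thesis by (simp add: cycle_product_simps)
  qed
qed simp

text \<open>Disjoint cycles commute; this permits sorting them by length, as a cycle type
  requires.\<close>

lemma cycle_product_cong_mset:
  assumes "mset cs = mset cs'" "distinct (concat cs)"
  shows "cycle_product cs = cycle_product cs'" and "distinct (concat cs')" and "set (concat cs) = set (concat cs')"
proof -
  have s: "set cs = set cs'" using assms(1) by (rule mset_eq_setD)
  then show s': "set (concat cs) = set (concat cs')" by simp
  have "sum_list (map mset cs) = sum_list (map mset cs')"
    using assms(1) by (metis mset_map sum_mset_sum_list)
  then have "mset (concat cs) = mset (concat cs')" by (simp only: mset_concat)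
  then show d: "distinct (concat cs')" using assms(2) mset_eq_imp_distinct_iff by blast
  show "cycle_product cs = cycle_product cs'"
  proof
    fix x show "cycle_product cs x = cycle_product cs' x"
    proof (cases "x \<in> set (concat cs)")
      case True
      then obtain c where "c \<in> set cs" "x \<in> set c" by auto
      then show ?thesis using cycle_product_apply[OF assms(2)] cycle_product_apply[OF d] s by simp
    next
      case False
      then show ?thesis using permutes_not_in[OF cycle_product_permutes] s' by metis
    qed
  qed
qed

lemma cycle_product_conj:
  assumes "bij h" "distinct (concat cs)"
  shows "cycle_product (map (map h) cs) = h \<circ> cycle_product cs \<circ> pinv h"
  using assms(2)
proof (induction cs)
  case Nil
  show ?case using assms(1) by (simp add: cycle_product_simps fun_eq_iff bij_is_surj surj_f_inv_f)
next
  case (Cons c cs)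
  have hh: "pinv h (h x) = x" for x using assms(1) by (simp add: bij_is_inj)
  have conj: "cycle_of_list (map h c) = h \<circ> cycle_of_list c \<circ> pinv h"
    using Cons.prems assms(1) by (intro conjugation_of_cycle[symmetric]) auto
  have "cycle_product (map (map h) cs) = h \<circ> cycle_product cs \<circ> pinv h"
    by (rule Cons.IH) (use Cons.prems in simp)
  then show ?case by (simp add: cycle_product_simps conj fun_eq_iff hh)
qed

section \<open>Conjugacy and cycle types\<close>

lemma cycle_product_permutes': "is_cycle_product d m s \<Longrightarrow> s permutes {..<d}"
  unfolding is_cycle_product_def cycle_product_def[symmetric] using cycle_product_permutes by metis

text \<open>Write the two lists of cycles under each other: \<open>h\<close> sends each entry of the
  upper one to the entry below it. Since the representatives \<open>\<sigma> m\<close> are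
  arbitrary, this is what makes class functions depend on the cycle type alone.\<close>

lemma is_cycle_product_conj:
  assumes "is_cycle_product d m s" "is_cycle_product d m s'"
  obtains h where "h permutes {..<d}" "s' = h \<circ> s \<circ> pinv h"
proof -
  obtain cs where cs: "map length cs = m" "distinct (concat cs)" "set (concat cs) = {..<d}" "s = cycle_product cs"
    using assms(1) unfolding is_cycle_product_def cycle_product_def by blast
  obtain cs' where cs': "map length cs' = m" "distinct (concat cs')" "set (concat cs') = {..<d}" "s' = cycle_product cs'"
    using assms(2) unfolding is_cycle_product_def cycle_product_def by blast
  let ?a = "concat cs" and ?b = "concat cs'"
  have len: "length ?a = length ?b" using cs(1) cs'(1) by (simp only: length_concat)
  define ix where "ix = inv_into {..<length ?a} ((!) ?a)"
  have ba: "bij_betw ((!) ?a) {..<length ?a} {..<d}" using bij_betw_nth[OF cs(2) refl] cs(3) by simp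
  have bb: "bij_betw ((!) ?b) {..<length ?a} {..<d}" using bij_betw_nth[OF cs'(2) refl] cs'(3) len by simp
  have "bij_betw ((!) ?b \<circ> ix) {..<d} {..<d}"
    unfolding ix_def by (rule bij_betw_trans[OF bij_betw_inv_into[OF ba] bb])
  define h where "h x = (if x < d then ?b ! ix x else x)" for x
  have "bij_betw h {..<d} {..<d}"
    using \<open>bij_betw ((!) ?b \<circ> ix) {..<d} {..<d}\<close> by (rule bij_betw_cong[THEN iffD1, rotated]) (simp add: h_def)
  then have h: "h permutes {..<d}" by (rule bij_imp_permutes) (simp add: h_def)
  have "map h ?a = ?b"
  proof (rule nth_equalityI)
    fix i assume "i < length (map h ?a)"
    then have i: "i < length ?a" by simp
    have "ix (?a ! i) = i" unfolding ix_def using ba i by (intro inv_into_f_f) (auto simp: bij_betw_def)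
    moreover have "?a ! i < d" using cs(3) nth_mem[OF i] by auto
    ultimately show "map h ?a ! i = ?b ! i" using i by (simp add: h_def)
  qed (simp only: length_map len)
  then have "concat (map (map h) cs) = ?b" by (simp add: map_concat)
  moreover have "length cs = length cs'" using cs(1) cs'(1) by (metis length_map)
  moreover have "length (cs ! i) = length (cs' ! i)" if "i < length cs" for i
    using cs(1) cs'(1) that calculation(2) by (metis nth_map)
  ultimately have "map (map h) cs = cs'" by (intro concat_injective) (auto simp: set_zip)
  then have "s' = h \<circ> s \<circ> pinv h"
    using cycle_product_conj[OF permutes_bij[OF h] cs(2)] cs(4) cs'(4) by simp
  then show ?thesis using that h by blast
qed

text \<open>Empty cycles are dropped, because they would become parts equal to 0 in the cycle
  type.\<close>

lemma cycle_decomp_cycle_product: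
  "cycle_decomp I p \<Longrightarrow> \<exists>cs. distinct (concat cs) \<and> set (concat cs) = I \<and> [] \<notin> set cs \<and> p = cycle_product cs"
proof (induction rule: cycle_decomp.induct)
  case empty
  show ?case by (rule exI[of _ "[]"]) (simp add: cycle_product_simps)
next
  case (comp I p c)
  then obtain cs where cs: "distinct (concat cs)" "set (concat cs) = I" "[] \<notin> set cs" "p = cycle_product cs" by blast
  show ?case
  proof (cases "c = []")
    case True
    then show ?thesis using cs by (intro exI[of _ cs]) simp
  next
    case False
    then show ?thesis using cs comp.hyps by (intro exI[of _ "c # cs"]) (auto simp: cycle_product_simps)
  qed
qed

lemma ex_cycle_type:
  assumes "s permutes {..<d}" shows "\<exists>m\<in>partitions d. is_cycle_product d m s"
proof -
  obtain cs0 where cs0: "distinct (concat cs0)" "set (concat cs0) = {..<d}" "[] \<notin> set cs0" "s = cycle_product cs0"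
    using cycle_decomp_cycle_product[OF cycle_decomposition[OF assms]] by auto
  define cs where "cs = rev (sort_key length cs0)"
  have "mset cs0 = mset cs" unfolding cs_def by simp
  note cs = cycle_product_cong_mset[OF this cs0(1)]
  let ?m = "map length cs"
  have "is_cycle_product d ?m s"
    unfolding is_cycle_product_def cycle_product_def[symmetric] using cs cs0 by (intro exI[of _ cs]) auto
  moreover have "?m \<in> partitions d"
  proof -
    have "sorted_wrt (\<ge>) ?m" unfolding cs_def by (simp only: rev_map[symmetric] sorted_wrt_rev sorted_sort_key)
    moreover have "0 \<notin> set ?m" using cs0(3) unfolding cs_def by auto
    moreover have "sum_list ?m = card (set (concat cs))" using distinct_card[OF cs(2)] by (simp add: length_concat)
    ultimately show ?thesis using cs(3) cs0(2) unfolding partitions_def is_partition_def by simp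
  qed
  ultimately show ?thesis by blast
qed

text \<open>\<open>ctype\<close> picks a cycle type for each permutation. Its fibres partition the
  group, and on the fibre over \<open>m\<close> a class function is constant with value
  \<open>F (\<sigma> m)\<close>. The weights are relative fibre sizes and do not depend on
  \<open>F\<close>.\<close>

lemma sum_class_function:
  fixes \<sigma> :: "nat list \<Rightarrow> nat \<Rightarrow> nat"
  assumes \<sigma>: "\<forall>m\<in>partitions d. is_cycle_product d m (\<sigma> m)"
  obtains w :: "nat list \<Rightarrow> 'k :: field_char_0" where
    "\<And>F :: (nat \<Rightarrow> nat) \<Rightarrow> 'k. (\<And>s h. s permutes {..<d} \<Longrightarrow> h permutes {..<d} \<Longrightarrow> F (h \<circ> s \<circ> pinv h) = F s) \<Longrightarrow>
       (\<Sum>s\<in>perms d. F s) = fact d * (\<Sum>m\<in>partitions d. w m * F (\<sigma> m))"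
proof -
  define ctype where "ctype s = (SOME m. m \<in> partitions d \<and> is_cycle_product d m s)" for s
  have ctype: "ctype s \<in> partitions d \<and> is_cycle_product d (ctype s) s" if "s \<in> perms d" for s
  proof -
    have "\<exists>m. m \<in> partitions d \<and> is_cycle_product d m s" using ex_cycle_type[of s d] that by blast
    then show ?thesis unfolding ctype_def by (rule someI_ex)
  qed
  define w where "w m = of_nat (card {s \<in> perms d. ctype s = m}) / (fact d :: 'k)" for m
  have fin: "finite (perms d)" by (simp add: finite_permutations)
  show ?thesis
  proof (rule that)
    fix F :: "(nat \<Rightarrow> nat) \<Rightarrow> 'k"
    assume F: "\<And>s h. s permutes {..<d} \<Longrightarrow> h permutes {..<d} \<Longrightarrow> F (h \<circ> s \<circ> pinv h) = F s"
    have val: "F (\<sigma> (ctype s)) = F s" if "s \<in> perms d" for s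
    proof -
      have "is_cycle_product d (ctype s) s" "is_cycle_product d (ctype s) (\<sigma> (ctype s))"
        using ctype[OF that] \<sigma> by auto
      then obtain h where h: "h permutes {..<d}" "\<sigma> (ctype s) = h \<circ> s \<circ> pinv h" by (rule is_cycle_product_conj)
      show ?thesis unfolding h(2) using F[OF _ h(1)] that by simp
    qed
    have "(\<Sum>s\<in>perms d. F s) = (\<Sum>s\<in>perms d. F (\<sigma> (ctype s)))" using val by simp
    also have "\<dots> = (\<Sum>m\<in>partitions d. \<Sum>s | s \<in> perms d \<and> ctype s = m. F (\<sigma> (ctype s)))"
      by (rule sum.group[symmetric, OF fin finite_partitions]) (use ctype in auto)
    also have "\<dots> = (\<Sum>m\<in>partitions d. fact d * (w m * F (\<sigma> m)))"
      by (intro sum.cong refl) (simp add: w_def)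
    finally show "(\<Sum>s\<in>perms d. F s) = fact d * (\<Sum>m\<in>partitions d. w m * F (\<sigma> m))"
      by (simp only: sum_distrib_left)
  qed
qed

section \<open>Diagonalization\<close>

text \<open>Row by row: in the sum for the pair \<open>(i, b)\<close> the terms with index below
  \<open>i\<close> agree by induction, those above \<open>i\<close> vanish by triangularity, and the
  term \<open>i\<close> is the entry \<open>(i, b)\<close> itself because of the unit diagonal. This
  works over any field.\<close>

lemma cholesky_unique:
  fixes L K :: "nat \<Rightarrow> nat \<Rightarrow> 'a :: field"
  assumes L: "\<And>i j. j < i \<Longrightarrow> i < n \<Longrightarrow> L i j = 0" "\<And>i. i < n \<Longrightarrow> L i i = 1"
    and K: "\<And>i j. j < i \<Longrightarrow> i < n \<Longrightarrow> K i j = 0" "\<And>i. i < n \<Longrightarrow> K i i = 1"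
    and eq: "\<And>a b. a < n \<Longrightarrow> b < n \<Longrightarrow> (\<Sum>i<n. L i a * L i b) = (\<Sum>i<n. K i a * K i b)"
    and "i < n" "b < n"
  shows "L i b = K i b"
  using \<open>i < n\<close> \<open>b < n\<close>
proof (induction i arbitrary: b rule: less_induct)
  case (less i)
  have "L k i * L k b - K k i * K k b = (if k = i then L i b - K i b else 0)" if "k < n" for k
  proof -
    consider "k < i" | "k = i" | "i < k" by linarith
    then show ?thesis
    proof cases
      case 1 then show ?thesis using less.IH[of k] less.prems that by simp
    next
      case 2 then show ?thesis using L(2) K(2) less.prems by simp
    next
      case 3 then show ?thesis using L(1) K(1) that by simp
    qed
  qed
  then have "(\<Sum>k<n. L k i * L k b - K k i * K k b) = (\<Sum>k<n. if k = i then L i b - K i b else 0)"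
    by (intro sum.cong) auto
  also have "\<dots> = L i b - K i b" using less.prems by simp
  finally show ?case using eq[OF less.prems] by (simp add: sum_subtractf)
qed

lemma mat_index_mult:
  assumes "A \<in> carrier_mat n n" "B \<in> carrier_mat n n" "i < n" "j < n"
  shows "(A * B) $$ (i, j) = (\<Sum>k<n. A $$ (i, k) * B $$ (k, j))"
  using assms by (auto simp: scalar_prod_def lessThan_atLeast0 intro!: sum.cong)

text \<open>With \<open>L = X W \<Phi>\<^sup>T\<close> one gets \<open>\<Phi> = L\<^sup>T X\<close>, so that \<open>L\<^sup>T L = \<Phi> W \<Phi>\<^sup>T = K\<^sup>T K\<close> forces \<open>L = K\<close>.\<close>

lemma orthogonal_diagonalization:
  fixes X :: "'a :: field mat"
  assumes carr: "X \<in> carrier_mat n n" "\<Phi> \<in> carrier_mat n n" "K \<in> carrier_mat n n" "A \<in> carrier_mat n n"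
    and W: "W = mat_diag n w" and D: "D = mat_diag n e"
    and XX: "X * W * transpose_mat X = 1\<^sub>m n"
    and XP: "\<And>i j. j < i \<Longrightarrow> i < n \<Longrightarrow> (X * W * transpose_mat \<Phi>) $$ (i, j) = 0"
      "\<And>i. i < n \<Longrightarrow> (X * W * transpose_mat \<Phi>) $$ (i, i) = 1"
    and K: "\<And>i j. j < i \<Longrightarrow> i < n \<Longrightarrow> K $$ (i, j) = 0" "\<And>i. i < n \<Longrightarrow> K $$ (i, i) = 1"
    and PP: "\<Phi> * W * transpose_mat \<Phi> = transpose_mat K * K"
    and PDP: "\<Phi> * (W * D) * transpose_mat \<Phi> = transpose_mat K * A * K"
  shows "(W * transpose_mat X) * X = 1\<^sub>m n" and "A = X * D * (W * transpose_mat X)"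
proof -
  have carr': "W \<in> carrier_mat n n" "D \<in> carrier_mat n n" unfolding W D by auto
  note carr = carr carr' transpose_carrier_mat mult_carrier_mat
  note assoc = assoc_mult_mat[of _ n n _ n _ n]
  have WT: "transpose_mat W = W" unfolding W mat_diag_def by (rule eq_matI) auto
  have WD: "W * D = D * W" unfolding W D by (simp add: mat_diag_diag mult.commute)
  \<comment> \<open>For square matrices a right inverse is a left inverse: the orthogonality of the
    rows of \<open>X\<close> yields that of its columns.\<close>
  have "X * (W * transpose_mat X) = 1\<^sub>m n" using XX carr by (simp add: assoc)
  then show inv: "(W * transpose_mat X) * X = 1\<^sub>m n"
    by (rule mat_mult_left_right_inverse[rotated 2]) (use carr in auto)
  define L where "L = X * W * transpose_mat \<Phi>"
  have L: "L \<in> carrier_mat n n" unfolding L_def using carr by auto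
  have "transpose_mat ((W * transpose_mat X) * X) = transpose_mat X * (X * W)"
    using carr by (simp add: transpose_mult[of _ n n _ n] WT)
  then have inv2: "transpose_mat X * (X * W) = 1\<^sub>m n" using inv by simp
  have "transpose_mat X * L = (transpose_mat X * (X * W)) * transpose_mat \<Phi>"
    unfolding L_def using carr by (simp add: assoc)
  then have PT: "transpose_mat \<Phi> = transpose_mat X * L" unfolding inv2 using carr by simp
  have "\<Phi> = transpose_mat (transpose_mat X * L)" unfolding PT[symmetric] by simp
  then have P: "\<Phi> = transpose_mat L * X" using carr L by (simp add: transpose_mult[of _ n n _ n])
  \<comment> \<open>Replaces the permutation characters by \<open>L\<close> around any middle
    matrix; it is used with \<open>Z = W\<close>, where \<open>X\<close> cancels, and with
    \<open>Z = W * D\<close>, where the matrix to be compared with \<open>A\<close> appears.\<close>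
  have sandwich: "\<Phi> * Z * transpose_mat \<Phi> = transpose_mat L * (X * Z * transpose_mat X) * L"
    if "Z \<in> carrier_mat n n" for Z
    unfolding PT unfolding P using that carr L by (simp add: assoc)
  have LL: "transpose_mat L * L = transpose_mat K * K"
    using sandwich[OF carr'(1)] L unfolding PP XX by simp
  have "L $$ (i, j) = K $$ (i, j)" if "i < n" "j < n" for i j
  proof (rule cholesky_unique[of n "\<lambda>i j. L $$ (i, j)" "\<lambda>i j. K $$ (i, j)"])
    fix a b assume ab: "a < n" "b < n"
    have tr: "(transpose_mat M * M) $$ (a, b) = (\<Sum>i<n. M $$ (i, a) * M $$ (i, b))" if "M \<in> carrier_mat n n" for M :: "'a mat"
      using that ab by (subst mat_index_mult[of _ n]) auto
    show "(\<Sum>i<n. L $$ (i, a) * L $$ (i, b)) = (\<Sum>i<n. K $$ (i, a) * K $$ (i, b))"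
      using tr[OF L] tr[OF carr(3)] LL by simp
  qed (use XP K that L_def in auto)
  then have LK: "L = K" using L carr(3) by (intro eq_matI) auto
  \<comment> \<open>The determinant is 1, so \<open>L\<close> is invertible and can be cancelled on
    both sides of the equation containing \<open>A\<close>.\<close>
  have "upper_triangular L" using XP(1) L unfolding L_def[symmetric] by (intro upper_triangularI) auto
  then have "det L = prod_list (diag_mat L)" by (rule det_upper_triangular[OF _ L])
  also have "diag_mat L = map (\<lambda>i. 1) [0..<n]"
    using XP(2) L unfolding diag_mat_def L_def[symmetric] by (intro map_cong) auto
  also have "prod_list (map (\<lambda>i. 1) [0..<n]) = (1 :: 'a)" by (induction n) auto
  finally have "det L \<noteq> 0" by simp
  from det_non_zero_imp_unit[OF L this, of "()"]
  obtain L' where L': "L' \<in> carrier_mat n n" "L' * L = 1\<^sub>m n" "L * L' = 1\<^sub>m n"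
    unfolding Units_def ring_mat_def by auto
  have LT: "transpose_mat L' * transpose_mat L = 1\<^sub>m n"
    using arg_cong[OF L'(3), of transpose_mat] L L'(1) by (simp add: transpose_mult[of _ n n _ n])
  have cancel: "transpose_mat L' * (transpose_mat L * Z * L) * L' = Z" if Z: "Z \<in> carrier_mat n n" for Z
  proof -
    have "transpose_mat L' * (transpose_mat L * Z * L) * L' = (transpose_mat L' * transpose_mat L) * Z * (L * L')"
      using L L'(1) Z by (simp add: assoc)
    then show ?thesis unfolding LT L'(3) using Z by simp
  qed
  have eq: "transpose_mat L * (X * (W * D) * transpose_mat X) * L = transpose_mat L * A * L"
    using sandwich[of "W * D"] carr' PDP unfolding LK by simp
  have "X * (W * D) * transpose_mat X \<in> carrier_mat n n"
    using carr by (intro mult_carrier_mat[of _ n n _ n]) auto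
  from cancel[OF this] have "X * (W * D) * transpose_mat X = A"
    unfolding eq cancel[OF carr(4)] by (rule sym)
  then have "A = X * (D * W) * transpose_mat X" unfolding WD by (rule sym)
  also have "X * (D * W) = X * D * W"
    by (rule assoc_mult_mat[OF carr(1) carr'(2) carr'(1), symmetric])
  also have "X * D * W * transpose_mat X = X * D * (W * transpose_mat X)"
    using carr(1) carr' by (intro assoc_mult_mat[of _ n n _ n _ n] mult_carrier_mat[of _ n n _ n]) simp_all
  finally show "A = X * D * (W * transpose_mat X)" .
qed

section \<open>From sums over the group to matrices\<close>

lemma card_coloured_contingency_1: "card (coloured_contingency 1 A B) = card (contingency A B)"
proof -
  have "bij_betw (image_mset (\<lambda>(a, b). (a, b, 0))) (contingency A B) (coloured_contingency 1 A B)"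
  proof (rule bij_betw_byWitness[where f' = "image_mset (\<lambda>p. (fst p, fst (snd p)))"])
    show "\<forall>M\<in>contingency A B. image_mset (\<lambda>p. (fst p, fst (snd p))) (image_mset (\<lambda>(a, b). (a, b, 0 :: nat)) M) = M"
      by (auto simp: multiset.map_comp comp_def case_prod_unfold)
    show "\<forall>M\<in>coloured_contingency 1 A B. image_mset (\<lambda>(a, b). (a, b, 0)) (image_mset (\<lambda>p. (fst p, fst (snd p))) M) = M"
      unfolding coloured_contingency_def multiset.map_comp
      by (intro ballI multiset.map_ident_strong) auto
    show "image_mset (\<lambda>(a, b). (a, b, 0)) ` contingency A B \<subseteq> coloured_contingency 1 A B"
      unfolding contingency_def coloured_contingency_def
      by (auto simp: multiset.map_comp comp_def case_prod_unfold)
    show "image_mset (\<lambda>p. (fst p, fst (snd p))) ` coloured_contingency 1 A B \<subseteq> contingency A B"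
      unfolding contingency_def coloured_contingency_def
      by (auto simp: multiset.map_comp comp_def)
  qed
  then show ?thesis by (rule bij_betw_same_card[symmetric])
qed

lemma partition_list_props:
  shows "bij_betw (\<lambda>i. partition_list d ! i) {..<num_partitions d} (partitions d)"
    and "i < j \<Longrightarrow> j < num_partitions d \<Longrightarrow> partition_list d ! j < partition_list d ! i"
proof -
  have len: "length (partition_list d) = num_partitions d"
    by (simp add: partition_list_def num_partitions_def)
  have set: "set (partition_list d) = partitions d" by (simp add: partition_list_def finite_partitions)
  have "distinct (partition_list d)" by (simp add: partition_list_def)
  from bij_betw_nth[OF this _ set[symmetric]] show "bij_betw (\<lambda>i. partition_list d ! i) {..<num_partitions d} (partitions d)"
    by (simp add: len)
  have "sorted_wrt (>) (partition_list d)"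
    unfolding partition_list_def sorted_wrt_rev by (simp add: strict_sorted_iff)
  then show "i < j \<Longrightarrow> j < num_partitions d \<Longrightarrow> partition_list d ! j < partition_list d ! i"
    using len by (simp add: sorted_wrt_iff_nth_less)
qed

theorem corollary9p10:
  fixes n d :: nat
    and \<sigma> :: "nat list \<Rightarrow> nat \<Rightarrow> nat"
    and X :: "'k :: field_char_0 mat"
  assumes "n > 0" and "d > 0"
    and "\<forall>m\<in>partitions d. is_cycle_product d m (\<sigma> m)"
    and "X = char_table d \<sigma>"
  shows "\<exists>Xinv D. Xinv \<in> carrier_mat (num_partitions d) (num_partitions d) \<and>
           inverts_mat X Xinv \<and> inverts_mat Xinv X \<and>
           D \<in> carrier_mat (num_partitions d) (num_partitions d) \<and> diagonal_mat D \<and>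
           (\<forall>i < num_partitions d. \<exists>k. D $$ (i, i) = of_nat n ^ k) \<and>
           A_mat n d = X * D * Xinv"
proof -
  define N where "N = num_partitions d"
  define lam where "lam i = partition_list d ! i" for i
  have bij: "bij_betw lam {..<N} (partitions d)"
    unfolding lam_def N_def by (rule partition_list_props(1))
  have part: "lam i \<in> partitions d" if "i < N" for i using bij that by (auto simp: bij_betw_def)
  \<comment> \<open>Positions run from the largest partition to the smallest, so that a condition
    \<open>m \<le> l\<close> on partitions becomes upper triangularity of a matrix.\<close>
  have less: "lam j < lam i" if "i < j" "j < N" for i j
    using partition_list_props(2) that unfolding lam_def N_def by blast
  have inj: "lam i = lam j \<longleftrightarrow> i = j" if "i < N" "j < N" for i j
    using bij that by (auto simp: bij_betw_def inj_on_def)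
  have reindex: "(\<Sum>i<N. f (lam i)) = (\<Sum>l\<in>partitions d. f l)" for f :: "nat list \<Rightarrow> 'k"
    by (rule sum.reindex_bij_betw[OF bij])
  have perm: "\<sigma> m permutes {..<d}" if "m \<in> partitions d" for m
    using assms(3) that cycle_product_permutes' by blast
  obtain w :: "nat list \<Rightarrow> 'k" where w:
    "\<And>F. (\<And>s h. s permutes {..<d} \<Longrightarrow> h permutes {..<d} \<Longrightarrow> F (h \<circ> s \<circ> pinv h) = F s) \<Longrightarrow>
       (\<Sum>s\<in>perms d. F s) = fact d * (\<Sum>m\<in>partitions d. w m * F (\<sigma> m))"
    using sum_class_function[OF assms(3)] by blast
  define col where "col s = (of_nat (colour_char d n s) :: 'k)" for s
  define ph where "ph l s = (of_nat (perm_char d (row_content l) s) :: 'k)" for l s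
  define \<Phi> where "\<Phi> = mat N N (\<lambda>(i, j). ph (lam i) (\<sigma> (lam j)))"
  define K where "K = mat N N (\<lambda>(i, j). of_int (schur (lam i) (row_content (lam j))) :: 'k)"
  define W where "W = mat_diag N (\<lambda>i. w (lam i))"
  define D where "D = mat_diag N (\<lambda>i. col (\<sigma> (lam i)))"
  define cls where "cls F \<longleftrightarrow> (\<forall>s h. s permutes {..<d} \<longrightarrow> h permutes {..<d} \<longrightarrow> F (h \<circ> s \<circ> pinv h) = F s)"
    for F :: "(nat \<Rightarrow> nat) \<Rightarrow> 'k"
  have X: "X = mat N N (\<lambda>(i, j). irr_char (lam i) (\<sigma> (lam j)))"
    unfolding assms(4) char_table_def N_def lam_def ..
  have A: "A_mat n d = mat N N (\<lambda>(i, j). of_int (a_coeff n (lam i) (lam j)) :: 'k)"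
    unfolding A_mat_def N_def lam_def ..
  have cls_irr: "cls (irr_char l)" if "l \<in> partitions d" for l
    unfolding cls_def using irr_char_conj[OF that] by blast
  have cls_ph: "cls (ph l)" for l unfolding cls_def ph_def by (simp add: perm_char_conj)
  have cls_col: "cls col" unfolding cls_def col_def by (simp add: colour_char_conj)
  have cls_mult: "cls (\<lambda>s. F s * G s)" if "cls F" "cls G" for F G using that unfolding cls_def by simp
  \<comment> \<open>Every matrix product needed below is an instance: the class weights turn a sum
    over cycle types into an average over the group. The extra class function \<open>c\<close> is
    constantly 1 or counts fixed colourings.\<close>
  have entry: "(mat N N (\<lambda>(i, j). f (lam i) (\<sigma> (lam j))) * mat_diag N (\<lambda>i. w (lam i) * c (\<sigma> (lam i))) *
      transpose_mat (mat N N (\<lambda>(i, j). g (lam i) (\<sigma> (lam j))))) $$ (a, b)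
      = (\<Sum>s\<in>perms d. f (lam a) s * g (lam b) s * c s) / fact d"
    if "a < N" "b < N" "cls (f (lam a))" "cls (g (lam b))" "cls c" for f g c a b
  proof -
    have "(mat N N (\<lambda>(i, j). f (lam i) (\<sigma> (lam j))) * mat_diag N (\<lambda>i. w (lam i) * c (\<sigma> (lam i))) *
      transpose_mat (mat N N (\<lambda>(i, j). g (lam i) (\<sigma> (lam j))))) $$ (a, b)
      = (\<Sum>k<N. f (lam a) (\<sigma> (lam k)) * (w (lam k) * c (\<sigma> (lam k))) * g (lam b) (\<sigma> (lam k)))"
      using that(1,2) by (subst mat_index_mult[of _ N]) (auto simp: mat_diag_mult_right[of _ N N])
    also have "\<dots> = (\<Sum>k<N. w (lam k) * (f (lam a) (\<sigma> (lam k)) * g (lam b) (\<sigma> (lam k)) * c (\<sigma> (lam k))))"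
      by (intro sum.cong refl) (simp add: mult_ac)
    also have "\<dots> = (\<Sum>m\<in>partitions d. w m * (f (lam a) (\<sigma> m) * g (lam b) (\<sigma> m) * c (\<sigma> m)))"
      by (rule reindex)
    also have "\<dots> = (\<Sum>s\<in>perms d. f (lam a) s * g (lam b) s * c s) / fact d"
      using w[of "\<lambda>s. f (lam a) s * g (lam b) s * c s"] cls_mult[OF cls_mult[OF that(3,4)] that(5)]
      unfolding cls_def by simp
    finally show ?thesis .
  qed
  \<comment> \<open>The factor 1 brings \<open>W\<close> into the form of \<open>entry\<close> with
    \<open>c\<close> constantly 1.\<close>
  have W1: "W = mat_diag N (\<lambda>i. w (lam i) * 1)" unfolding W_def by simp
  have WD: "W * D = mat_diag N (\<lambda>i. w (lam i) * col (\<sigma> (lam i)))" unfolding W_def D_def by (simp add: mat_diag_diag)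
  have cls_1: "cls (\<lambda>_. 1)" unfolding cls_def by simp
  have size: "size (row_content (lam i)) = d" if "i < N" for i
    using part[OF that] size_content[of "lam i"] by (simp add: partitions_def)
  have is_part: "is_partition (lam i)" if "i < N" for i using part[OF that] by (simp add: partitions_def)
  have XX: "X * W * transpose_mat X = 1\<^sub>m N"
  proof (rule eq_matI)
    fix i j assume "i < dim_row (1\<^sub>m N :: 'k mat)" "j < dim_col (1\<^sub>m N :: 'k mat)"
    then have ij: "i < N" "j < N" by auto
    show "(X * W * transpose_mat X) $$ (i, j) = 1\<^sub>m N $$ (i, j)"
      unfolding X W1 entry[where f = irr_char and g = irr_char and c = "\<lambda>_. 1", OF ij cls_irr[OF part[OF ij(1)]] cls_irr[OF part[OF ij(2)]] cls_1]
      using ij irr_char_orthonormal[OF part[OF ij(1)] part[OF ij(2)], where 'k = 'k] inj[OF ij] by simp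
  qed (simp_all add: X W_def)
  have XP: "(X * W * transpose_mat \<Phi>) $$ (i, j) = (\<Sum>s\<in>perms d. ph (lam j) s * irr_char (lam i) s) / fact d"
    if ij: "i < N" "j < N" for i j
    unfolding X W1 \<Phi>_def entry[where f = irr_char and g = ph and c = "\<lambda>_. 1", OF ij cls_irr[OF part[OF ij(1)]] cls_ph cls_1] by (simp add: mult.commute)
  have kk: "(\<Sum>s\<in>perms d. ph (lam i) s * ph (lam j) s * of_nat (colour_char d r s)) / fact d
     = (of_nat (card (coloured_contingency r (row_content (lam i)) (row_content (lam j)))) :: 'k)" if "i < N" "j < N" for i j r
    unfolding ph_def of_nat_mult[symmetric] of_nat_sum[symmetric] perm_char_sum[OF size[OF that(1)] size[OF that(2)]]
    by simp
  have PP: "\<Phi> * W * transpose_mat \<Phi> = transpose_mat K * K"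
  proof (rule eq_matI)
    fix i j assume "i < dim_row (transpose_mat K * K)" "j < dim_col (transpose_mat K * K)"
    then have ij: "i < N" "j < N" by (auto simp: K_def)
    \<comment> \<open>A single colour admits only one colouring, so the identity for
      \<open>n = 1\<close> has no colour factor.\<close>
    have col1: "colour_char d 1 s = 1" if "s \<in> perms d" for s
      using colour_char_power[of s d 1] that by auto
    have "(\<Phi> * W * transpose_mat \<Phi>) $$ (i, j) = (\<Sum>s\<in>perms d. ph (lam i) s * ph (lam j) s * of_nat (colour_char d 1 s)) / fact d"
      unfolding \<Phi>_def W1 entry[where f = ph and g = ph and c = "\<lambda>_. 1", OF ij cls_ph cls_ph cls_1] using col1 by simp
    also have "\<dots> = of_int (int (card (contingency (row_content (lam i)) (row_content (lam j)))))"
      unfolding kk[OF ij] card_coloured_contingency_1 by simp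
    also have "int (card (contingency (row_content (lam i)) (row_content (lam j)))) =
        (\<Sum>l\<in>partitions d. schur l (row_content (lam i)) * schur l (row_content (lam j)))"
      using schur_cauchy[where A = "row_content (lam i)" and B = "row_content (lam j)"] size[OF ij(2)] by simp
    also have "(of_int (\<Sum>l\<in>partitions d. schur l (row_content (lam i)) * schur l (row_content (lam j))) :: 'k) = (\<Sum>k<N. of_int (schur (lam k) (row_content (lam i))) * of_int (schur (lam k) (row_content (lam j))))"
      using reindex[of "\<lambda>l. of_int (schur l (row_content (lam i)) * schur l (row_content (lam j)))"] by simp
    also have "\<dots> = (transpose_mat K * K) $$ (i, j)"
      using ij by (subst mat_index_mult[of _ N]) (auto simp: K_def)
    finally show "(\<Phi> * W * transpose_mat \<Phi>) $$ (i, j) = (transpose_mat K * K) $$ (i, j)" .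
  qed (simp_all add: \<Phi>_def K_def)
  have PDP: "\<Phi> * (W * D) * transpose_mat \<Phi> = transpose_mat K * A_mat n d * K"
  proof (rule eq_matI)
    fix i j assume "i < dim_row (transpose_mat K * A_mat n d * K)" "j < dim_col (transpose_mat K * A_mat n d * K)"
    then have ij: "i < N" "j < N" by (auto simp: K_def)
    have "(\<Phi> * (W * D) * transpose_mat \<Phi>) $$ (i, j) = (\<Sum>s\<in>perms d. ph (lam i) s * ph (lam j) s * of_nat (colour_char d n s)) / fact d"
      unfolding \<Phi>_def WD entry[where f = ph and g = ph and c = col, OF ij cls_ph cls_ph cls_col] unfolding col_def ..
    also have "\<dots> = of_int (\<Sum>l\<in>partitions d. \<Sum>m\<in>partitions d. schur l (row_content (lam i)) * a_coeff n l m * schur m (row_content (lam j)))"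
      unfolding kk[OF ij] a_coeff_generating[OF size[OF ij(1)] size[OF ij(2)]] by simp
    also have "\<dots> = (\<Sum>l\<in>partitions d. \<Sum>m\<in>partitions d. of_int (schur l (row_content (lam i))) * of_int (a_coeff n l m) * of_int (schur m (row_content (lam j))))"
      by simp
    also have "\<dots> = (\<Sum>k<N. \<Sum>k'<N. of_int (schur (lam k) (row_content (lam i))) * of_int (a_coeff n (lam k) (lam k')) * of_int (schur (lam k') (row_content (lam j))))"
      unfolding reindex[symmetric] ..
    also have "\<dots> = (\<Sum>k'<N. (\<Sum>k<N. of_int (schur (lam k) (row_content (lam i))) * of_int (a_coeff n (lam k) (lam k'))) * of_int (schur (lam k') (row_content (lam j))))"
      unfolding sum_distrib_right by (rule sum.swap)
    also have "\<dots> = (\<Sum>k'<N. (transpose_mat K * A_mat n d) $$ (i, k') * K $$ (k', j))"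
    proof (rule sum.cong[OF refl])
      fix k' assume "k' \<in> {..<N}"
      then have k': "k' < N" by simp
      have "(transpose_mat K * A_mat n d) $$ (i, k') = (\<Sum>k<N. transpose_mat K $$ (i, k) * A_mat n d $$ (k, k'))"
        using ij k' by (intro mat_index_mult) (auto simp: K_def A)
      also have "\<dots> = (\<Sum>k<N. of_int (schur (lam k) (row_content (lam i))) * of_int (a_coeff n (lam k) (lam k')))"
        using ij k' by (intro sum.cong) (auto simp: K_def A)
      finally show "(\<Sum>k<N. of_int (schur (lam k) (row_content (lam i))) * of_int (a_coeff n (lam k) (lam k'))) * of_int (schur (lam k') (row_content (lam j))) =
         (transpose_mat K * A_mat n d) $$ (i, k') * K $$ (k', j)" using ij k' by (simp add: K_def)
    qed
    also have "\<dots> = (transpose_mat K * A_mat n d * K) $$ (i, j)"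
      using ij by (intro mat_index_mult[symmetric]) (auto simp: K_def A)
    finally show "(\<Phi> * (W * D) * transpose_mat \<Phi>) $$ (i, j) = (transpose_mat K * A_mat n d * K) $$ (i, j)" .
  qed (simp_all add: \<Phi>_def K_def)
  have carr: "X \<in> carrier_mat N N" "\<Phi> \<in> carrier_mat N N" "K \<in> carrier_mat N N" "(A_mat n d :: 'k mat) \<in> carrier_mat N N"
    by (simp_all add: X \<Phi>_def K_def A)
  \<comment> \<open>Row \<open>i\<close> carries the irreducible character and column
    \<open>j\<close> the permutation character. For \<open>j < i\<close> the partition
    \<open>lam j\<close> is the larger one, so \<open>lam j \<le> lam i\<close> fails and the
    pairing vanishes.\<close>
  have XP0: "(X * W * transpose_mat \<Phi>) $$ (i, j) = 0" if "j < i" "i < N" for i j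
    using XP[of i j] perm_char_irr_char(1)[OF part part, of j i, where 'k = 'k] less[OF that] that by (simp add: ph_def)
  have XP1: "(X * W * transpose_mat \<Phi>) $$ (i, i) = 1" if "i < N" for i
    using XP[OF that that] perm_char_irr_char(2)[OF part[OF that] part[OF that], where 'k = 'k] by (simp add: ph_def)
  have K0: "K $$ (i, j) = 0" if "j < i" "i < N" for i j
  proof -
    have "schur (lam i) (row_content (lam j)) = 0"
      using schur_content_triangular[OF is_part is_part, of i j] less[OF that] that by force
    then show ?thesis using that by (simp add: K_def)
  qed
  have K1: "K $$ (i, i) = 1" if "i < N" for i
    using that by (simp add: K_def schur_content_self is_part)
  note main = orthogonal_diagonalization[OF carr W_def D_def XX XP0 XP1 K0 K1 PP PDP]
  define Xinv where "Xinv = W * transpose_mat X"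
  have W: "W \<in> carrier_mat N N" and cD: "D \<in> carrier_mat N N" unfolding W_def D_def by auto
  have Xinv: "Xinv \<in> carrier_mat N N" unfolding Xinv_def using W carr(1) by auto
  have "X * Xinv = 1\<^sub>m N"
    unfolding Xinv_def XX[symmetric] using W carr(1)
    by (intro assoc_mult_mat[of _ N N _ N _ N, symmetric]) auto
  moreover have "Xinv * X = 1\<^sub>m N" unfolding Xinv_def by (rule main(1))
  moreover have "A_mat n d = X * D * Xinv" unfolding Xinv_def by (rule main(2))
  moreover have "\<exists>k. D $$ (i, i) = of_nat n ^ k" if i: "i < N" for i
  proof -
    obtain k where "colour_char d n (\<sigma> (lam i)) = n ^ k" using colour_char_power[OF perm[OF part[OF i]]] by blast
    then have "D $$ (i, i) = of_nat n ^ k" using i by (simp add: D_def mat_diag_def col_def)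
    then show ?thesis ..
  qed
  moreover have "diagonal_mat D" unfolding D_def mat_diag_def diagonal_mat_def by auto
  ultimately show ?thesis
    unfolding N_def[symmetric] inverts_mat_def
    using Xinv cD carr(1) by - (rule exI[where x = Xinv], rule exI[where x = D], auto)
qed

end
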